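(* Let $m=1$. Let $f\in\mathcal C^2(\mathbb R^n,\mathbb R^n)$, $g\in\mathcal C^2(\mathbb R^n,\mathbb R^n)$, $h\in\mathcal C^3(\mathbb R^n,\mathbb R)$, and consider the single-input single-output control system $$\dot x(t)=f(x(t))+g(x(t))u(t),\quad x(t^0)=x^0,\qquad y(t)=h(x(t)). \tag{S}$$ Assume that (S) has (global and strict) relative degree $r=2$, and that there exists a diffeomorphism $\Phi:\mathbb R^n\to\mathbb R^n$ such that the coordinate transformation $\Phi(x(t))=(y(t),\dot y(t),\eta(t))$ puts (S) into Byrnes-Isidori form whose internal dynamics satisfy the bounded-input, bounded-state (BIBS) condition (all as defined in the context). Let $\psi=(\psi_0,\psi_1)\in\mathcal G^1$, $y_{\mathrm{ref}}\in W^{2,\infty}(\mathbb R_{\ge0},\mathbb R)$, $\lambda_u\ge 0$, $t^0\in\mathbb R_{\ge 0}$, $\delta>0$, and let $B\subset\mathcal D_{t^0}$ be a compact set. Then there exist $T>\delta$ and $M>0$ such that the Funnel MPC (FMPC) algorithm (with data $\psi,y_{\mathrm{ref}},\lambda_u,t^0,\delta,T,M$, described in the context) is initially and recursively feasible for every $x^0\in\mathbb R^n$ with $\Phi(x^0)\in B$, i.e. at time $\hat t=t^0$ and at each successor time $\hat t\in t^0+\delta\mathbb N$ the optimal control problem (OCP) solved in the algorithm has a solution. In particular, the closed-loop system consisting of (S) and the FMPC feedback $\mu$ has a (not necessarily unique) global solution $x:[t^0,\infty)\to\mathbb R^n$, and the corresponding input is given by $$u_{\rm FMPC}(t)=\mu(t,x(\hat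 t)),\qquad t\in[\hat t,\hat t+\delta),\ \hat t\in t^0+\delta\mathbb N_0 .$$ Furthermore, each global solution $x$ with corresponding input $u_{\rm FMPC}$ satisfies: (i) $|u_{\rm FMPC}(t)|\le M$ for all $t\ge t^0$. (ii) $|e^{(i)}(t)|<\psi_i(t)$ for all $t\ge t^0$ and $i=0,1$, where $e:=y-y_{\mathrm{ref}}$ and $y=h\circ x$; in particular the error $e$ evolves within the funnel $\mathcal F_{\psi_0}$ and $\dot e$ evolves within the funnel $\mathcal F_{\psi_1}$.
   Context: **Notation.** $\mathbb R_{\ge0}=[0,\infty)$ and $\mathbb N_0=\mathbb N\cup\{0\}$. $\mathcal C^p(V,\mathbb R^k)$ denotes the $p$-times continuously differentiable functions $V\to\mathbb R^k$, and $\mathcal C=\mathcal C^0$. For an interval $I$, $L^\infty(I,\mathbb R^k)$ denotes the measurable essentially bounded functions and $L^\infty_{\rm loc}(I,\mathbb R^k)$ the locally bounded measurable functions. $W^{k,\infty}(I,\mathbb R^l)$ is the Sobolev space of $k$-times weakly differentiable functions whose derivatives of orders $0,\dots,k$ lie in $L^\infty$. $\|\cdot\|$ denotes a norm on $\mathbb R^k$. **Solutions.** Controls are functions $u\in L^\infty_{\rm loc}(\mathbb R_{\ge0},\mathbb R)$. A solution of $\dot x=f(x)+g(x)u$, $x(t^0)=x^0$, is meant in the sense of Carathéodory: an absolutely continuous function $x$ on an interval $[t^0,\omega)$, $\omega>t^0$, with $x(t^0)=x^0$, satisfying the ODE for almost all $t$. The unique maximal solution is denoted $x(\cdot;t^0,x^0,u)$.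 **Relative degree two ($m=1$).** With the Lie derivative $(L_fh)(x)=h'(x)f(x)$ (and similarly for $L_g$), the system has (global and strict) relative degree $2$ if $(L_gh)(x)=0$ and $(L_gL_fh)(x)\neq0$ for all $x\in\mathbb R^n$. **Byrnes-Isidori form.** The transformation $\Phi(x(t))=(y(t),\dot y(t),\eta(t))\in\mathbb R\times\mathbb R\times\mathbb R^{n-2}$ puts the system into Byrnes-Isidori form if in the new coordinates it reads $$\ddot y(t)=p(y(t),\dot y(t),\eta(t))+\gamma(y(t),\dot y(t),\eta(t))\,u(t),\qquad \dot\eta(t)=q(y(t),\dot y(t),\eta(t)),$$ with $(y(t^0),\dot y(t^0),\eta(t^0))=\Phi(x^0)$, $p\in\mathcal C(\mathbb R^n,\mathbb R)$, $q\in\mathcal C(\mathbb R^n,\mathbb R^{n-2})$ and $\gamma=(L_gL_fh)\circ\Phi^{-1}\in\mathcal C(\mathbb R^n,\mathbb R)$. The second equation is called the internal dynamics. **BIBS condition.** For every $c_0>0$ there exists $c_1>0$ such that for all $t^0\ge0$, $\eta^0\in\mathbb R^{n-2}$ and $\zeta\in L^\infty_{\rm loc}([t^0,\infty),\mathbb R^2)$: if $\|\eta^0\|+\|\zeta\|_\infty\le c_0$, then $\|\eta(\cdot;t^0,\eta^0,\zeta)\|_\infty\le c_1$. Here $\eta(\cdot;t^0,\eta^0,\zeta):[t^0,\infty)\to\mathbb R^{n-2}$ denotes the unique global solution of $\dot\eta=q(\zeta,\eta)$, $\eta(t^0)=\eta^0$, i.e. of the internal dynamics with $(y,\dot y)$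 replaced by $\zeta$. **Funnels.** $\mathcal G^0:=\{\psi\in W^{2,\infty}(\mathbb R_{\ge0},\mathbb R): \inf_{t\ge0}\psi(t)>0\}$ and $$\mathcal G^1:=\{(\psi_0,\psi_1)\in\mathcal G^0\times\mathcal G^0:\ \exists\,\varepsilon>0\ \forall\,t\ge0:\ \psi_1(t)\ge\varepsilon-\dot\psi_0(t)\}.$$ For $i=0,1$, $\mathcal F_{\psi_i}:=\{(t,e)\in\mathbb R_{\ge0}\times\mathbb R:\ |e|<\psi_i(t)\}$. For $t\ge0$ and $\zeta=(\zeta^0,\zeta^1)\in\mathbb R^2$ put $e_i(t,\zeta):=\zeta^i-y_{\mathrm{ref}}^{(i)}(t)$, $i=0,1$. For $t\ge 0$, $$\mathcal D_t:=\{(\zeta,\eta)\in\mathbb R^2\times\mathbb R^{n-2}:\ |e_i(t,\zeta)|<\psi_i(t)\text{ for } i=0,1\}.$$ **Stage cost.** For a design parameter $\lambda_u\ge0$, define $\ell:\mathbb R_{\ge0}\times\mathbb R^2\times\mathbb R\to\mathbb R\cup\{\infty\}$ by $$\ell(t,\zeta,u)=\sum_{i=0}^1\frac{1}{1-|e_i(t,\zeta)|^2/\psi_i(t)^2}+\lambda_u|u|^2$$ if $|e_i(t,\zeta)|\ne\psi_i(t)$ for $i=0,1$, and $\ell(t,\zeta,u)=\infty$ otherwise. **FMPC algorithm.** Given the system, $y_{\mathrm{ref}}\in W^{2,\infty}(\mathbb R_{\ge0},\mathbb R)$, $\psi\in\mathcal G^1$, $\ell$, a control bound $M>0$, $t^0\ge0$,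 an initial value $x^0$ with $\Phi(x^0)\in\mathcal D_{t^0}$, a time shift $\delta>0$ and a prediction horizon $T>\delta$. Initialize $\hat t:=t^0$ and repeat: (a) Obtain a measurement of the state at time $\hat t$ and set $\hat x:=x(\hat t)$. (b) Compute a solution $u^\star\in L^\infty([\hat t,\hat t+T],\mathbb R)$ of the optimal control problem (OCP) $$\mathop{\mathrm{minimize}}_{u\in L^\infty([\hat t,\hat t+T],\mathbb R)}\ \int_{\hat t}^{\hat t+T}\ell\big(t,(y(t),\dot y(t)),u(t)\big)\,dt$$ subject to $\dot x(t)=f(x(t))+g(x(t))u(t)$, $y(t)=h(x(t))$, $x(\hat t)=\hat x$, and $|u(t)|\le M$ for $t\in[\hat t,\hat t+T]$. (c) Apply the feedback law $\mu:[\hat t,\hat t+\delta)\times\mathbb R^n\to\mathbb R$, $\mu(t,\hat x)=u^\star(t)$, to the system. Increase $\hat t$ by $\delta$ and go to (a). *)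

theory Defs
  imports "HOL-Analysis.Analysis" "HOL-Probability.Essential_Supremum"
begin

section \<open>Function spaces\<close>

text \<open>Functions of class \<open>C\<^sup>k\<close> on a finite-dimensional space: the derivative is described by its
  values on the individual direction vectors.\<close>

primrec C_k :: "nat \<Rightarrow> ('a::euclidean_space \<Rightarrow> 'b::euclidean_space) \<Rightarrow> bool" where
  "C_k 0 F \<longleftrightarrow> continuous_on UNIV F"
| "C_k (Suc k) F \<longleftrightarrow> (\<forall>x. F differentiable (at x)) \<and>
     (\<forall>v. C_k k (\<lambda>x. frechet_derivative F (at x) v))"

text \<open>The least regularity that makes a bijection a diffeomorphism.\<close>

definition diffeomorphism :: "('a::euclidean_space \<Rightarrow> 'a) \<Rightarrow> bool" where
  "diffeomorphism \<Phi> \<longleftrightarrow> bij \<Phi> \<and> C_k 1 \<Phi> \<and> C_k 1 (inv \<Phi>)"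

definition Linf_norm :: "real set \<Rightarrow> (real \<Rightarrow> 'a::euclidean_space) \<Rightarrow> ereal" where
  "Linf_norm I u = esssup (lebesgue_on I) (\<lambda>t. ereal (norm (u t)))"

definition Linf :: "real set \<Rightarrow> (real \<Rightarrow> 'a::euclidean_space) set" where
  "Linf I = {u \<in> borel_measurable (lebesgue_on I). Linf_norm I u < \<infinity>}"

definition Linf_loc :: "real set \<Rightarrow> (real \<Rightarrow> 'a::euclidean_space) set" where
  "Linf_loc I = {u \<in> borel_measurable (lebesgue_on I). \<forall>K. compact K \<and> K \<subseteq> I \<longrightarrow> u \<in> Linf K}"

text \<open>Weak derivatives on an interval, tested against \<open>C\<^sup>1\<close> functions with compact support in the
  interior, which is equivalent to testing against smooth ones.\<close>

definition weak_derivative :: "real set \<Rightarrow> (real \<Rightarrow> real) \<Rightarrow> (real \<Rightarrow> real) \<Rightarrow> bool" where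
  "weak_derivative I u v \<longleftrightarrow>
     (\<forall>\<phi>::real \<Rightarrow> real. C_k 1 \<phi> \<and> compact (closure {t. \<phi> t \<noteq> 0}) \<and>
        closure {t. \<phi> t \<noteq> 0} \<subseteq> interior I \<longrightarrow>
        (LINT t:I|lebesgue. u t * deriv \<phi> t) = - (LINT t:I|lebesgue. v t * \<phi> t))"

primrec sobolev_inf :: "nat \<Rightarrow> real set \<Rightarrow> (real \<Rightarrow> real) \<Rightarrow> bool" where
  "sobolev_inf 0 I u \<longleftrightarrow> u \<in> Linf I"
| "sobolev_inf (Suc k) I u \<longleftrightarrow> u \<in> Linf I \<and> (\<exists>v. weak_derivative I u v \<and> sobolev_inf k I v)"

text \<open>\<open>W\<^sup>2\<^sup>,\<^sup>\<infinity>([0,\<infinity>), \<real>)\<close>. Continuity selects the representative of the almost-everywhere class for which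
  pointwise values are meaningful; it is continuously differentiable on \<open>[0,\<infinity>)\<close>.\<close>

definition W2inf :: "(real \<Rightarrow> real) set" where
  "W2inf = {u. sobolev_inf 2 {0..} u \<and> continuous_on {0..} u}"

text \<open>The classical derivative on an interval, one-sided at end points belonging to it.\<close>

definition D1 :: "real set \<Rightarrow> (real \<Rightarrow> real) \<Rightarrow> real \<Rightarrow> real" where
  "D1 I u t = vector_derivative u (at t within I)"


section \<open>Caratheodory solutions\<close>

text \<open>Epsilon-delta absolute continuity. The elements of a division are non-overlapping compact
  intervals \<open>{Inf k..Sup k}\<close>.\<close>

definition abs_continuous_on :: "real set \<Rightarrow> (real \<Rightarrow> 'a::euclidean_space) \<Rightarrow> bool" where
  "abs_continuous_on I x \<longleftrightarrow>
     (\<forall>\<epsilon>>0. \<exists>\<delta>>0. \<forall>\<D> S. \<D> division_of S \<and> S \<subseteq> I \<and> (\<Sum>k\<in>\<D>. Sup k - Inf k) < \<delta> \<longrightarrow>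
        (\<Sum>k\<in>\<D>. norm (x (Sup k) - x (Inf k))) < \<epsilon>)"

text \<open>On intervals that are not compact, absolute continuity is meant locally.\<close>

definition caratheodory_solution ::
    "(real \<Rightarrow> 'a::euclidean_space \<Rightarrow> 'a) \<Rightarrow> real set \<Rightarrow> (real \<Rightarrow> 'a) \<Rightarrow> bool" where
  "caratheodory_solution F J x \<longleftrightarrow>
     (\<forall>a b. {a..b} \<subseteq> J \<longrightarrow> abs_continuous_on {a..b} x) \<and>
     (AE t in lebesgue_on J. (x has_vector_derivative F t (x t)) (at t within J))"

definition control_solution ::
    "('a::euclidean_space \<Rightarrow> 'a) \<Rightarrow> ('a \<Rightarrow> 'a) \<Rightarrow> (real \<Rightarrow> real) \<Rightarrow> real set \<Rightarrow> (real \<Rightarrow> 'a) \<Rightarrow> bool"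
  where
  "control_solution f g u J x \<longleftrightarrow> caratheodory_solution (\<lambda>t z. f z + u t *\<^sub>R g z) J x"


section \<open>Relative degree and Byrnes-Isidori form\<close>

definition lie :: "('a::euclidean_space \<Rightarrow> 'a) \<Rightarrow> ('a \<Rightarrow> real) \<Rightarrow> 'a \<Rightarrow> real" where
  "lie f h x = frechet_derivative h (at x) (f x)"

definition relative_degree_two ::
    "('a::euclidean_space \<Rightarrow> 'a) \<Rightarrow> ('a \<Rightarrow> 'a) \<Rightarrow> ('a \<Rightarrow> real) \<Rightarrow> bool" where
  "relative_degree_two f g h \<longleftrightarrow> (\<forall>x. lie g h x = 0 \<and> lie g (lie f h) x \<noteq> 0)"

text \<open>The product of \<open>\<real>\<^sup>2\<close> and \<open>\<real>\<^sup>n\<^sup>-\<^sup>2\<close> is rendered as \<open>real^'n\<close> with two distinct distinguished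
  indices \<open>i0\<close>, \<open>i1\<close>, which carry the output and its derivative. The space \<open>\<real>\<^sup>n\<^sup>-\<^sup>2\<close> is identified with
  the vectors vanishing at \<open>i0\<close> and \<open>i1\<close>. Unlike an index type for \<open>\<real>\<^sup>n\<^sup>-\<^sup>2\<close>, which could not be
  empty, this covers the case \<open>n = 2\<close>.\<close>

definition internal_space :: "'n \<Rightarrow> 'n \<Rightarrow> (real^'n::finite) set" where
  "internal_space i0 i1 = {\<eta>. \<eta> $ i0 = 0 \<and> \<eta> $ i1 = 0}"

definition bi_vec :: "'n \<Rightarrow> 'n \<Rightarrow> real \<times> real \<Rightarrow> real^'n \<Rightarrow> real^'n::finite" where
  "bi_vec i0 i1 \<zeta> \<eta> = (\<chi> i. if i = i0 then fst \<zeta> else if i = i1 then snd \<zeta> else \<eta> $ i)"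

text \<open>In the new coordinates \<open>z = \<Phi>(x)\<close> the system reads \<open>z\<^sub>i\<^sub>0' = z\<^sub>i\<^sub>1\<close>, \<open>z\<^sub>i\<^sub>1' = p(z) + \<gamma>(z) u\<close>, and
  \<open>\<eta>' = q(z)\<close> for the remaining components. Since \<open>z\<^sub>i\<^sub>0\<close> is the output \<open>y\<close>, the first equation
  states that \<open>z\<^sub>i\<^sub>1\<close> is its derivative.\<close>

definition byrnes_isidori_form ::
    "'n \<Rightarrow> 'n \<Rightarrow> (real^'n \<Rightarrow> real^'n) \<Rightarrow> (real^'n \<Rightarrow> real^'n) \<Rightarrow> (real^'n \<Rightarrow> real) \<Rightarrow>
     (real^'n \<Rightarrow> real^'n) \<Rightarrow> (real^'n \<Rightarrow> real) \<Rightarrow> (real^'n \<Rightarrow> real^'n::finite) \<Rightarrow> bool" where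
  "byrnes_isidori_form i0 i1 f g h \<Phi> p q \<longleftrightarrow>
     continuous_on UNIV p \<and> continuous_on UNIV q \<and> range q \<subseteq> internal_space i0 i1 \<and>
     (\<forall>x. \<Phi> x $ i0 = h x) \<and>
     (\<forall>s \<omega> u x. 0 \<le> s \<and> s < \<omega> \<and> u \<in> Linf_loc {0..} \<longrightarrow>
        (control_solution f g u {s..<\<omega>} x \<longleftrightarrow>
         control_solution
           (\<lambda>z. bi_vec i0 i1 (z $ i1, p z) (q z))
           (\<lambda>z. bi_vec i0 i1 (0, (lie g (lie f h) \<circ> inv \<Phi>) z) 0)
           u {s..<\<omega>} (\<Phi> \<circ> x)))"

definition internal_solution ::
    "'n \<Rightarrow> 'n \<Rightarrow> (real^'n \<Rightarrow> real^'n) \<Rightarrow> (real \<Rightarrow> real \<times> real) \<Rightarrow> real \<Rightarrow> real^'n \<Rightarrow>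
     (real \<Rightarrow> real^'n::finite) \<Rightarrow> bool" where
  "internal_solution i0 i1 q \<zeta> s \<eta>0 \<eta> \<longleftrightarrow>
     caratheodory_solution (\<lambda>t z. q (bi_vec i0 i1 (\<zeta> t) z)) {s..} \<eta> \<and> \<eta> s = \<eta>0 \<and>
     (\<forall>t\<ge>s. \<eta> t \<in> internal_space i0 i1)"

definition bibs :: "'n \<Rightarrow> 'n \<Rightarrow> (real^'n \<Rightarrow> real^'n::finite) \<Rightarrow> bool" where
  "bibs i0 i1 q \<longleftrightarrow>
     (\<forall>c0::real>0. \<exists>c1::real>0. \<forall>s\<ge>0. \<forall>\<eta>0\<in>internal_space i0 i1. \<forall>\<zeta>\<in>Linf_loc {s..}.
        ereal (norm \<eta>0) + Linf_norm {s..} \<zeta> \<le> ereal c0 \<longrightarrow>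
        (\<exists>\<eta>. internal_solution i0 i1 q \<zeta> s \<eta>0 \<eta> \<and>
             (\<forall>\<eta>'. internal_solution i0 i1 q \<zeta> s \<eta>0 \<eta>' \<longrightarrow> (\<forall>t\<ge>s. \<eta>' t = \<eta> t)) \<and>
             Linf_norm {s..} \<eta> \<le> ereal c1))"


section \<open>Funnels\<close>

definition G0 :: "(real \<Rightarrow> real) set" where
  "G0 = {\<psi> \<in> W2inf. (INF t\<in>{0..}. \<psi> t) > 0}"

definition G1 :: "((real \<Rightarrow> real) \<times> (real \<Rightarrow> real)) set" where
  "G1 = {(\<psi>0, \<psi>1). \<psi>0 \<in> G0 \<and> \<psi>1 \<in> G0 \<and> (\<exists>\<epsilon>>0. \<forall>t\<ge>0. \<psi>1 t \<ge> \<epsilon> - D1 {0..} \<psi>0 t)}"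

definition funnel :: "(real \<Rightarrow> real) \<Rightarrow> (real \<times> real) set" where
  "funnel \<psi> = {(t, e). t \<ge> 0 \<and> \<bar>e\<bar> < \<psi> t}"

definition err0 :: "(real \<Rightarrow> real) \<Rightarrow> real \<Rightarrow> real \<times> real \<Rightarrow> real" where
  "err0 yref t \<zeta> = fst \<zeta> - yref t"

definition err1 :: "(real \<Rightarrow> real) \<Rightarrow> real \<Rightarrow> real \<times> real \<Rightarrow> real" where
  "err1 yref t \<zeta> = snd \<zeta> - D1 {0..} yref t"

definition D_set ::
    "'n \<Rightarrow> 'n \<Rightarrow> (real \<Rightarrow> real) \<times> (real \<Rightarrow> real) \<Rightarrow> (real \<Rightarrow> real) \<Rightarrow> real \<Rightarrow> (real^'n::finite) set"
  where
  "D_set i0 i1 \<psi> yref t =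
     {z. \<bar>err0 yref t (z $ i0, z $ i1)\<bar> < fst \<psi> t \<and> \<bar>err1 yref t (z $ i0, z $ i1)\<bar> < snd \<psi> t}"


section \<open>Funnel MPC\<close>

definition stage_cost ::
    "(real \<Rightarrow> real) \<times> (real \<Rightarrow> real) \<Rightarrow> (real \<Rightarrow> real) \<Rightarrow> real \<Rightarrow> real \<Rightarrow> real \<times> real \<Rightarrow> real \<Rightarrow> ereal"
  where
  "stage_cost \<psi> yref lu t \<zeta> v =
     (if \<bar>err0 yref t \<zeta>\<bar> \<noteq> fst \<psi> t \<and> \<bar>err1 yref t \<zeta>\<bar> \<noteq> snd \<psi> t
      then ereal (1 / (1 - \<bar>err0 yref t \<zeta>\<bar>\<^sup>2 / (fst \<psi> t)\<^sup>2)
                + 1 / (1 - \<bar>err1 yref t \<zeta>\<bar>\<^sup>2 / (snd \<psi> t)\<^sup>2) + lu * \<bar>v\<bar>\<^sup>2)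
      else \<infinity>)"

text \<open>Lebesgue integral of an extended real function. It is \<open>\<infinity>\<close> whenever the positive part has infinite
  integral, in particular if the integrals of both parts are infinite: the stage cost is negative
  outside the funnels, so the cost of a control leaving them need not be defined otherwise.\<close>

definition ereal_integral :: "real set \<Rightarrow> (real \<Rightarrow> ereal) \<Rightarrow> ereal" where
  "ereal_integral I F =
     (let P = (\<integral>\<^sup>+t. e2ennreal (F t) \<partial>lebesgue_on I);
          N = (\<integral>\<^sup>+t. e2ennreal (- F t) \<partial>lebesgue_on I)
      in if P = \<infinity> then \<infinity> else enn2ereal P - enn2ereal N)"

definition ocp_cost ::
    "('a::euclidean_space \<Rightarrow> real) \<Rightarrow> (real \<Rightarrow> real) \<times> (real \<Rightarrow> real) \<Rightarrow> (real \<Rightarrow> real) \<Rightarrow> real \<Rightarrow>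
     real \<Rightarrow> real \<Rightarrow> (real \<Rightarrow> 'a) \<Rightarrow> (real \<Rightarrow> real) \<Rightarrow> ereal" where
  "ocp_cost h \<psi> yref lu T s x u =
     ereal_integral {s..s + T}
       (\<lambda>t. stage_cost \<psi> yref lu t ((h \<circ> x) t, D1 {s..s + T} (h \<circ> x) t) (u t))"

text \<open>The input bound is imposed for every time, not only almost every time; each class of essentially
  bounded controls satisfying it almost everywhere has such a representative.\<close>

definition ocp_admissible ::
    "('a::euclidean_space \<Rightarrow> 'a) \<Rightarrow> ('a \<Rightarrow> 'a) \<Rightarrow> real \<Rightarrow> real \<Rightarrow> real \<Rightarrow> 'a \<Rightarrow>
     (real \<Rightarrow> 'a) \<Rightarrow> (real \<Rightarrow> real) \<Rightarrow> bool" where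
  "ocp_admissible f g T M s xh x u \<longleftrightarrow>
     u \<in> Linf {s..s + T} \<and> control_solution f g u {s..s + T} x \<and> x s = xh \<and>
     (\<forall>t\<in>{s..s + T}. \<bar>u t\<bar> \<le> M)"

definition ocp_solution ::
    "('a::euclidean_space \<Rightarrow> 'a) \<Rightarrow> ('a \<Rightarrow> 'a) \<Rightarrow> ('a \<Rightarrow> real) \<Rightarrow>
     (real \<Rightarrow> real) \<times> (real \<Rightarrow> real) \<Rightarrow> (real \<Rightarrow> real) \<Rightarrow> real \<Rightarrow> real \<Rightarrow> real \<Rightarrow> real \<Rightarrow> 'a \<Rightarrow>
     (real \<Rightarrow> real) \<Rightarrow> bool" where
  "ocp_solution f g h \<psi> yref lu T M s xh u \<longleftrightarrow>
     (\<exists>x. ocp_admissible f g T M s xh x u \<and>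
          (\<forall>x' u'. ocp_admissible f g T M s xh x' u' \<longrightarrow>
             ocp_cost h \<psi> yref lu T s x u \<le> ocp_cost h \<psi> yref lu T s x' u'))"

text \<open>\<open>fmpc_state f g h \<psi> yref lu t0 \<delta> T M x0 k xh\<close>: with some choice of optimal controls, the first \<open>k\<close>
  iterations of the algorithm can be carried out and lead to the state \<open>xh\<close> at time \<open>t0 + k \<delta>\<close>.\<close>

inductive fmpc_state ::
    "('a::euclidean_space \<Rightarrow> 'a) \<Rightarrow> ('a \<Rightarrow> 'a) \<Rightarrow> ('a \<Rightarrow> real) \<Rightarrow>
     (real \<Rightarrow> real) \<times> (real \<Rightarrow> real) \<Rightarrow> (real \<Rightarrow> real) \<Rightarrow> real \<Rightarrow> real \<Rightarrow> real \<Rightarrow> real \<Rightarrow> real \<Rightarrow> 'a \<Rightarrow>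
     nat \<Rightarrow> 'a \<Rightarrow> bool"
  for f g h \<psi> yref lu t0 \<delta> T M x0 where
  init: "fmpc_state f g h \<psi> yref lu t0 \<delta> T M x0 0 x0"
| step: "\<lbrakk>fmpc_state f g h \<psi> yref lu t0 \<delta> T M x0 k xh;
          ocp_solution f g h \<psi> yref lu T M (t0 + real k * \<delta>) xh u;
          control_solution f g u {t0 + real k * \<delta>..t0 + real (Suc k) * \<delta>} x;
          x (t0 + real k * \<delta>) = xh\<rbrakk>
         \<Longrightarrow> fmpc_state f g h \<psi> yref lu t0 \<delta> T M x0 (Suc k) (x (t0 + real (Suc k) * \<delta>))"

text \<open>Initial (\<open>k = 0\<close>) and recursive feasibility, whichever optimal controls were chosen before.\<close>

definition fmpc_feasible ::
    "('a::euclidean_space \<Rightarrow> 'a) \<Rightarrow> ('a \<Rightarrow> 'a) \<Rightarrow> ('a \<Rightarrow> real) \<Rightarrow>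
     (real \<Rightarrow> real) \<times> (real \<Rightarrow> real) \<Rightarrow> (real \<Rightarrow> real) \<Rightarrow> real \<Rightarrow> real \<Rightarrow> real \<Rightarrow> real \<Rightarrow> real \<Rightarrow> 'a \<Rightarrow>
     bool" where
  "fmpc_feasible f g h \<psi> yref lu t0 \<delta> T M x0 \<longleftrightarrow>
     (\<forall>k xh. fmpc_state f g h \<psi> yref lu t0 \<delta> T M x0 k xh \<longrightarrow>
        (\<exists>u. ocp_solution f g h \<psi> yref lu T M (t0 + real k * \<delta>) xh u))"

definition sampling_time :: "real \<Rightarrow> real \<Rightarrow> real \<Rightarrow> real" where
  "sampling_time t0 \<delta> t = t0 + of_int \<lfloor>(t - t0) / \<delta>\<rfloor> * \<delta>"

definition fmpc_input ::
    "real \<Rightarrow> real \<Rightarrow> (real \<Rightarrow> 'a \<Rightarrow> real) \<Rightarrow> (real \<Rightarrow> 'a) \<Rightarrow> real \<Rightarrow> real" where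
  "fmpc_input t0 \<delta> \<mu> x t = \<mu> t (x (sampling_time t0 \<delta> t))"

text \<open>The feedback laws of the individual iterations live on disjoint time intervals and are collected
  in a single \<open>\<mu>\<close>.\<close>

definition fmpc_closed_loop ::
    "('a::euclidean_space \<Rightarrow> 'a) \<Rightarrow> ('a \<Rightarrow> 'a) \<Rightarrow> ('a \<Rightarrow> real) \<Rightarrow>
     (real \<Rightarrow> real) \<times> (real \<Rightarrow> real) \<Rightarrow> (real \<Rightarrow> real) \<Rightarrow> real \<Rightarrow> real \<Rightarrow> real \<Rightarrow> real \<Rightarrow> real \<Rightarrow> 'a \<Rightarrow>
     (real \<Rightarrow> 'a \<Rightarrow> real) \<Rightarrow> (real \<Rightarrow> 'a) \<Rightarrow> bool" where
  "fmpc_closed_loop f g h \<psi> yref lu t0 \<delta> T M x0 \<mu> x \<longleftrightarrow>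
     control_solution f g (fmpc_input t0 \<delta> \<mu> x) {t0..} x \<and> x t0 = x0 \<and>
     (\<forall>k::nat. \<exists>u. ocp_solution f g h \<psi> yref lu T M (t0 + real k * \<delta>) (x (t0 + real k * \<delta>)) u \<and>
        (\<forall>t\<in>{t0 + real k * \<delta>..<t0 + real (Suc k) * \<delta>}. \<mu> t (x (t0 + real k * \<delta>)) = u t))"

end

theory Submission
  imports Defs "HOL-Complex_Analysis.Great_Picard"
begin

text \<open>Call a state safe if the error can be braked before the boundary of the funnel with a fixed bound on
  its acceleration. From a safe state the error can be steered inside both funnels for all future times; the BIBS
  condition supplies the internal state along such an output, all states met on the way lie in one compact set, and
  there \<open>\<gamma>\<close> is bounded away from 0, so that a control with a bound \<open>M\<close> independent of time realises the path.
  Conversely, an error inside the funnel cannot stay unsafe for a whole unit of time, as it would reach the boundary.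
  With \<open>T = \<delta> + 1\<close> the tail of an optimal trajectory beyond \<open>\<delta>\<close> hence contains a safe
  state, from which the steering control extends it: finite-cost controls exist at the next sampling time.

  A trajectory of finite cost stays inside the funnels, since a Lipschitz error touching the boundary at time
  \<open>\<tau>\<close> makes the cost dominate a multiple of \<open>1 / (\<tau> - t)\<close>, which is not integrable. Optimal controls
  exist by the direct method: for control-affine dynamics, trajectories and primitives of controls of a minimizing
  sequence converge uniformly along a subsequence, and the cost is lower semicontinuous.\<close>

subsection \<open>Absolute continuity\<close>

lemma AE_lebesgue_on_negligible:
  assumes "AE t in lebesgue_on S. P t" "S \<in> sets lebesgue"
  obtains N where "negligible N" "\<And>t. t \<in> S \<Longrightarrow> t \<notin> N \<Longrightarrow> P t"
proof -
  have "AE t in lebesgue. t \<in> S \<longrightarrow> P t"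
    using assms by (simp add: AE_restrict_space_iff)
  then obtain N where "{t \<in> space lebesgue. \<not> (t \<in> S \<longrightarrow> P t)} \<subseteq> N" "N \<in> null_sets lebesgue"
    by (auto elim!: AE_E2 simp: eventually_ae_filter)
  then show ?thesis
    by (intro that[of N]) (auto simp: negligible_iff_null_sets)
qed

lemma AE_lebesgue_on_negligibleI:
  assumes "negligible N" "\<And>t. t \<in> S \<Longrightarrow> t \<notin> N \<Longrightarrow> P t" "S \<in> sets lebesgue"
  shows "AE t in lebesgue_on S. P t"
proof -
  have "AE t in lebesgue. t \<in> S \<longrightarrow> P t"
    unfolding eventually_ae_filter using assms by (auto simp: negligible_iff_null_sets)
  then show ?thesis using assms by (simp add: AE_restrict_space_iff)
qed

lemma abs_continuous_onD:
  assumes "abs_continuous_on I \<phi>" "\<epsilon> > 0"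
  obtains \<delta> where "\<delta> > 0" "\<And>\<D> S. \<lbrakk>\<D> division_of S; S \<subseteq> I; (\<Sum>k\<in>\<D>. Sup k - Inf k) < \<delta>\<rbrakk>
     \<Longrightarrow> (\<Sum>k\<in>\<D>. norm (\<phi> (Sup k) - \<phi> (Inf k))) < \<epsilon>"
  using assms unfolding abs_continuous_on_def by meson

lemma abs_continuous_on_tagged:
  fixes \<phi> :: "real \<Rightarrow> 'a::euclidean_space"
  assumes "abs_continuous_on {a..b} \<phi>" "e > 0"
  obtains \<delta> where "\<delta> > 0"
    "\<And>p G. \<lbrakk>p tagged_partial_division_of {a..b}; open G; emeasure lebesgue G < ennreal \<delta>;
        \<Union>(snd ` p) \<subseteq> G\<rbrakk> \<Longrightarrow> (\<Sum>(x,k)\<in>p. norm (\<phi> (Sup k) - \<phi> (Inf k))) < e"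
proof -
  obtain \<delta> where \<delta>: "\<delta> > 0" "\<And>\<D> S. \<lbrakk>\<D> division_of S; S \<subseteq> {a..b}; (\<Sum>k\<in>\<D>. Sup k - Inf k) < \<delta>\<rbrakk>
     \<Longrightarrow> (\<Sum>k\<in>\<D>. norm (\<phi> (Sup k) - \<phi> (Inf k))) < e"
    using abs_continuous_onD[OF assms] by blast
  show ?thesis
  proof (rule that[OF \<delta>(1)])
    fix p G assume p: "p tagged_partial_division_of {a..b}" and G: "open G"
      "emeasure lebesgue G < ennreal \<delta>" "\<Union>(snd ` p) \<subseteq> G"
    have div: "(snd ` p) division_of \<Union>(snd ` p)"
      using p by (rule partial_division_of_tagged_division)
    have sub: "\<Union>(snd ` p) \<subseteq> {a..b}"
      using tagged_partial_division_ofD(3)[OF p] by fastforce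
    have iv: "\<exists>u v. u \<le> v \<and> k = {u..v}" if "k \<in> snd ` p" for k
      using division_ofD(3,4)[OF div that] by (metis atLeastatMost_empty_iff2 box_real(2) linorder_linear not_le)
    have meas: "(\<Sum>k\<in>snd ` p. Sup k - Inf k) = (\<Sum>k\<in>snd ` p. measure lebesgue k)"
      by (rule sum.cong[OF refl]) (use iv in force)
    have "k \<in> lmeasurable" if "k \<in> snd ` p" for k
      using iv[OF that] by auto
    then have lm: "\<Union>(snd ` p) \<in> lmeasurable"
      using division_of_finite[OF div] by (intro fmeasurable.finite_Union) auto
    have "(\<Sum>k\<in>snd ` p. measure lebesgue k) = measure lebesgue (\<Union>(snd ` p))"
      using content_division[OF div] .
    moreover have "emeasure lebesgue (\<Union>(snd ` p)) < ennreal \<delta>"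
      using G emeasure_mono[of "\<Union>(snd ` p)" G lebesgue] by force
    then have "measure lebesgue (\<Union>(snd ` p)) < \<delta>"
      using emeasure_eq_measure2[OF lm] \<delta>(1) by (simp add: ennreal_less_iff)
    ultimately have "(\<Sum>k\<in>snd ` p. norm (\<phi> (Sup k) - \<phi> (Inf k))) < e"
      using \<delta>(2)[OF div sub] meas by simp
    moreover have "(\<Sum>(x,k)\<in>p. norm (\<phi> (Sup k) - \<phi> (Inf k))) = (\<Sum>k\<in>snd ` p. norm (\<phi> (Sup k) - \<phi> (Inf k)))"
    proof -
      have "(\<Sum>(x,k)\<in>p. norm (\<phi> (Sup k) - \<phi> (Inf k))) = (\<Sum>z\<in>p. norm (\<phi> (Sup (snd z)) - \<phi> (Inf (snd z))))"
        by (simp add: split_beta)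
      also have "\<dots> = (\<Sum>k\<in>snd ` p. norm (\<phi> (Sup k) - \<phi> (Inf k)))"
      proof (rule sum.reindex_nontrivial[symmetric, unfolded o_def])
        show "finite p" using p by (rule tagged_partial_division_ofD(1))
        fix z w assume zw: "z \<in> p" "w \<in> p" "z \<noteq> w" "snd z = snd w"
        have "(fst z, snd z) \<in> p" "(fst w, snd w) \<in> p" "(fst z, snd z) \<noteq> (fst w, snd w)"
          using zw(1-3) by simp_all
        then have "interior (snd z) \<inter> interior (snd w) = {}"
          by (rule tagged_partial_division_ofD(5)[OF p])
        moreover obtain u v where "u \<le> v" "snd z = {u..v}" using iv[of "snd z"] zw by auto
        ultimately have "u = v" using zw by auto
        then show "norm (\<phi> (Sup (snd z)) - \<phi> (Inf (snd z))) = 0" using \<open>snd z = {u..v}\<close> by simp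
      qed
      finally show ?thesis .
    qed
    ultimately show "(\<Sum>(x,k)\<in>p. norm (\<phi> (Sup k) - \<phi> (Inf k))) < e" by simp
  qed
qed

lemma ac_has_integral:
  fixes \<phi> :: "real \<Rightarrow> 'a::euclidean_space"
  assumes ac: "abs_continuous_on {a..b} \<phi>" and ab: "a \<le> b" and N: "negligible N"
    and deriv: "\<And>t. t \<in> {a..b} \<Longrightarrow> t \<notin> N \<Longrightarrow> (\<phi> has_vector_derivative f t) (at t within {a..b})"
  shows "(f has_integral (\<phi> b - \<phi> a)) {a..b}"
proof -
  define g where "g = (\<lambda>t. if t \<in> N then 0 else f t)"
  have "(g has_integral (\<phi> b - \<phi> a)) {a..b}"
    unfolding has_integral_real
  proof (intro allI impI)
    fix e :: real assume "e > 0"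
    define e1 where "e1 = e / (2 * (b - a + 1))"
    have e1: "e1 > 0" "e1 * (b - a) < e / 2"
      using \<open>e > 0\<close> ab by (auto simp: e1_def field_simps)
    obtain \<delta> where \<delta>: "\<delta> > 0"
      "\<And>p G. \<lbrakk>p tagged_partial_division_of {a..b}; open G; emeasure lebesgue G < ennreal \<delta>;
        \<Union>(snd ` p) \<subseteq> G\<rbrakk> \<Longrightarrow> (\<Sum>(x,k)\<in>p. norm (\<phi> (Sup k) - \<phi> (Inf k))) < e / 2"
      using abs_continuous_on_tagged[OF ac, of "e/2"] \<open>e > 0\<close> by auto
    obtain G where G: "open G" "N \<subseteq> G" "emeasure lebesgue (G - N) < ennreal \<delta>"
      using sets_lebesgue_outer_open[OF negligible_imp_sets[OF N] \<delta>(1)] by metis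
    have "emeasure lebesgue G = emeasure lebesgue (G - N)"
      using N G(1) by (intro emeasure_Diff_null_set[symmetric]) (auto simp: negligible_iff_null_sets)
    then have Gs: "emeasure lebesgue G < ennreal \<delta>" using G(3) by simp
    have "\<forall>x. \<exists>d>0. x \<in> {a..b} - N \<longrightarrow>
         (\<forall>y\<in>{a..b}. norm (y-x) < d \<longrightarrow> norm (\<phi> y - \<phi> x - (y-x) *\<^sub>R f x) \<le> e1 * norm (y-x))"
    proof
      fix x show "\<exists>d>0. x \<in> {a..b} - N \<longrightarrow>
         (\<forall>y\<in>{a..b}. norm (y-x) < d \<longrightarrow> norm (\<phi> y - \<phi> x - (y-x) *\<^sub>R f x) \<le> e1 * norm (y-x))"
        using deriv[of x, unfolded has_vector_derivative_def has_derivative_within_alt] e1(1)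
        by (cases "x \<in> {a..b} - N") (auto intro: exI[of _ 1])
    qed
    then obtain d where d: "\<And>x. 0 < d x"
                 "\<And>x y. \<lbrakk>x \<in> {a..b} - N; y \<in> {a..b}; norm (y-x) < d x\<rbrakk>
                        \<Longrightarrow> norm (\<phi> y - \<phi> x - (y-x) *\<^sub>R f x) \<le> e1 * norm (y-x)"
      by metis
    define \<gamma> where "\<gamma> = (\<lambda>x. if x \<in> N then G else ball x (d x))"
    have gau: "gauge \<gamma>" unfolding gauge_def \<gamma>_def using G d(1) by auto
    have main: "norm ((\<Sum>(x,k)\<in>p. measure lborel k *\<^sub>R g x) - (\<phi> b - \<phi> a)) < e"
      if p: "p tagged_division_of {a..b}" and fine: "\<gamma> fine p" for p
    proof -
      have fin: "finite p" using p by blast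
      have tot: "\<phi> b - \<phi> a = (\<Sum>(x,K)\<in>p. \<phi>(Sup K) - \<phi>(Inf K))"
        "b - a = (\<Sum>(x,K)\<in>p. Sup K - Inf K)"
        using additive_tagged_division_1[OF ab p, of \<phi>] additive_tagged_division_1[OF ab p, of "\<lambda>x. x"] by auto
      let ?pN = "{z \<in> p. fst z \<in> N}" and ?pM = "{z \<in> p. fst z \<notin> N}"
      have iv: "\<exists>u v. u \<le> v \<and> K = {u..v} \<and> x \<in> {u..v} \<and> {u..v} \<subseteq> {a..b}" if "(x,K) \<in> p" for x K
        using tagged_division_ofD(2,3,4)[OF p that] by (metis atLeastAtMost_iff box_real(2) order_trans)
      have lenpos: "0 \<le> Sup K - Inf K" if "(x,K) \<in> p" for x K using iv[OF that] by auto
      have pN: "?pN tagged_partial_division_of {a..b}"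
        using p unfolding tagged_division_of_def by (blast intro: tagged_partial_division_subset)
      have "\<Union>(snd ` ?pN) \<subseteq> G"
        using fine unfolding fine_def \<gamma>_def by fastforce
      then have b1: "(\<Sum>(x,k)\<in>?pN. norm (\<phi> (Sup k) - \<phi> (Inf k))) < e / 2"
        by (rule \<delta>(2)[OF pN G(1) Gs])
      have b2: "norm (measure lborel K *\<^sub>R g x - (\<phi> (Sup K) - \<phi> (Inf K))) \<le> e1 * (Sup K - Inf K)"
        if z: "(x,K) \<in> p" "x \<notin> N" for x K
      proof -
        obtain u v where uv: "u \<le> v" "K = {u..v}" "x \<in> {u..v}" "{u..v} \<subseteq> {a..b}"
          using iv[OF z(1)] by auto
        have "{u..v} \<subseteq> ball x (d x)" using fine z uv unfolding fine_def \<gamma>_def by fastforce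
        moreover have "u \<in> {u..v}" "v \<in> {u..v}" using uv by auto
        ultimately have "norm (u - x) < d x" "norm (v - x) < d x"
          by (auto simp: subset_iff dist_norm norm_minus_commute)
        moreover have "x \<in> {a..b} - N" "u \<in> {a..b}" "v \<in> {a..b}" using uv z(2) by auto
        ultimately have "norm (\<phi> u - \<phi> x - (u-x) *\<^sub>R f x) \<le> e1 * norm (u-x)"
          "norm (\<phi> v - \<phi> x - (v-x) *\<^sub>R f x) \<le> e1 * norm (v-x)"
          by (blast intro: d(2))+
        moreover have "norm ((v - u) *\<^sub>R f x - (\<phi> v - \<phi> u)) \<le> norm (\<phi> u - \<phi> x - (u-x) *\<^sub>R f x) + norm (\<phi> v - \<phi> x - (v-x) *\<^sub>R f x)"
          using norm_triangle_ineq4[of "\<phi> u - \<phi> x - (u-x) *\<^sub>R f x" "\<phi> v - \<phi> x - (v-x) *\<^sub>R f x"]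
          by (simp add: algebra_simps)
        ultimately have "norm ((v - u) *\<^sub>R f x - (\<phi> v - \<phi> u)) \<le> e1 * norm (u-x) + e1 * norm (v-x)"
          by linarith
        also have "\<dots> = e1 * (v - u)" using uv by (auto simp: algebra_simps)
        finally show ?thesis using uv z by (simp add: g_def)
      qed
      have split: "p = ?pN \<union> ?pM" "?pN \<inter> ?pM = {}" by auto
      have "(\<Sum>(x,k)\<in>p. measure lborel k *\<^sub>R g x) - (\<phi> b - \<phi> a) = (\<Sum>(x,k)\<in>p. measure lborel k *\<^sub>R g x - (\<phi>(Sup k) - \<phi>(Inf k)))"
        unfolding tot sum_subtractf[symmetric] by (simp add: split_beta)
      also have "norm \<dots> \<le> (\<Sum>(x,k)\<in>p. norm (measure lborel k *\<^sub>R g x - (\<phi>(Sup k) - \<phi>(Inf k))))"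
        by (rule order_trans[OF norm_sum]) (simp add: split_beta)
      also have "\<dots> = (\<Sum>(x,k)\<in>?pN. norm (measure lborel k *\<^sub>R g x - (\<phi>(Sup k) - \<phi>(Inf k))))
          + (\<Sum>(x,k)\<in>?pM. norm (measure lborel k *\<^sub>R g x - (\<phi>(Sup k) - \<phi>(Inf k))))"
        by (subst split(1), rule sum.union_disjoint) (use fin in auto)
      also have "(\<Sum>(x,k)\<in>?pN. norm (measure lborel k *\<^sub>R g x - (\<phi>(Sup k) - \<phi>(Inf k)))) = (\<Sum>(x,k)\<in>?pN. norm (\<phi>(Sup k) - \<phi>(Inf k)))"
        by (rule sum.cong) (auto simp: g_def norm_minus_commute)
      also have "(\<Sum>(x,k)\<in>?pM. norm (measure lborel k *\<^sub>R g x - (\<phi>(Sup k) - \<phi>(Inf k)))) \<le> (\<Sum>(x,k)\<in>?pM. e1 * (Sup k - Inf k))"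
        by (rule sum_mono) (use b2 in auto)
      also have "\<dots> \<le> (\<Sum>(x,k)\<in>p. e1 * (Sup k - Inf k))"
        by (rule sum_mono2) (use fin lenpos e1 in \<open>auto intro!: mult_nonneg_nonneg\<close>)
      also have "\<dots> = e1 * (b - a)" unfolding tot by (simp add: sum_distrib_left split_beta)
      finally show ?thesis using b1 e1(2) by linarith
    qed
    show "\<exists>\<gamma>. gauge \<gamma> \<and> (\<forall>\<D>. \<D> tagged_division_of {a..b} \<and> \<gamma> fine \<D> \<longrightarrow>
        norm ((\<Sum>(x,k)\<in>\<D>. measure lborel k *\<^sub>R g x) - (\<phi> b - \<phi> a)) < e)"
      by (intro exI[of _ \<gamma>] conjI allI impI gau) (elim conjE, rule main)
  qed
  then show ?thesis
    by (rule has_integral_spike[OF N, rotated]) (auto simp: g_def)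
qed

lemma abs_continuous_on_imp_continuous_on:
  assumes "abs_continuous_on {a..b} x"
  shows "continuous_on {a..b} x"
proof (rule continuous_onI)
  fix s e assume s: "s \<in> {a..b}" and e: "e > (0::real)"
  obtain \<delta> where \<delta>: "\<delta> > 0" "\<And>\<D> S. \<lbrakk>\<D> division_of S; S \<subseteq> {a..b}; (\<Sum>k\<in>\<D>. Sup k - Inf k) < \<delta>\<rbrakk>
     \<Longrightarrow> (\<Sum>k\<in>\<D>. norm (x (Sup k) - x (Inf k))) < e"
    using abs_continuous_onD[OF assms e] by blast
  have *: "norm (x v - x u) < e" if "u \<in> {a..b}" "v \<in> {a..b}" "u \<le> v" "v - u < \<delta>" for u v
    using \<delta>(2)[of "{{u..v}}" "{u..v}"] that division_of_self[of u v] by auto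
  have "dist (x t) (x s) \<le> e" if "t \<in> {a..b}" "dist t s < \<delta>" for t
    using *[of s t] *[of t s] s that by (cases "s \<le> t") (auto simp: dist_norm norm_minus_commute)
  then show "\<exists>d>0. \<forall>x'\<in>{a..b}. dist x' s < d \<longrightarrow> dist (x x') (x s) \<le> e"
    using \<delta>(1) by blast
qed

lemma lipschitz_imp_abs_continuous_on:
  fixes x :: "real \<Rightarrow> 'a::euclidean_space"
  assumes "\<And>s t. s \<in> I \<Longrightarrow> t \<in> I \<Longrightarrow> norm (x s - x t) \<le> L * \<bar>s - t\<bar>"
  shows "abs_continuous_on I x"
  unfolding abs_continuous_on_def
proof (intro allI impI)
  fix e :: real assume e: "e > 0"
  define L' where "L' = max L 0 + 1"
  have L': "L' > 0" "L \<le> L'" by (auto simp: L'_def)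
  have "(\<Sum>k\<in>\<D>. norm (x (Sup k) - x (Inf k))) < e"
    if *: "\<D> division_of S" "S \<subseteq> I" "(\<Sum>k\<in>\<D>. Sup k - Inf k) < e / L'" for \<D> S
  proof -
    have "norm (x (Sup k) - x (Inf k)) \<le> L' * (Sup k - Inf k)" if k: "k \<in> \<D>" for k
    proof -
      obtain u v where uv: "u \<le> v" "k = {u..v}"
        using division_ofD(3,4)[OF *(1) k]
        by (metis atLeastatMost_empty_iff2 box_real(2))
      then have "u \<in> I" "v \<in> I" using division_ofD(2)[OF *(1) k] *(2) by auto
      then have "norm (x v - x u) \<le> L * \<bar>v - u\<bar>" by (rule assms[rotated])
      also have "\<dots> \<le> L' * \<bar>v - u\<bar>" using L' by (intro mult_right_mono) auto
      finally show ?thesis using uv by simp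
    qed
    then have "(\<Sum>k\<in>\<D>. norm (x (Sup k) - x (Inf k))) \<le> L' * (\<Sum>k\<in>\<D>. Sup k - Inf k)"
      unfolding sum_distrib_left by (rule sum_mono)
    also have "\<dots> < e" using *(3) L' by (simp add: field_simps)
    finally show ?thesis .
  qed
  then show "\<exists>\<delta>>0. \<forall>\<D> S. \<D> division_of S \<and> S \<subseteq> I \<and> (\<Sum>k\<in>\<D>. Sup k - Inf k) < \<delta> \<longrightarrow>
        (\<Sum>k\<in>\<D>. norm (x (Sup k) - x (Inf k))) < e"
    using e L' by (intro exI[of _ "e / L'"]) auto
qed

lemma caratheodory_solution_has_integral:
  assumes sol: "caratheodory_solution F J x" and J: "J \<in> sets lebesgue" "{a..b} \<subseteq> J" and ab: "a \<le> b"
  shows "((\<lambda>t. F t (x t)) has_integral (x b - x a)) {a..b}"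
proof -
  have "AE t in lebesgue_on J. (x has_vector_derivative F t (x t)) (at t within J)"
    using sol by (simp add: caratheodory_solution_def)
  then obtain N where N: "negligible N"
    "\<And>t. t \<in> J \<Longrightarrow> t \<notin> N \<Longrightarrow> (x has_vector_derivative F t (x t)) (at t within J)"
    by (rule AE_lebesgue_on_negligible[OF _ J(1)]) blast
  show ?thesis
  proof (rule ac_has_integral[OF _ ab N(1)])
    show "abs_continuous_on {a..b} x" using sol J by (simp add: caratheodory_solution_def)
    show "(x has_vector_derivative F t (x t)) (at t within {a..b})" if "t \<in> {a..b}" "t \<notin> N" for t
      using N(2)[of t] that J(2) has_vector_derivative_within_subset by blast
  qed
qed

lemma caratheodory_solution_continuous_on:
  assumes "caratheodory_solution F J x" "{a..b} \<subseteq> J"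
  shows "continuous_on {a..b} x"
  using assms by (auto simp: caratheodory_solution_def intro: abs_continuous_on_imp_continuous_on)

lemma caratheodory_solution_subset:
  assumes "caratheodory_solution F J x" "K \<subseteq> J" "J \<in> sets lebesgue" "K \<in> sets lebesgue"
  shows "caratheodory_solution F K x"
proof -
  have "AE t in lebesgue_on J. (x has_vector_derivative F t (x t)) (at t within J)"
    using assms by (simp add: caratheodory_solution_def)
  then obtain N where N: "negligible N"
    "\<And>t. t \<in> J \<Longrightarrow> t \<notin> N \<Longrightarrow> (x has_vector_derivative F t (x t)) (at t within J)"
    by (rule AE_lebesgue_on_negligible[OF _ assms(3)]) blast
  have "AE t in lebesgue_on K. (x has_vector_derivative F t (x t)) (at t within K)"
    by (rule AE_lebesgue_on_negligibleI[OF N(1) _ assms(4)])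
      (use N(2) assms(2) has_vector_derivative_within_subset in blast)
  then show ?thesis using assms by (auto simp: caratheodory_solution_def)
qed

lemma has_integral_norm_bound_AE:
  fixes f :: "real \<Rightarrow> 'a::euclidean_space"
  assumes "(f has_integral i) {a..b}" "a \<le> b" "negligible N" "0 \<le> c"
    "\<And>t. t \<in> {a..b} \<Longrightarrow> t \<notin> N \<Longrightarrow> norm (f t) \<le> c"
  shows "norm i \<le> c * (b - a)"
proof -
  have "((\<lambda>t. if t \<in> N then 0 else f t) has_integral i) {a..b}"
    by (rule has_integral_spike[OF assms(3) _ assms(1)]) auto
  then show ?thesis
    using has_integral_bound_real[OF assms(4), of "{}" "\<lambda>t. if t \<in> N then 0 else f t" i a b] assms(2,4,5)
    by auto
qed

lemma caratheodory_solution_lipschitz: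
  assumes sol: "caratheodory_solution F J x" and J: "J \<in> sets lebesgue" "{a..b} \<subseteq> J"
    and c: "0 \<le> c" "\<And>t. t \<in> {a..b} \<Longrightarrow> norm (F t (x t)) \<le> c"
    and st: "s \<in> {a..b}" "t \<in> {a..b}"
  shows "norm (x s - x t) \<le> c * \<bar>s - t\<bar>"
proof -
  have *: "norm (x v - x u) \<le> c * (v - u)" if "u \<in> {a..b}" "v \<in> {a..b}" "u \<le> v" for u v
    using has_integral_norm_bound_AE[OF caratheodory_solution_has_integral[OF sol J(1), of u v], of "{}" c]
      that J(2) c by (auto simp: subset_iff)
  show ?thesis
    using *[of s t] *[of t s] st by (cases "s \<le> t") (auto simp: norm_minus_commute)
qed

subsection \<open>Differentiability almost everywhere\<close>

lemma AE_has_vector_derivative_indefinite_integral: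
  fixes f U :: "real \<Rightarrow> real"
  assumes U: "\<And>c d. c \<le> d \<Longrightarrow> (f has_integral (U d - U c)) {c..d}"
  obtains N where "negligible N" "\<And>t. t \<notin> N \<Longrightarrow> (U has_vector_derivative f t) (at t)"
proof -
  have int1: "f integrable_on cbox a b" for a b
  proof (cases "a \<le> b")
    case True
    then show ?thesis using U[of a b] by auto
  qed auto
  have int2: "(\<lambda>x. f (- x)) integrable_on cbox a b" for a b
    using int1[of "-b" "-a"] Henstock_Kurzweil_Integration.integrable_reflect_real[where f=f and a="-b" and b="-a"] by simp
  obtain N1 where N1: "negligible N1"
    "\<And>x e. \<lbrakk>x \<notin> N1; 0 < e\<rbrakk> \<Longrightarrow> \<exists>d>0. \<forall>h. 0 < h \<and> h < d \<longrightarrow> norm (integral (cbox x (x + h *\<^sub>R One)) f /\<^sub>R h ^ DIM(real) - f x) < e"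
    by (rule integrable_ccontinuous_explicit[of f, OF int1]) blast
  obtain N2 where N2: "negligible N2"
    "\<And>x e. \<lbrakk>x \<notin> N2; 0 < e\<rbrakk> \<Longrightarrow> \<exists>d>0. \<forall>h. 0 < h \<and> h < d \<longrightarrow> norm (integral (cbox x (x + h *\<^sub>R One)) (\<lambda>x. f (-x)) /\<^sub>R h ^ DIM(real) - f (-x)) < e"
    by (rule integrable_ccontinuous_explicit[of "\<lambda>x. f (-x)", OF int2]) blast
  have right: "\<exists>d>0. \<forall>h. 0 < h \<and> h < d \<longrightarrow> \<bar>(U (t + h) - U t) / h - f t\<bar> < e" if "t \<notin> N1" "e > 0" for t e
    using N1(2)[OF that] integral_unique[OF U] by (simp add: divide_inverse mult.commute)
  have left: "\<exists>d>0. \<forall>h. 0 < h \<and> h < d \<longrightarrow> \<bar>(U t - U (t - h)) / h - f t\<bar> < e" if "- t \<notin> N2" "e > 0" for t e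
  proof -
    have "integral {- t..- t + h} (\<lambda>x. f (-x)) = U t - U (t - h)" if "h > 0" for h
      using integral_unique[OF U[of "t-h" t]] Henstock_Kurzweil_Integration.integral_reflect_real[of t "t - h" f] that by (simp add: algebra_simps)
    then show ?thesis
      using N2(2)[OF that] by (simp add: divide_inverse mult.commute)
  qed
  have "(U has_vector_derivative f t) (at t)" if "t \<notin> N1 \<union> uminus ` N2" for t
  proof -
    have t: "t \<notin> N1" "- t \<notin> N2" using that by (auto simp: image_iff)
    have "(\<lambda>h. (U (t + h) - U t) / h) \<midarrow>0\<rightarrow> f t"
      unfolding LIM_eq
    proof (intro allI impI)
      fix e :: real assume e: "e > 0"
      obtain d1 where d1: "d1 > 0" "\<And>h. 0 < h \<and> h < d1 \<Longrightarrow> \<bar>(U (t + h) - U t) / h - f t\<bar> < e"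
        using right[OF t(1) e] by blast
      obtain d2 where d2: "d2 > 0" "\<And>h. 0 < h \<and> h < d2 \<Longrightarrow> \<bar>(U t - U (t - h)) / h - f t\<bar> < e"
        using left[OF t(2) e] by blast
      have "norm ((U (t + h) - U t) / h - f t) < e" if "h \<noteq> 0" "norm (h - 0) < min d1 d2" for h
      proof (cases "h > 0")
        case True then show ?thesis using d1(2)[of h] that by auto
      next
        case False
        have "(U (t + h) - U t) / h = (U t - U (t - (-h))) / (-h)" using that by (simp add: field_simps)
        then show ?thesis using d2(2)[of "-h"] that False by auto
      qed
      then show "\<exists>s>0. \<forall>x. x \<noteq> 0 \<and> norm (x - 0) < s \<longrightarrow> norm ((U (t + x) - U t) / x - f t) < e"
        using d1 d2 by (intro exI[of _ "min d1 d2"]) auto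
    qed
    then show ?thesis by (simp add: DERIV_def has_real_derivative_iff_has_vector_derivative[symmetric])
  qed
  moreover have "negligible (N1 \<union> uminus ` N2)"
  proof (rule negligible_Un[OF N1(1)], rule negligible_locally_Lipschitz_image[OF _ N2(1)])
    fix x show "\<exists>T B. open T \<and> x \<in> T \<and> (\<forall>y\<in>N2 \<inter> T. norm (- y - - x) \<le> B * norm (y - x))"
      by (intro exI[of _ UNIV] exI[of _ 1]) auto
  qed simp
  ultimately show ?thesis using that by blast
qed


lemma lipschitz_density:
  fixes F :: "real \<Rightarrow> real"
  assumes lip: "\<And>x y. \<bar>F x - F y\<bar> \<le> L * \<bar>x - y\<bar>"
  obtains f where "f \<in> borel_measurable borel" "\<And>c d. c \<le> d \<Longrightarrow> (f has_integral (F d - F c)) {c..d}"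
proof -
  define G where "G x = F x + (L + 1) * x" for x
  have L0: "L \<ge> 0" using lip[of 1 0] by simp
  have Gexp: "y - x \<le> G y - G x" if "x \<le> y" for x y
    using lip[of x y] that by (simp add: G_def algebra_simps)
  have Glip: "\<bar>G x - G y\<bar> \<le> (2 * L + 1) * \<bar>x - y\<bar>" for x y
  proof -
    have "\<bar>G x - G y\<bar> \<le> \<bar>F x - F y\<bar> + \<bar>(L + 1) * (x - y)\<bar>"
      by (simp add: G_def algebra_simps)
    also have "\<dots> \<le> L * \<bar>x - y\<bar> + (L + 1) * \<bar>x - y\<bar>"
      using lip[of x y] L0 by (simp add: abs_mult)
    finally show ?thesis by (simp add: algebra_simps)
  qed
  have Gcont: "continuous_on UNIV G"
    by (rule lipschitz_on_continuous_on[of "2 * L + 1"])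
      (use Glip L0 in \<open>auto intro!: lipschitz_onI simp: dist_real_def\<close>)
  have Ginj: "inj G"
  proof (rule linorder_injI)
    fix x y :: real assume "x < y"
    then show "G x \<noteq> G y" using Gexp[of x y] by auto
  qed
  have Gsurj: "\<exists>x. G x = y" for y
  proof -
    define r where "r = \<bar>y - G 0\<bar>"
    have "G (- r) \<le> y" using Gexp[of "-r" 0] by (simp add: r_def)
    moreover have "y \<le> G r" using Gexp[of 0 r] by (simp add: r_def)
    ultimately have "\<exists>x\<ge>-r. x \<le> r \<and> G x = y"
      by (intro IVT') (auto simp: r_def intro: continuous_on_subset[OF Gcont])
    then show ?thesis by blast
  qed
  define J where "J = inv G"
  have GJ[simp]: "G (J y) = y" for y using Gsurj unfolding J_def by (metis f_inv_into_f rangeI)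
  have JG[simp]: "J (G x) = x" for x using Ginj by (simp add: J_def)
  have Jlip: "\<bar>J x - J y\<bar> \<le> \<bar>x - y\<bar>" for x y
    using Gexp[of "J x" "J y"] Gexp[of "J y" "J x"] by (cases "J x \<le> J y") auto
  have Jcont: "continuous_on UNIV J"
    by (rule lipschitz_on_continuous_on[of 1]) (use Jlip in \<open>auto intro!: lipschitz_onI simp: dist_real_def\<close>)
  have Jm[measurable]: "J \<in> borel_measurable borel"
    using Jcont by (rule borel_measurable_continuous_onI)
  have vim: "J -` A = G ` A" for A :: "real set" by (auto simp: image_iff) (metis GJ)
  define \<mu> where "\<mu> = distr lborel borel J"
  have em: "emeasure \<mu> A = emeasure lborel (G ` A)" if "A \<in> sets borel" for A
    using that by (simp add: \<mu>_def emeasure_distr vim)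
  have G_Icc: "G ` {a..b} = {G a..G b}" if "a \<le> b" for a b
  proof (intro equalityI subsetI)
    fix y assume "y \<in> G ` {a..b}"
    then show "y \<in> {G a..G b}" using Gexp by fastforce
  next
    fix y assume y: "y \<in> {G a..G b}"
    have "a \<le> J y" using Gexp[of "J y" a] y by (cases "a \<le> J y") auto
    moreover have "J y \<le> b" using Gexp[of b "J y"] y by (cases "J y \<le> b") auto
    ultimately show "y \<in> G ` {a..b}" by (intro image_eqI[of _ _ "J y"]) auto
  qed
  have emI: "emeasure \<mu> {a..b} = ennreal (G b - G a)" if "a \<le> b" for a b
    using em[of "{a..b}"] G_Icc[OF that] Gexp[OF that] that by simp
  have ac: "absolutely_continuous lborel \<mu>"
    unfolding absolutely_continuous_def
  proof
    fix A :: "real set" assume A: "A \<in> null_sets lborel"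
    then have "negligible A" by (simp add: negligible_iff_null_sets null_sets_completionI)
    then have "negligible (G ` A)"
    proof (rule negligible_locally_Lipschitz_image[rotated])
      fix x show "\<exists>T B. open T \<and> x \<in> T \<and> (\<forall>y\<in>A \<inter> T. norm (G y - G x) \<le> B * norm (y - x))"
        using Glip by (intro exI[of _ UNIV] exI[of _ "2 * L + 1"]) auto
    qed simp
    moreover have "G ` A \<in> sets borel"
      using A measurable_sets[OF Jm, of A] vim[of A] by auto
    ultimately have "G ` A \<in> null_sets lborel"
      by (auto simp: negligible_iff_null_sets null_sets_def)
    then show "A \<in> null_sets \<mu>" using A em[of A] by (auto simp: null_sets_def \<mu>_def)
  qed
  have sets: "sets \<mu> = sets lborel" by (simp add: \<mu>_def)
  obtain D where D: "D \<in> borel_measurable lborel" "density lborel D = \<mu>"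
    using sigma_finite_measure.Radon_Nikodym[OF sigma_finite_lborel ac sets] by blast
  have nn: "(\<integral>\<^sup>+ x\<in>{a..b}. D x \<partial>lborel) = ennreal (G b - G a)" if "a \<le> b" for a b
    using emI[OF that] emeasure_density[OF D(1), of "{a..b}"] D(2) by simp
  define d where "d x = enn2real (D x)" for x
  have dm: "d \<in> borel_measurable borel" using D(1) unfolding d_def by measurable
  have int: "(d has_integral (G b - G a)) {a..b}" if ab: "a \<le> b" for a b
  proof -
    have "AE x in lborel. D x * indicator {a..b} x \<noteq> \<infinity>"
      by (rule nn_integral_PInf_AE) (use D(1) nn[OF ab] in auto)
    then have "(\<integral>\<^sup>+ x. ennreal (d x * indicator {a..b} x) \<partial>lborel) = (\<integral>\<^sup>+ x\<in>{a..b}. D x \<partial>lborel)"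
      by (intro nn_integral_cong_AE) (auto elim!: eventually_mono simp: d_def indicator_def less_top split: if_splits)
    then have "(\<integral>\<^sup>+ x. ennreal (d x * indicator {a..b} x) \<partial>lborel) = ennreal (G b - G a)"
      using nn[OF ab] by simp
    moreover have "(\<lambda>x. d x * indicator {a..b} x) \<in> borel_measurable borel" using dm by measurable
    ultimately have "((\<lambda>x. d x * indicator {a..b} x) has_integral (G b - G a)) UNIV"
      using Gexp[OF ab] ab by (intro nn_integral_has_integral) (auto simp: d_def)
    moreover have "(\<lambda>x. if x \<in> {a..b} then d x else 0) = (\<lambda>x. d x * indicator {a..b} x)"
      by (auto simp: indicator_def)
    ultimately show ?thesis
      using has_integral_restrict_UNIV[of "{a..b}" d "G b - G a"] by simp
  qed
  show ?thesis
  proof (rule that[of "\<lambda>x. d x - (L + 1)"])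
    show "(\<lambda>x. d x - (L + 1)) \<in> borel_measurable borel" using dm by simp
    fix a b :: real assume ab: "a \<le> b"
    show "((\<lambda>x. d x - (L + 1)) has_integral F b - F a) {a..b}"
      using has_integral_diff[OF int[OF ab] has_integral_const_real[of "L+1" a b]] ab
      by (simp add: G_def algebra_simps)
  qed
qed

lemma lipschitz_AE_has_vector_derivative:
  fixes F :: "real \<Rightarrow> real"
  assumes lip: "\<And>x y. \<bar>F x - F y\<bar> \<le> L * \<bar>x - y\<bar>"
  obtains f N where "f \<in> borel_measurable borel" "\<And>t. \<bar>f t\<bar> \<le> L" "negligible N"
    "\<And>t. t \<notin> N \<Longrightarrow> (F has_vector_derivative f t) (at t)"
proof -
  have L0: "L \<ge> 0" using lip[of 1 0] by simp
  obtain d where d: "d \<in> borel_measurable borel" "\<And>a b. a \<le> b \<Longrightarrow> (d has_integral (F b - F a)) {a..b}"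
    by (rule lipschitz_density[OF lip]) blast
  obtain N where N: "negligible N" "\<And>t. t \<notin> N \<Longrightarrow> (F has_vector_derivative d t) (at t)"
    by (rule AE_has_vector_derivative_indefinite_integral[OF d(2)]; blast)
  have bd: "\<bar>d t\<bar> \<le> L" if "t \<notin> N" for t
  proof -
    have "((\<lambda>h. \<bar>(F (t + h) - F t) / h\<bar>) \<longlongrightarrow> \<bar>d t\<bar>) (at 0)"
      using N(2)[OF that] by (intro tendsto_rabs) (simp add: DERIV_def has_real_derivative_iff_has_vector_derivative[symmetric])
    moreover have "\<bar>(F (t + h) - F t) / h\<bar> \<le> L" for h
      using lip[of "t+h" t] L0 by (cases "h = 0") (auto simp: field_simps abs_mult)
    ultimately show ?thesis
      by (intro tendsto_upperbound[of _ _ "at (0::real)"]) auto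
  qed
  define f where "f t = max (-L) (min L (d t))" for t
  show ?thesis
  proof (rule that[of f N])
    show "f \<in> borel_measurable borel" using d(1) unfolding f_def by measurable
    show "\<bar>f t\<bar> \<le> L" for t using L0 by (auto simp: f_def)
    show "(F has_vector_derivative f t) (at t)" if "t \<notin> N" for t
    proof -
      have "f t = d t" using bd[OF that] by (auto simp: f_def abs_le_iff)
      then show ?thesis using N(2)[OF that] by simp
    qed
  qed (rule N(1))
qed

subsection \<open>Continuously differentiable maps\<close>

lemma C_k_Suc_imp: "C_k (Suc n) F \<Longrightarrow> C_k n F"
proof (induction n arbitrary: F)
  case 0
  then show ?case
    by (auto simp: continuous_on_eq_continuous_at differentiable_imp_continuous_within)
next
  case (Suc n)
  then show ?case by simp
qed

lemma C_k_mono: "C_k m F \<Longrightarrow> n \<le> m \<Longrightarrow> C_k n F"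
proof (induction m)
  case (Suc m)
  then show ?case using C_k_Suc_imp[of m F] by (cases "n = Suc m") auto
qed simp

lemma frechet_derivative_expand:
  fixes F :: "'a::euclidean_space \<Rightarrow> 'b::euclidean_space"
  assumes "F differentiable (at x)"
  shows "frechet_derivative F (at x) v = (\<Sum>b\<in>Basis. (v \<bullet> b) *\<^sub>R frechet_derivative F (at x) b)"
proof -
  have lin: "linear (frechet_derivative F (at x))"
    using assms by (rule linear_frechet_derivative)
  have "frechet_derivative F (at x) v = frechet_derivative F (at x) (\<Sum>b\<in>Basis. (v \<bullet> b) *\<^sub>R b)"
    by (simp add: euclidean_representation)
  also have "\<dots> = (\<Sum>b\<in>Basis. (v \<bullet> b) *\<^sub>R frechet_derivative F (at x) b)"
    using lin by (simp add: linear_sum linear_scale)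
  finally show ?thesis .
qed

lemma continuous_on_frechet_derivative:
  fixes F :: "'a::euclidean_space \<Rightarrow> 'b::euclidean_space"
  assumes "C_k 1 F" "continuous_on UNIV g"
  shows "continuous_on UNIV (\<lambda>x. frechet_derivative F (at x) (g x))"
proof -
  have c: "continuous_on UNIV (\<lambda>x. \<Sum>b\<in>Basis. (g x \<bullet> b) *\<^sub>R frechet_derivative F (at x) b)"
    using assms by (intro continuous_intros) auto
  have eq: "(\<lambda>x. frechet_derivative F (at x) (g x)) = (\<lambda>x. \<Sum>b\<in>Basis. (g x \<bullet> b) *\<^sub>R frechet_derivative F (at x) b)"
  proof
    fix x show "frechet_derivative F (at x) (g x) = (\<Sum>b\<in>Basis. (g x \<bullet> b) *\<^sub>R frechet_derivative F (at x) b)"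
      by (rule frechet_derivative_expand) (use assms(1) in simp)
  qed
  show ?thesis by (subst eq) (rule c)
qed

lemma C_k_1_locally_lipschitz:
  fixes F :: "'a::euclidean_space \<Rightarrow> 'b::euclidean_space"
  assumes F: "C_k 1 F"
  obtains L where "L \<ge> 0" "\<And>x y. x \<in> cball 0 R \<Longrightarrow> y \<in> cball 0 R \<Longrightarrow> norm (F x - F y) \<le> L * norm (x - y)"
proof -
  define D where "D x v = frechet_derivative F (at x) v" for x v
  have diff: "F differentiable (at x)" for x using F by simp
  have "continuous_on (cball 0 R) (\<lambda>x. \<Sum>b\<in>Basis. norm (D x b))"
    using F by (intro continuous_intros) (auto simp: D_def intro: continuous_on_subset)
  then have "bounded ((\<lambda>x. \<Sum>b\<in>Basis. norm (D x b)) ` cball 0 R)"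
    by (intro compact_imp_bounded compact_continuous_image) auto
  then obtain L where "\<forall>y\<in>(\<lambda>x. \<Sum>b\<in>Basis. norm (D x b)) ` cball 0 R. norm y \<le> L"
    unfolding bounded_iff by blast
  then have L: "(\<Sum>b\<in>Basis. norm (D x b)) \<le> L" if "x \<in> cball 0 R" for x
    using that by (auto simp: abs_le_iff)
  define L' where "L' = max L 0"
  have "norm (D x v) \<le> L' * norm v" if "x \<in> cball 0 R" for x v
  proof -
    have "norm (D x v) \<le> (\<Sum>b\<in>Basis. norm ((v \<bullet> b) *\<^sub>R D x b))"
      unfolding D_def by (subst frechet_derivative_expand[OF diff]) (rule norm_sum)
    also have "\<dots> \<le> (\<Sum>b\<in>Basis. norm v * norm (D x b))"
      by (intro sum_mono) (auto intro!: mult_right_mono Basis_le_norm)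
    also have "\<dots> = norm v * (\<Sum>b\<in>Basis. norm (D x b))" by (simp add: sum_distrib_left)
    also have "\<dots> \<le> norm v * L'" using L[OF that] by (intro mult_left_mono) (auto simp: L'_def)
    finally show ?thesis by (simp add: mult.commute)
  qed
  then have on: "onorm (D x) \<le> L'" if "x \<in> cball 0 R" for x
    using that by (intro onorm_bound) (auto simp: L'_def)
  have "norm (F x - F y) \<le> L' * norm (x - y)" if "x \<in> cball 0 R" "y \<in> cball 0 R" for x y
    by (rule differentiable_bound[of "cball 0 R" F D])
      (use that on diff in \<open>auto simp: D_def[abs_def] frechet_derivative_works intro: has_derivative_at_withinI\<close>)
  then show ?thesis by (intro that[of L']) (auto simp: L'_def)
qed

lemma continuous_on_lie_lie:
  fixes f g :: "'a::euclidean_space \<Rightarrow> 'a" and h :: "'a \<Rightarrow> real"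
  assumes f: "C_k 2 f" and g: "C_k 2 g" and h: "C_k 3 h"
  shows "continuous_on UNIV (lie g (lie f h))"
proof -
  have f1: "C_k 1 f" and g0: "C_k 0 g" and h1: "C_k 1 h"
    using f g h by (auto intro: C_k_mono simp del: C_k.simps One_nat_def)
  define H where "H b x = frechet_derivative h (at x) b" for b x
  have H1: "C_k 1 (H b)" for b
  proof -
    have "C_k (Suc 2) h" using h by (simp add: numeral_3_eq_3 numeral_2_eq_2 del: C_k.simps)
    then have "C_k 2 (H b)" unfolding H_def by (simp only: C_k.simps(2))
    then show ?thesis by (rule C_k_mono) simp
  qed
  have fd: "f differentiable (at x)" for x using f1 by simp
  have hd: "h differentiable (at x)" for x using h1 by simp
  have Hd: "H b differentiable (at x)" for b x using H1[of b] by simp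
  have lie: "lie f h = (\<lambda>x. \<Sum>b\<in>Basis. (f x \<bullet> b) * H b x)"
    by (rule ext, simp only: lie_def H_def, subst frechet_derivative_expand[OF hd]) simp
  have deriv: "(lie f h has_derivative (\<lambda>v. \<Sum>b\<in>Basis. (f x \<bullet> b) * frechet_derivative (H b) (at x) v
      + (frechet_derivative f (at x) v \<bullet> b) * H b x)) (at x)" for x
    unfolding lie
    by (intro has_derivative_sum has_derivative_mult has_derivative_inner_left)
      (use fd Hd in \<open>auto simp: frechet_derivative_works[symmetric]\<close>)
  have "lie g (lie f h) = (\<lambda>x. \<Sum>b\<in>Basis. (f x \<bullet> b) * frechet_derivative (H b) (at x) (g x)
      + (frechet_derivative f (at x) (g x) \<bullet> b) * H b x)"
    using frechet_derivative_at[OF deriv] by (auto simp: lie_def[of g] fun_eq_iff dest: fun_cong)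
  moreover have "continuous_on UNIV (\<lambda>x. \<Sum>b\<in>Basis. (f x \<bullet> b) * frechet_derivative (H b) (at x) (g x)
      + (frechet_derivative f (at x) (g x) \<bullet> b) * H b x)"
    using f1 g0 H1 C_k_Suc_imp[of 0 f] C_k_Suc_imp[of 0 "H _"]
    by (intro continuous_intros continuous_on_frechet_derivative) auto
  ultimately show ?thesis by simp
qed

subsection \<open>Solutions with locally bounded right-hand side\<close>

definition lipschitz_solution ::
    "(real \<Rightarrow> 'a::euclidean_space \<Rightarrow> 'a) \<Rightarrow> real \<Rightarrow> real \<Rightarrow> (real \<Rightarrow> 'a) \<Rightarrow> bool" where
  "lipschitz_solution F a b x \<longleftrightarrow>
     (\<exists>L. \<forall>s\<in>{a..b}. \<forall>t\<in>{a..b}. norm (x s - x t) \<le> L * \<bar>s - t\<bar>) \<and>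
     (\<exists>N. negligible N \<and> (\<forall>t\<in>{a<..<b} - N. (x has_vector_derivative F t (x t)) (at t)))"

lemma lipschitz_solutionI:
  assumes "\<And>s t. s \<in> {a..b} \<Longrightarrow> t \<in> {a..b} \<Longrightarrow> norm (x s - x t) \<le> L * \<bar>s - t\<bar>"
    and "negligible N" "\<And>t. t \<in> {a<..<b} \<Longrightarrow> t \<notin> N \<Longrightarrow> (x has_vector_derivative F t (x t)) (at t)"
  shows "lipschitz_solution F a b x"
  using assms unfolding lipschitz_solution_def by blast

lemma lipschitz_solutionE:
  assumes "lipschitz_solution F a b x"
  obtains L N where "L \<ge> 0" "\<And>s t. s \<in> {a..b} \<Longrightarrow> t \<in> {a..b} \<Longrightarrow> norm (x s - x t) \<le> L * \<bar>s - t\<bar>"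
    "negligible N" "\<And>t. t \<in> {a<..<b} \<Longrightarrow> t \<notin> N \<Longrightarrow> (x has_vector_derivative F t (x t)) (at t)"
proof -
  obtain L N where *: "\<And>s t. s \<in> {a..b} \<Longrightarrow> t \<in> {a..b} \<Longrightarrow> norm (x s - x t) \<le> L * \<bar>s - t\<bar>"
    "negligible N" "\<And>t. t \<in> {a<..<b} \<Longrightarrow> t \<notin> N \<Longrightarrow> (x has_vector_derivative F t (x t)) (at t)"
    using assms unfolding lipschitz_solution_def by blast
  have "norm (x s - x t) \<le> max L 0 * \<bar>s - t\<bar>" if "s \<in> {a..b}" "t \<in> {a..b}" for s t
  proof -
    have "L * \<bar>s - t\<bar> \<le> max L 0 * \<bar>s - t\<bar>" by (intro mult_right_mono) auto
    then show ?thesis using *(1)[OF that] by linarith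
  qed
  then show ?thesis by (intro that[of "max L 0" N]) (use * in auto)
qed

lemma lipschitz_solution_continuous_on:
  assumes "lipschitz_solution F a b x"
  shows "continuous_on {a..b} x"
proof -
  obtain L N where "L \<ge> 0" "\<And>s t. s \<in> {a..b} \<Longrightarrow> t \<in> {a..b} \<Longrightarrow> norm (x s - x t) \<le> L * \<bar>s - t\<bar>"
    using lipschitz_solutionE[OF assms] by metis
  then show ?thesis
    by (intro lipschitz_on_continuous_on[of L] lipschitz_onI) (auto simp: dist_norm)
qed

lemma lipschitz_solution_subset:
  assumes "lipschitz_solution F a b x" "a \<le> c" "d \<le> b"
  shows "lipschitz_solution F c d x"
proof -
  obtain L N where *: "L \<ge> 0" "\<And>s t. s \<in> {a..b} \<Longrightarrow> t \<in> {a..b} \<Longrightarrow> norm (x s - x t) \<le> L * \<bar>s - t\<bar>"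
    "negligible N" "\<And>t. t \<in> {a<..<b} \<Longrightarrow> t \<notin> N \<Longrightarrow> (x has_vector_derivative F t (x t)) (at t)"
    using lipschitz_solutionE[OF assms(1)] by metis
  show ?thesis by (rule lipschitz_solutionI[of c d x L N]) (use * assms(2,3) in auto)
qed

lemma lipschitz_solution_cong:
  assumes "lipschitz_solution F a b x"
    and "\<And>t. t \<in> {a..b} \<Longrightarrow> y t = x t" "negligible N'"
    and "\<And>t. t \<in> {a<..<b} \<Longrightarrow> t \<notin> N' \<Longrightarrow> G t (x t) = F t (x t)"
  shows "lipschitz_solution G a b y"
proof -
  obtain L N where *: "L \<ge> 0" "\<And>s t. s \<in> {a..b} \<Longrightarrow> t \<in> {a..b} \<Longrightarrow> norm (x s - x t) \<le> L * \<bar>s - t\<bar>"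
    "negligible N" "\<And>t. t \<in> {a<..<b} \<Longrightarrow> t \<notin> N \<Longrightarrow> (x has_vector_derivative F t (x t)) (at t)"
    using lipschitz_solutionE[OF assms(1)] by metis
  show ?thesis
  proof (rule lipschitz_solutionI[of a b y L "N \<union> N'"])
    show "(y has_vector_derivative G t (y t)) (at t)" if "t \<in> {a<..<b}" "t \<notin> N \<union> N'" for t
    proof (rule has_vector_derivative_transform_within_open[where f=x and S="{a<..<b}"])
      show "(x has_vector_derivative G t (y t)) (at t)"
        using *(4)[of t] that assms(2)[of t] assms(4)[of t] by auto
    qed (use that assms(2) in auto)
  qed (use * assms in \<open>auto simp: negligible_Un\<close>)
qed

lemma lipschitz_solution_glue:
  assumes "lipschitz_solution F a b x" "lipschitz_solution F b c x" "a \<le> b" "b \<le> c"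
  shows "lipschitz_solution F a c x"
proof -
  obtain L1 N1 where P: "L1 \<ge> 0" "\<And>s t. s \<in> {a..b} \<Longrightarrow> t \<in> {a..b} \<Longrightarrow> norm (x s - x t) \<le> L1 * \<bar>s - t\<bar>"
    "negligible N1" "\<And>t. t \<in> {a<..<b} \<Longrightarrow> t \<notin> N1 \<Longrightarrow> (x has_vector_derivative F t (x t)) (at t)"
    using lipschitz_solutionE[OF assms(1)] by metis
  obtain L2 N2 where Q: "L2 \<ge> 0" "\<And>s t. s \<in> {b..c} \<Longrightarrow> t \<in> {b..c} \<Longrightarrow> norm (x s - x t) \<le> L2 * \<bar>s - t\<bar>"
    "negligible N2" "\<And>t. t \<in> {b<..<c} \<Longrightarrow> t \<notin> N2 \<Longrightarrow> (x has_vector_derivative F t (x t)) (at t)"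
    using lipschitz_solutionE[OF assms(2)] by metis
  define L where "L = max L1 L2"
  have le: "L1 * \<bar>r\<bar> \<le> L * \<bar>r\<bar>" "L2 * \<bar>r\<bar> \<le> L * \<bar>r\<bar>" for r :: real
    unfolding L_def by (intro mult_right_mono; simp)+
  have *: "norm (x t - x s) \<le> L * (t - s)" if st: "s \<in> {a..c}" "t \<in> {a..c}" "s \<le> t" for s t
  proof -
    consider "t \<le> b" | "b \<le> s" | "s < b" "b < t" by linarith
    then show ?thesis
    proof cases
      case 1
      then have "norm (x t - x s) \<le> L1 * \<bar>t - s\<bar>" using st by (intro P(2)) auto
      then show ?thesis using le(1)[of "t - s"] st by simp
    next
      case 2
      then have "norm (x t - x s) \<le> L2 * \<bar>t - s\<bar>" using st by (intro Q(2)) auto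
      then show ?thesis using le(2)[of "t - s"] st by simp
    next
      case 3
      have "norm (x t - x s) \<le> norm (x t - x b) + norm (x b - x s)"
        using norm_triangle_ineq[of "x t - x b" "x b - x s"] by simp
      also have "\<dots> \<le> L * (t - b) + L * (b - s)"
      proof (rule add_mono)
        have "norm (x b - x s) \<le> L1 * \<bar>b - s\<bar>" using 3 st by (intro P(2)) auto
        then show "norm (x b - x s) \<le> L * (b - s)" using order_trans[OF _ le(1)[of "b - s"]] 3 by force
        have "norm (x t - x b) \<le> L2 * \<bar>t - b\<bar>" using 3 st by (intro Q(2)) auto
        then show "norm (x t - x b) \<le> L * (t - b)" using order_trans[OF _ le(2)[of "t - b"]] 3 by force
      qed
      finally show ?thesis by (simp add: algebra_simps)
    qed
  qed
  show ?thesis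
  proof (rule lipschitz_solutionI[of a c x L "insert b (N1 \<union> N2)"])
    show "norm (x s - x t) \<le> L * \<bar>s - t\<bar>" if "s \<in> {a..c}" "t \<in> {a..c}" for s t
      using *[of s t] *[of t s] that by (cases "s \<le> t") (auto simp: norm_minus_commute)
    show "(x has_vector_derivative F t (x t)) (at t)" if "t \<in> {a<..<c}" "t \<notin> insert b (N1 \<union> N2)" for t
      using P(4)[of t] Q(4)[of t] that by (cases "t < b") auto
  qed (use P(3) Q(3) in auto)
qed

lemma lipschitz_solution_imp_caratheodory:
  assumes J: "J \<in> sets lebesgue" and T: "\<And>n::nat. lipschitz_solution F a (b n) x"
    "\<And>t. t \<in> J \<Longrightarrow> a \<le> t \<and> (\<exists>n. t \<le> b n)" "negligible E" "\<And>t. t \<in> J - E \<Longrightarrow> a < t \<and> (\<exists>n. t < b n)"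
  shows "caratheodory_solution F J x"
  unfolding caratheodory_solution_def
proof (intro conjI allI impI)
  fix c d assume cd: "{c..d} \<subseteq> J"
  show "abs_continuous_on {c..d} x"
  proof (cases "c \<le> d")
    case True
    then obtain n where n: "d \<le> b n" "a \<le> c" using T(2)[of d] T(2)[of c] cd by (auto simp: subset_iff)
    obtain L N where "L \<ge> 0" "\<And>s t. s \<in> {a..b n} \<Longrightarrow> t \<in> {a..b n} \<Longrightarrow> norm (x s - x t) \<le> L * \<bar>s - t\<bar>"
      using lipschitz_solutionE[OF T(1)[of n]] by metis
    then show ?thesis using n by (intro lipschitz_imp_abs_continuous_on[of _ x L]) auto
  next
    case False
    then show ?thesis by (intro lipschitz_imp_abs_continuous_on[of _ x 0]) auto
  qed
next
  have "\<forall>n. \<exists>N. negligible N \<and> (\<forall>t\<in>{a<..<b n} - N. (x has_vector_derivative F t (x t)) (at t))"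
    using T(1) unfolding lipschitz_solution_def by blast
  then obtain N where N: "\<And>n. negligible (N n)"
    "\<And>n t. t \<in> {a<..<b n} - N n \<Longrightarrow> (x has_vector_derivative F t (x t)) (at t)" by metis
  show "AE t in lebesgue_on J. (x has_vector_derivative F t (x t)) (at t within J)"
  proof (rule AE_lebesgue_on_negligibleI[OF _ _ J])
    show "negligible (E \<union> (\<Union>n. N n))"
      using N(1) T(3) by (intro negligible_Un negligible_Union_nat) auto
    fix t assume t: "t \<in> J" "t \<notin> E \<union> (\<Union>n. N n)"
    then obtain n where "a < t" "t < b n" using T(4)[of t] by auto
    then have "(x has_vector_derivative F t (x t)) (at t)" using N(2)[of t n] t by auto
    then show "(x has_vector_derivative F t (x t)) (at t within J)"
      by (rule has_vector_derivative_at_within)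
  qed
qed

lemma lipschitz_solution_caratheodory_Icc:
  assumes "lipschitz_solution F a b x" shows "caratheodory_solution F {a..b} x"
  by (rule lipschitz_solution_imp_caratheodory[of _ F a "\<lambda>_. b" x "{a,b}"])
    (use assms in \<open>auto simp: negligible_insert\<close>)

lemma lipschitz_solution_caratheodory_Ici:
  assumes "\<And>b. a \<le> b \<Longrightarrow> lipschitz_solution F a b x" shows "caratheodory_solution F {a..} x"
proof (rule lipschitz_solution_imp_caratheodory[of _ F a "\<lambda>n. a + real n" x "{a}"])
  show "a \<le> t \<and> (\<exists>n. t \<le> a + real n)" if "t \<in> {a..}" for t
    using that real_arch_simple[of "t - a"] by (auto simp: algebra_simps)
  show "a < t \<and> (\<exists>n. t < a + real n)" if "t \<in> {a..} - {a}" for t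
    using that reals_Archimedean2[of "t - a"] by (auto simp: algebra_simps)
qed (use assms in auto)

lemma caratheodory_imp_lipschitz_solution:
  assumes sol: "caratheodory_solution F J x" and J: "J \<in> sets lebesgue" "{a..b} \<subseteq> J"
    and c: "\<And>t. t \<in> {a..b} \<Longrightarrow> norm (F t (x t)) \<le> c"
  shows "lipschitz_solution F a b x"
proof -
  have sub: "{a<..<b} \<subseteq> J" using J(2) by (auto simp: subset_iff)
  have c': "norm (F t (x t)) \<le> max c 0" if "t \<in> {a..b}" for t using c[OF that] by simp
  have "AE t in lebesgue_on J. (x has_vector_derivative F t (x t)) (at t within J)"
    using sol by (simp add: caratheodory_solution_def)
  then obtain N where N: "negligible N"
    "\<And>t. t \<in> J \<Longrightarrow> t \<notin> N \<Longrightarrow> (x has_vector_derivative F t (x t)) (at t within J)"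
    by (rule AE_lebesgue_on_negligible[OF _ J(1)]) blast
  show ?thesis
  proof (rule lipschitz_solutionI[of a b x "max c 0" N])
    show "norm (x s - x t) \<le> max c 0 * \<bar>s - t\<bar>" if "s \<in> {a..b}" "t \<in> {a..b}" for s t
      by (rule caratheodory_solution_lipschitz[OF sol J _ c' that]) auto
    show "(x has_vector_derivative F t (x t)) (at t)" if "t \<in> {a<..<b}" "t \<notin> N" for t
    proof -
      have "(x has_vector_derivative F t (x t)) (at t within J)" using N(2)[of t] that J(2) by (auto simp: subset_iff)
      then have "(x has_vector_derivative F t (x t)) (at t within {a<..<b})"
        by (rule has_vector_derivative_within_subset) (rule sub)
      moreover have "at t within {a<..<b} = at t" using that(1) by (rule at_within_open) simp
      ultimately show ?thesis by simp
    qed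
  qed (rule N(1))
qed

lemma lipschitz_solution_has_integral:
  assumes "lipschitz_solution F a b x" "a \<le> c" "c \<le> d" "d \<le> b"
  shows "((\<lambda>t. F t (x t)) has_integral (x d - x c)) {c..d}"
  by (rule caratheodory_solution_has_integral[OF lipschitz_solution_caratheodory_Icc[OF assms(1)]])
    (use assms in auto)

lemma lipschitz_solution_closure:
  assumes sol: "\<And>b'. a \<le> b' \<Longrightarrow> b' < b \<Longrightarrow> lipschitz_solution F a b' x" and cont: "continuous_on {a..b} x"
    and ab: "a < b" and c: "\<And>t. t \<in> {a..<b} \<Longrightarrow> norm (F t (x t)) \<le> c"
  shows "lipschitz_solution F a b x"
proof -
  have c0: "c \<ge> 0" using order_trans[OF norm_ge_zero c[of a]] ab by simp
  have *: "norm (x t - x s) \<le> c * (t - s)" if "a \<le> s" "s \<le> t" "t < b" for s t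
    using has_integral_norm_bound_AE[OF lipschitz_solution_has_integral[OF sol[of t], of s t], of "{}" c]
      c c0 that ab by auto
  have **: "norm (x b - x s) \<le> c * (b - s)" if s: "a \<le> s" "s < b" for s
  proof (rule tendsto_le[of "at_left b"])
    have lim: "(x \<longlongrightarrow> x b) (at_left b)"
      by (rule continuous_on_Icc_at_leftD[OF cont ab])
    show "((\<lambda>t. norm (x t - x s)) \<longlongrightarrow> norm (x b - x s)) (at_left b)"
      by (intro tendsto_intros lim)
    show "((\<lambda>t. c * (t - s)) \<longlongrightarrow> c * (b - s)) (at_left b)"
      by (intro tendsto_intros)
    show "\<forall>\<^sub>F t in at_left b. norm (x t - x s) \<le> c * (t - s)"
      unfolding eventually_at_left_field using *[OF s(1)] s by (intro exI[of _ s]) auto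
  qed simp
  have ***: "norm (x t - x s) \<le> c * (t - s)" if "a \<le> s" "s \<le> t" "t \<le> b" for s t
    using *[of s t] **[of s] that by (cases "t = b"; cases "s = b") auto
  have "\<forall>n. \<exists>N. negligible N \<and> (\<forall>t\<in>{a<..<b - (b - a) / real (Suc n)} - N. (x has_vector_derivative F t (x t)) (at t))"
  proof
    fix n
    have "lipschitz_solution F a (b - (b - a) / real (Suc n)) x"
    proof (rule sol)
      have "(b - a) / real (Suc n) \<le> (b - a) / 1" using ab by (intro divide_left_mono) auto
      then show "a \<le> b - (b - a) / real (Suc n)" by simp
      show "b - (b - a) / real (Suc n) < b" using ab by simp
    qed
    then show "\<exists>N. negligible N \<and> (\<forall>t\<in>{a<..<b - (b - a) / real (Suc n)} - N. (x has_vector_derivative F t (x t)) (at t))"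
      unfolding lipschitz_solution_def by blast
  qed
  then obtain N where N: "\<And>n. negligible (N n)"
    "\<And>n t. t \<in> {a<..<b - (b - a) / real (Suc n)} - N n \<Longrightarrow> (x has_vector_derivative F t (x t)) (at t)" by metis
  show ?thesis
  proof (rule lipschitz_solutionI[of a b x c "\<Union>n. N n"])
    show "norm (x s - x t) \<le> c * \<bar>s - t\<bar>" if "s \<in> {a..b}" "t \<in> {a..b}" for s t
      using ***[of s t] ***[of t s] that by (cases "s \<le> t") (auto simp: norm_minus_commute)
    show "negligible (\<Union>n. N n)" using N(1) by (rule negligible_Union_nat)
    fix t assume t: "t \<in> {a<..<b}" "t \<notin> (\<Union>n. N n)"
    obtain n where "(b - a) / real (Suc n) < b - t"
    proof -
      obtain n where "(b - a) / (b - t) < real n" using reals_Archimedean2 by blast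
      then have "(b - a) < real (Suc n) * (b - t)" using t by (auto simp: field_simps)
      then show ?thesis by (intro that[of n]) (auto simp: field_simps)
    qed
    then show "(x has_vector_derivative F t (x t)) (at t)" using N(2)[of t n] t by auto
  qed
qed

lemma lipschitz_solution_unique:
  fixes f g :: "'a::euclidean_space \<Rightarrow> 'a"
  assumes f: "C_k 1 f" and g: "C_k 1 g" and M: "\<And>t. t \<in> {a..b} \<Longrightarrow> \<bar>u t\<bar> \<le> M"
    and x: "lipschitz_solution (\<lambda>t z. f z + u t *\<^sub>R g z) a b x"
    and y: "lipschitz_solution (\<lambda>t z. f z + u t *\<^sub>R g z) a b y"
    and xy: "x a = y a" and t: "t \<in> {a..b}"
  shows "x t = y t"
proof -
  have cx: "continuous_on {a..b} x" "continuous_on {a..b} y"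
    using x y by (auto intro: lipschitz_solution_continuous_on)
  have "bounded (x ` {a..b} \<union> y ` {a..b})"
    using cx by (intro bounded_Un[THEN iffD2] conjI compact_imp_bounded compact_continuous_image) auto
  then obtain R where R: "\<And>t. t \<in> {a..b} \<Longrightarrow> x t \<in> cball 0 R" "\<And>t. t \<in> {a..b} \<Longrightarrow> y t \<in> cball 0 R"
    unfolding bounded_iff by fastforce
  obtain Lf where Lf: "Lf \<ge> 0" "\<And>x y. x \<in> cball 0 R \<Longrightarrow> y \<in> cball 0 R \<Longrightarrow> norm (f x - f y) \<le> Lf * norm (x - y)"
    using C_k_1_locally_lipschitz[OF f] by metis
  obtain Lg where Lg: "Lg \<ge> 0" "\<And>x y. x \<in> cball 0 R \<Longrightarrow> y \<in> cball 0 R \<Longrightarrow> norm (g x - g y) \<le> Lg * norm (x - y)"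
    using C_k_1_locally_lipschitz[OF g] by metis
  have M0: "M \<ge> 0" using M[OF t] by linarith
  define K where "K = Lf + M * Lg"
  have K0: "K \<ge> 0" using Lf Lg M0 by (simp add: K_def)
  have Kb: "norm ((f (x s) + u s *\<^sub>R g (x s)) - (f (y s) + u s *\<^sub>R g (y s))) \<le> K * norm (x s - y s)"
    if s: "s \<in> {a..b}" for s
  proof -
    have "norm ((f (x s) + u s *\<^sub>R g (x s)) - (f (y s) + u s *\<^sub>R g (y s)))
      = norm ((f (x s) - f (y s)) + u s *\<^sub>R (g (x s) - g (y s)))"
      by (simp add: algebra_simps)
    also have "\<dots> \<le> norm (f (x s) - f (y s)) + \<bar>u s\<bar> * norm (g (x s) - g (y s))"
      by (rule order_trans[OF norm_triangle_ineq]) simp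
    also have "\<dots> \<le> Lf * norm (x s - y s) + M * (Lg * norm (x s - y s))"
      using Lf(2) Lg(2) R M M0 s by (intro add_mono mult_mono) auto
    finally show ?thesis by (simp add: K_def algebra_simps)
  qed
  define r where "r = 1 / (2 * (K + 1))"
  have r: "r > 0" "K * r \<le> 1 / 2" using K0 by (auto simp: r_def field_simps)
  have step: "\<forall>t\<in>{c..min b (c + r)}. x t = y t" if c: "c \<in> {a..b}" "x c = y c" for c
  proof -
    let ?I = "{c..min b (c + r)}"
    have "continuous_on ?I (\<lambda>t. norm (x t - y t))"
      using cx c by (intro continuous_intros) (auto elim!: continuous_on_subset)
    moreover have "?I \<noteq> {}" using c r by auto
    ultimately obtain m where m: "m \<in> ?I" "\<And>t. t \<in> ?I \<Longrightarrow> norm (x t - y t) \<le> norm (x m - y m)"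
      using continuous_attains_sup[of ?I "\<lambda>t. norm (x t - y t)"] by auto
    let ?W = "norm (x m - y m)"
    have "((\<lambda>t. (f (x t) + u t *\<^sub>R g (x t)) - (f (y t) + u t *\<^sub>R g (y t))) has_integral (x m - x c) - (y m - y c)) {c..m}"
      using lipschitz_solution_has_integral[OF x, of c m] lipschitz_solution_has_integral[OF y, of c m] c m(1)
      by (intro has_integral_diff) auto
    then have "norm ((x m - x c) - (y m - y c)) \<le> (K * ?W) * (m - c)"
    proof (rule has_integral_norm_bound_AE[where N="{}"])
      fix t assume "t \<in> {c..m}"
      then have "norm (f (x t) + u t *\<^sub>R g (x t) - (f (y t) + u t *\<^sub>R g (y t))) \<le> K * norm (x t - y t)"
        "norm (x t - y t) \<le> ?W"
        using Kb[of t] m c by auto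
      then show "norm (f (x t) + u t *\<^sub>R g (x t) - (f (y t) + u t *\<^sub>R g (y t))) \<le> K * ?W"
        using K0 by (meson mult_left_mono order_trans)
    qed (use m K0 in auto)
    also have "\<dots> \<le> (K * ?W) * r" using m K0 by (intro mult_left_mono) auto
    also have "\<dots> = (K * r) * ?W" by simp
    also have "\<dots> \<le> 1 / 2 * ?W" using r(2) by (intro mult_right_mono) auto
    finally have "?W \<le> 0" using c(2) by simp
    then show ?thesis using m(2) by fastforce
  qed
  have "\<forall>t\<in>{a..min b (a + real n * r)}. x t = y t" for n
  proof (induction n)
    case 0
    then show ?case using xy by auto
  next
    case (Suc n)
    show ?case
    proof
      fix t assume t: "t \<in> {a..min b (a + real (Suc n) * r)}"
      show "x t = y t"
      proof (cases "t \<le> a + real n * r")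
        case True then show ?thesis using Suc t by auto
      next
        case False
        then have "a + real n * r \<in> {a..b}" using t r by auto
        moreover from this have "x (a + real n * r) = y (a + real n * r)" using Suc by auto
        ultimately show ?thesis using step[of "a + real n * r"] t False by (auto simp: algebra_simps)
      qed
    qed
  qed
  moreover obtain n where "(t - a) / r < real n" using reals_Archimedean2 by blast
  then have "t \<le> a + real n * r" using r by (auto simp: field_simps)
  ultimately show ?thesis using t by auto
qed

subsection \<open>Regularity of Sobolev functions\<close>

lemma Linf_AE_bound:
  fixes u :: "real \<Rightarrow> 'a::euclidean_space"
  assumes "u \<in> Linf I"
  obtains K where "K \<ge> 0" "AE t in lebesgue_on I. norm (u t) \<le> K"
proof -
  have "esssup (lebesgue_on I) (\<lambda>t. ereal (norm (u t))) < \<infinity>"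
    using assms by (simp add: Linf_def Linf_norm_def)
  then obtain K where K: "esssup (lebesgue_on I) (\<lambda>t. ereal (norm (u t))) \<le> ereal K"
    by (metis ereal_dense2 less_imp_le)
  have "AE t in lebesgue_on I. norm (u t) \<le> max K 0"
    using esssup_AE[of "\<lambda>t. ereal (norm (u t))" "lebesgue_on I"]
  proof eventually_elim
    case (elim t)
    then have "ereal (norm (u t)) \<le> ereal K" using K by (rule order_trans)
    then show ?case by simp
  qed
  then show ?thesis by (intro that[of "max K 0"]) auto
qed

lemma Linf_norm_le:
  fixes u :: "real \<Rightarrow> 'a::euclidean_space"
  assumes "u \<in> borel_measurable (lebesgue_on I)" "\<And>t. t \<in> I \<Longrightarrow> norm (u t) \<le> K"
  shows "Linf_norm I u \<le> ereal K"
  unfolding Linf_norm_def using assms by (intro esssup_I) (auto intro!: AE_I2)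

lemma Linf_norm_leD:
  fixes u :: "real \<Rightarrow> 'a::euclidean_space"
  assumes "Linf_norm I u \<le> ereal K"
  shows "AE t in lebesgue_on I. norm (u t) \<le> K"
  using esssup_AE[of "\<lambda>t. ereal (norm (u t))" "lebesgue_on I"]
proof eventually_elim
  case (elim t)
  then have "ereal (norm (u t)) \<le> ereal K"
    using assms unfolding Linf_norm_def by (rule order_trans)
  then show ?case by simp
qed

lemma bounded_in_Linf:
  fixes u :: "real \<Rightarrow> 'a::euclidean_space"
  assumes "u \<in> borel_measurable (lebesgue_on I)" "\<And>t. t \<in> I \<Longrightarrow> norm (u t) \<le> K"
  shows "u \<in> Linf I"
proof -
  have "Linf_norm I u \<le> ereal K" using assms by (rule Linf_norm_le)
  also have "\<dots> < \<infinity>" by simp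
  finally show ?thesis using assms by (simp add: Linf_def)
qed

lemma negligible_Diff_dense:
  fixes N :: "real set"
  assumes "negligible N" "a < b"
  obtains t where "a < t" "t < b" "t \<notin> N"
proof -
  have "\<not> negligible {a<..<b}" using assms(2) by (intro open_not_negligible) auto
  then have "\<not> {a<..<b} \<subseteq> N" using assms(1) negligible_subset by blast
  then obtain t where "t \<in> {a<..<b}" "t \<notin> N" by blast
  then show ?thesis by (intro that[of t]) auto
qed

lemma lebesgue_sets_Ici: "{a..} \<in> sets lebesgue" for a :: real
  by simp

lemma AE_bound_continuous_on_Ici:
  fixes u :: "real \<Rightarrow> 'a::euclidean_space"
  assumes "AE t in lebesgue_on {a..}. norm (u t) \<le> K" "continuous_on {a..} u" "a \<le> t"
  shows "norm (u t) \<le> K"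
proof (rule ccontr)
  assume *: "\<not> norm (u t) \<le> K"
  obtain N where N: "negligible N" "\<And>t. t \<in> {a..} \<Longrightarrow> t \<notin> N \<Longrightarrow> norm (u t) \<le> K"
    using AE_lebesgue_on_negligible[OF assms(1) lebesgue_sets_Ici] by blast
  have e: "norm (u t) - K > 0" and t: "t \<in> {a..}" using * assms(3) by simp_all
  obtain d where d: "d > 0" "\<And>s. s \<in> {a..} \<Longrightarrow> dist s t < d \<Longrightarrow> dist (u s) (u t) < norm (u t) - K"
    using assms(2)[unfolded continuous_on_iff, THEN bspec, OF t, THEN spec, THEN mp, OF e] by blast
  obtain s where s: "t < s" "s < t + d" "s \<notin> N"
    using negligible_Diff_dense[OF N(1), of t "t + d"] d(1) by auto
  have "dist (u s) (u t) < norm (u t) - K" using s assms(3) by (intro d(2)) (auto simp: dist_real_def)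
  moreover have "norm (u s) \<le> K" using N(2)[of s] s assms(3) by auto
  ultimately show False using norm_triangle_ineq2[of "u t" "u s"] by (simp add: dist_norm norm_minus_commute)
qed

lemma C_k_1_realI:
  fixes \<phi> :: "real \<Rightarrow> real"
  assumes d: "\<And>x. (\<phi> has_real_derivative \<phi>' x) (at x)" and c: "continuous_on UNIV \<phi>'"
  shows "C_k 1 \<phi>" "deriv \<phi> = \<phi>'"
proof -
  have fd: "frechet_derivative \<phi> (at x) = (\<lambda>v. \<phi>' x * v)" for x
    using frechet_derivative_at[of \<phi> "\<lambda>v. \<phi>' x * v" x] d[of x] by (simp add: has_field_derivative_def)
  have "\<phi> differentiable (at x)" for x
    using d[of x] by (auto simp: differentiable_def has_field_derivative_def)
  moreover have "continuous_on UNIV (\<lambda>x. frechet_derivative \<phi> (at x) v)" for v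
    unfolding fd using c by (intro continuous_intros)
  ultimately show "C_k 1 \<phi>" by simp
  show "deriv \<phi> = \<phi>'" using d by (auto intro!: DERIV_imp_deriv)
qed

lemma integrable_lebesgue_indicator_Icc:
  fixes p q :: real
  shows "integrable lebesgue (indicat_real {p..q})"
  by (rule integrable_real_indicator) (auto simp: emeasure_lborel_Icc_eq)

lemma weak_derivative_bound:
  fixes \<phi> :: "real \<Rightarrow> real"
  assumes wd: "weak_derivative {0..} u v" and v: "AE t in lebesgue_on {0..}. norm (v t) \<le> K" "0 \<le> K"
    and \<phi>: "C_k 1 \<phi>" "\<And>t. t \<notin> {p..q} \<Longrightarrow> \<phi> t = 0" "\<And>t. \<bar>\<phi> t\<bar> \<le> c" and pq: "0 < p" "p \<le> q"
  shows "\<bar>LINT t:{0..}|lebesgue. u t * deriv \<phi> t\<bar> \<le> K * c * (q - p)"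
    "(LINT t:{0..}|lebesgue. u t * deriv \<phi> t) = - (LINT t:{0..}|lebesgue. v t * \<phi> t)"
proof -
  have "{t. \<phi> t \<noteq> 0} \<subseteq> {p..q}" using \<phi>(2) by blast
  then have sub: "closure {t. \<phi> t \<noteq> 0} \<subseteq> {p..q}"
    by (rule closure_minimal) simp
  have "compact (closure {t. \<phi> t \<noteq> 0})"
    using sub compact_Int_closed[OF compact_Icc[of p q], of "closure {t. \<phi> t \<noteq> 0}"]
    by (simp add: Int_absorb1)
  moreover have "closure {t. \<phi> t \<noteq> 0} \<subseteq> interior {0..}"
    using sub pq by (auto simp: interior_real_atLeast)
  ultimately show eq: "(LINT t:{0..}|lebesgue. u t * deriv \<phi> t) = - (LINT t:{0..}|lebesgue. v t * \<phi> t)"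
    using wd \<phi>(1) unfolding weak_derivative_def by blast
  have c0: "0 \<le> c" using order_trans[OF abs_ge_zero \<phi>(3)] .
  define F where "F t = indicat_real {0..} t *\<^sub>R (v t * \<phi> t)" for t
  have bd: "AE t in lebesgue. norm (F t) \<le> K * c * indicator {p..q} t"
  proof -
    have "AE t in lebesgue. t \<in> {0..} \<longrightarrow> norm (v t) \<le> K"
      using v(1) by (simp add: AE_restrict_space_iff)
    then show ?thesis
    proof eventually_elim
      case (elim t)
      show ?case
      proof (cases "t \<in> {p..q}")
        case True
        then have "\<bar>v t\<bar> * \<bar>\<phi> t\<bar> \<le> K * c" using elim pq \<phi>(3)[of t] v(2) by (intro mult_mono) auto
        then show ?thesis using True pq by (simp add: F_def abs_mult)
      next
        case False
        then show ?thesis using \<phi>(2)[of t] by (simp add: F_def)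
      qed
    qed
  qed
  have "\<bar>LINT t|lebesgue. F t\<bar> \<le> K * c * (q - p)"
  proof (cases "integrable lebesgue F")
    case True
    have "norm (LINT t|lebesgue. F t) \<le> (LINT t|lebesgue. norm (F t))" by (rule integral_norm_bound)
    also have "\<dots> \<le> (LINT t|lebesgue. K * c * indicator {p..q} t)"
      using True bd by (intro integral_mono_AE integrable_norm integrable_mult_right integrable_lebesgue_indicator_Icc) auto
    also have "\<dots> = K * c * (q - p)" using pq by simp
    finally show ?thesis by simp
  next
    case False
    then show ?thesis using v(2) c0 pq by (simp add: not_integrable_integral_eq)
  qed
  then show "\<bar>LINT t:{0..}|lebesgue. u t * deriv \<phi> t\<bar> \<le> K * c * (q - p)"
    unfolding eq by (simp add: set_lebesgue_integral_def F_def)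
qed

lemma set_lebesgue_integral_compact_support:
  fixes F :: "real \<Rightarrow> real"
  assumes "continuous_on {p..q} F" "\<And>t. t \<notin> {p..q} \<Longrightarrow> F t = 0" "0 < p"
  shows "set_integrable lebesgue {0..} F" "(LINT t:{0..}|lebesgue. F t) = integral {p..q} F"
proof -
  have i: "set_integrable lebesgue {p..q} F" using assms(1) by (rule absolutely_integrable_continuous_real)
  have eq: "(\<lambda>t. indicat_real {0..} t *\<^sub>R F t) = (\<lambda>t. indicat_real {p..q} t *\<^sub>R F t)"
    using assms(2,3) by (auto simp: indicator_def fun_eq_iff)
  show "set_integrable lebesgue {0..} F" using i unfolding set_integrable_def eq .
  show "(LINT t:{0..}|lebesgue. F t) = integral {p..q} F"
    using set_lebesgue_integral_eq_integral(2)[OF i] unfolding set_lebesgue_integral_def eq .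
qed

definition tpow :: "nat \<Rightarrow> real \<Rightarrow> real" where
  "tpow k t = (max 0 t) ^ k"

lemma tpow_has_derivative:
  "(tpow (Suc (Suc k)) has_real_derivative (real (Suc (Suc k)) * tpow (Suc k) t)) (at t)"
proof -
  consider "t < 0" | "t > 0" | "t = 0" by linarith
  then show ?thesis
  proof cases
    case 1
    have "((\<lambda>t. 0) has_real_derivative 0) (at t)" by simp
    then have "(tpow (Suc (Suc k)) has_real_derivative 0) (at t)"
      by (rule has_field_derivative_transform_within_open[where S="{..<0}"]) (use 1 in \<open>auto simp: tpow_def max_def\<close>)
    then show ?thesis using 1 by (simp add: tpow_def)
  next
    case 2
    have "((\<lambda>t. t ^ Suc (Suc k)) has_real_derivative (real (Suc (Suc k)) * t ^ Suc k)) (at t)"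
      using DERIV_pow[of "Suc (Suc k)" t] by simp
    then have "(tpow (Suc (Suc k)) has_real_derivative (real (Suc (Suc k)) * t ^ Suc k)) (at t)"
      by (rule has_field_derivative_transform_within_open[where S="{0<..}"]) (use 2 in \<open>auto simp: tpow_def max_def\<close>)
    then show ?thesis using 2 by (simp add: tpow_def)
  next
    case 3
    have "(\<lambda>h. tpow (Suc (Suc k)) h / h) \<midarrow>0\<rightarrow> 0"
    proof (rule Lim_null_comparison)
      show "\<forall>\<^sub>F h in at 0. norm (tpow (Suc (Suc k)) h / h) \<le> \<bar>h\<bar> ^ Suc k"
      proof (rule always_eventually, rule allI)
        fix h :: real
        show "norm (tpow (Suc (Suc k)) h / h) \<le> \<bar>h\<bar> ^ Suc k"
        proof (cases "h > 0")
          case False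
          then have "tpow (Suc (Suc k)) h = 0" by (simp add: tpow_def max_def)
          moreover have "0 \<le> \<bar>h\<bar> ^ Suc k" by (rule zero_le_power) simp
          ultimately show ?thesis by simp
        qed (simp add: tpow_def)
      qed
      have "((\<lambda>h::real. \<bar>h\<bar> ^ Suc k) \<longlongrightarrow> \<bar>0\<bar> ^ Suc k) (at 0)" by (intro tendsto_intros)
      then show "((\<lambda>h::real. \<bar>h\<bar> ^ Suc k) \<longlongrightarrow> 0) (at 0)" by simp
    qed
    then show ?thesis using 3 by (simp add: DERIV_def tpow_def)
  qed
qed

lemma continuous_on_tpow[continuous_intros]:
  "continuous_on S f \<Longrightarrow> continuous_on S (\<lambda>x. tpow k (f x))"
  unfolding tpow_def by (intro continuous_intros)

text \<open>A \<open>C\<^sup>1\<close> step from 0 to 1 on \<open>[0,1]\<close> as a quadratic spline, with its derivative and antiderivative.\<close>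

definition hat :: "real \<Rightarrow> real" where
  "hat t = 4 * (tpow 1 t - 2 * tpow 1 (t - 1/2) + tpow 1 (t - 1))"
definition ramp :: "real \<Rightarrow> real" where
  "ramp t = 2 * (tpow 2 t - 2 * tpow 2 (t - 1/2) + tpow 2 (t - 1))"
definition iramp :: "real \<Rightarrow> real" where
  "iramp t = 2 / 3 * (tpow 3 t - 2 * tpow 3 (t - 1/2) + tpow 3 (t - 1))"

lemma ramp_has_derivative: "(ramp has_real_derivative hat t) (at t)"
  unfolding ramp_def[abs_def] hat_def numeral_2_eq_2
  by (rule derivative_eq_intros DERIV_chain'[OF _ tpow_has_derivative] refl)+ simp

lemma iramp_has_derivative: "(iramp has_real_derivative ramp t) (at t)"
  unfolding iramp_def[abs_def] ramp_def numeral_3_eq_3 numeral_2_eq_2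
  by (rule derivative_eq_intros DERIV_chain'[OF _ tpow_has_derivative] refl)+ simp

lemma hat_nonneg: "0 \<le> hat t" and hat_outside: "t \<notin> {0..1} \<Longrightarrow> hat t = 0"
  by (auto simp: hat_def tpow_def max_def)

lemma ramp_left: "t \<le> 0 \<Longrightarrow> ramp t = 0" and ramp_right: "1 \<le> t \<Longrightarrow> ramp t = 1"
  by (auto simp: ramp_def tpow_def max_def power2_eq_square algebra_simps)

lemma iramp_left: "t \<le> 0 \<Longrightarrow> iramp t = 0" and iramp_right: "1 \<le> t \<Longrightarrow> iramp t = t - 1/2"
  by (auto simp: iramp_def tpow_def max_def power3_eq_cube algebra_simps)

lemma ramp_mono: "s \<le> t \<Longrightarrow> ramp s \<le> ramp t"
  by (rule DERIV_nonneg_imp_nondecreasing[of s t ramp]) (use ramp_has_derivative hat_nonneg in blast)+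

lemma ramp_bounds: "0 \<le> ramp t" "ramp t \<le> 1"
  using ramp_mono[of "min t 0" t] ramp_mono[of t "max t 1"] ramp_left[of "min t 0"] ramp_right[of "max t 1"]
  by auto

lemma iramp_mono: "s \<le> t \<Longrightarrow> iramp s \<le> iramp t"
  by (rule DERIV_nonneg_imp_nondecreasing[of s t iramp]) (use iramp_has_derivative ramp_bounds in blast)+

lemma iramp_lip: assumes "s \<le> t" shows "iramp t - iramp s \<le> t - s"
proof -
  have "s - iramp s \<le> t - iramp t"
  proof (rule DERIV_nonneg_imp_nondecreasing[of s t "\<lambda>t. t - iramp t"])
    fix x
    have "((\<lambda>t. t - iramp t) has_real_derivative 1 - ramp x) (at x)"
      by (auto intro!: derivative_eq_intros iramp_has_derivative)
    then show "\<exists>y. ((\<lambda>t. t - iramp t) has_real_derivative y) (at x) \<and> 0 \<le> y"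
      using ramp_bounds(2)[of x] by auto
  qed (rule assms)
  then show ?thesis by simp
qed

lemma continuous_on_hat[continuous_intros]: "continuous_on S f \<Longrightarrow> continuous_on S (\<lambda>x. hat (f x))"
  and continuous_on_ramp[continuous_intros]: "continuous_on S f \<Longrightarrow> continuous_on S (\<lambda>x. ramp (f x))"
  unfolding hat_def ramp_def by (intro continuous_intros; assumption)+

definition mollify :: "(real \<Rightarrow> real) \<Rightarrow> nat \<Rightarrow> real \<Rightarrow> real" where
  "mollify y n c = (LINT t:{0..}|lebesgue. y t * (real n * hat (real n * (t - c))))"

lemma scaled_hat_outside: "n > 0 \<Longrightarrow> t \<notin> {c..c + 1 / real n} \<Longrightarrow> hat (real n * (t - c)) = 0"
  by (rule hat_outside) (auto simp: field_simps mult_less_0_iff zero_le_mult_iff)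

lemma mollify_integrable:
  assumes "continuous_on {0..} y" "c > 0" "n > 0"
  shows "set_integrable lebesgue {0..} (\<lambda>t. y t * (real n * hat (real n * (t - c))))"
    "mollify y n c = integral {c..c + 1 / real n} (\<lambda>t. y t * (real n * hat (real n * (t - c))))"
proof -
  have "continuous_on {c..c + 1 / real n} (\<lambda>t. y t * (real n * hat (real n * (t - c))))"
    by (intro continuous_intros continuous_on_subset[OF assms(1)]) (use assms in auto)
  from set_lebesgue_integral_compact_support[OF this] assms scaled_hat_outside[of n _ c]
  show "set_integrable lebesgue {0..} (\<lambda>t. y t * (real n * hat (real n * (t - c))))"
    "mollify y n c = integral {c..c + 1 / real n} (\<lambda>t. y t * (real n * hat (real n * (t - c))))"
    by (auto simp: mollify_def)
qed

lemma scaled_ramp_has_derivative: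
  "((\<lambda>t. ramp (real n * (t - c))) has_real_derivative real n * hat (real n * (t - c))) (at t)"
proof -
  have "((\<lambda>t. real n * (t - c)) has_real_derivative real n) (at t)"
    by (auto intro!: derivative_eq_intros)
  from DERIV_chain'[OF this ramp_has_derivative] show ?thesis by (simp add: mult.commute)
qed

lemma mollify_tendsto:
  assumes y: "continuous_on {0..} y" and c: "c > 0"
  shows "(\<lambda>n. mollify y n c) \<longlonglongrightarrow> y c"
proof (rule LIMSEQ_I)
  fix e :: real assume e: "e > 0"
  obtain d where d: "d > 0" "\<And>s. s \<in> {0..} \<Longrightarrow> dist s c < d \<Longrightarrow> dist (y s) (y c) < e / 2"
    using y[unfolded continuous_on_iff, rule_format, of c "e / 2"] c e by auto
  obtain n0 where n0: "1 / d < real n0" using reals_Archimedean2 by blast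
  have "norm (mollify y n c - y c) < e" if n: "n \<ge> max n0 1" for n
  proof -
    let ?I = "{c..c + 1 / real n}" and ?s = "\<lambda>t. real n * hat (real n * (t - c))"
    have n1: "n > 0" "1 / real n < d"
    proof -
      show "n > 0" using n by simp
      have "1 / d < real n" using n n0 by linarith
      then show "1 / real n < d" using d(1) \<open>n > 0\<close> by (simp add: field_simps)
    qed
    have s1: "(?s has_integral 1) ?I"
    proof -
      have "(?s has_integral ramp (real n * (c + 1 / real n - c)) - ramp (real n * (c - c))) ?I"
        by (rule fundamental_theorem_of_calculus)
          (use scaled_ramp_has_derivative n1 in \<open>auto simp: has_real_derivative_iff_has_vector_derivative intro: has_vector_derivative_at_within\<close>)
      then show ?thesis using n1 ramp_left[of 0] ramp_right[of 1] by simp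
    qed
    have ys: "(\<lambda>t. y t * ?s t) integrable_on ?I"
      by (intro integrable_continuous_real continuous_intros continuous_on_subset[OF y]) (use c in auto)
    have i1: "((\<lambda>t. y t * ?s t - y c * ?s t) has_integral (mollify y n c - y c * 1)) ?I"
      unfolding mollify_integrable(2)[OF y c n1(1)]
      by (intro has_integral_diff has_integral_mult_right s1 integrable_integral ys)
    have i2: "((\<lambda>t. (e / 2) * ?s t) has_integral (e / 2 * 1)) ?I"
      by (intro has_integral_mult_right s1)
    have "norm (integral ?I (\<lambda>t. y t * ?s t - y c * ?s t)) \<le> integral ?I (\<lambda>t. (e / 2) * ?s t)"
    proof (rule integral_norm_bound_integral[OF has_integral_integrable[OF i1] has_integral_integrable[OF i2]])
      fix t assume t: "t \<in> ?I"
      have "\<bar>y t - y c\<bar> \<le> e / 2" using d(2)[of t] t c n1(2) by (auto simp: dist_real_def)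
      then have "\<bar>y t - y c\<bar> * ?s t \<le> (e / 2) * ?s t" using hat_nonneg by (intro mult_right_mono) auto
      moreover have "norm (y t * ?s t - y c * ?s t) = \<bar>y t - y c\<bar> * ?s t"
        using hat_nonneg[of "real n * (t - c)"] by (simp add: left_diff_distrib[symmetric] abs_mult)
      ultimately show "norm (y t * ?s t - y c * ?s t) \<le> (e / 2) * ?s t" by simp
    qed
    then have "norm (mollify y n c - y c) \<le> e / 2"
      unfolding integral_unique[OF i1] integral_unique[OF i2] by simp
    then show ?thesis using e by simp
  qed
  then show "\<exists>no. \<forall>n\<ge>no. norm (mollify y n c - y c) < e" by blast
qed


lemma weak_derivative_lipschitz:
  assumes wd: "weak_derivative {0..} y v" and v: "AE t in lebesgue_on {0..}. norm (v t) \<le> K" "0 \<le> K"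
    and y: "continuous_on {0..} y" and ab: "0 < a" "a \<le> b"
  shows "\<bar>y b - y a\<bar> \<le> K * (b - a)"
proof -
  have *: "\<bar>mollify y n a - mollify y n b\<bar> \<le> K * (b + 1 / real n - a)" if n: "n > 0" for n
  proof -
    define \<phi> where "\<phi> t = ramp (real n * (t - a)) - ramp (real n * (t - b))" for t
    define \<phi>' where "\<phi>' t = real n * hat (real n * (t - a)) - real n * hat (real n * (t - b))" for t
    have d: "(\<phi> has_real_derivative \<phi>' t) (at t)" for t
      unfolding \<phi>_def[abs_def] \<phi>'_def by (intro DERIV_diff scaled_ramp_has_derivative)
    have c: "continuous_on UNIV \<phi>'" unfolding \<phi>'_def[abs_def] by (intro continuous_intros)
    note C = C_k_1_realI[OF d c]
    have out: "\<phi> t = 0" if nt: "t \<notin> {a..b + 1 / real n}" for t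
    proof -
      consider "t < a" | "t > b + 1 / real n" using nt unfolding atLeastAtMost_iff de_Morgan_conj not_le by blast
      then show ?thesis
      proof cases
        case 1
        then have "real n * (t - a) \<le> 0" "real n * (t - b) \<le> 0" using ab n by (auto simp: mult_le_0_iff)
        then show ?thesis by (simp add: \<phi>_def ramp_left)
      next
        case 2
        then have "1 \<le> real n * (t - b)" using n by (simp add: field_simps)
        moreover have "real n * (t - b) \<le> real n * (t - a)" using ab by (intro mult_left_mono) auto
        ultimately show ?thesis by (simp add: \<phi>_def ramp_right)
      qed
    qed
    have bd: "\<bar>\<phi> t\<bar> \<le> 1" for t
      using ramp_bounds[of "real n * (t - a)"] ramp_bounds[of "real n * (t - b)"] by (simp add: \<phi>_def abs_le_iff)
    have "\<bar>LINT t:{0..}|lebesgue. y t * deriv \<phi> t\<bar> \<le> K * 1 * (b + 1 / real n - a)"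
      by (rule weak_derivative_bound(1)[OF wd v C(1) out bd]) (use ab divide_nonneg_nonneg[of 1 "real n"] in linarith)+
    moreover have "(LINT t:{0..}|lebesgue. y t * deriv \<phi> t) = mollify y n a - mollify y n b"
      unfolding C(2) \<phi>'_def mollify_def right_diff_distrib[of "y t" for t]
      by (rule set_integral_diff(2)) (use mollify_integrable(1)[OF y] ab n in auto)
    ultimately show ?thesis by simp
  qed
  have "\<bar>y a - y b\<bar> \<le> K * (b + 0 - a)"
  proof (rule LIMSEQ_le)
    show "(\<lambda>n. \<bar>mollify y n a - mollify y n b\<bar>) \<longlonglongrightarrow> \<bar>y a - y b\<bar>"
      by (intro tendsto_intros mollify_tendsto[OF y]) (use ab in auto)
    show "(\<lambda>n. K * (b + 1 / real n - a)) \<longlonglongrightarrow> K * (b + 0 - a)"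
      by (intro tendsto_intros lim_1_over_n)
    show "\<exists>N. \<forall>n\<ge>N. \<bar>mollify y n a - mollify y n b\<bar> \<le> K * (b + 1 / real n - a)"
      using * by (intro exI[of _ 1]) auto
  qed
  then show ?thesis by (simp add: abs_minus_commute)
qed

lemma weak_derivative_second_difference:
  assumes wd: "weak_derivative {0..} y v" "weak_derivative {0..} v w"
    and v: "v \<in> Linf {0..}" and w: "AE t in lebesgue_on {0..}. norm (w t) \<le> K" "0 \<le> K"
    and y: "continuous_on {0..} y" and ab: "0 < a" "a \<le> b" and s: "0 \<le> s" "s \<le> b - a"
  shows "\<bar>(y (b + s) - y b) - (y (a + s) - y a)\<bar> \<le> 2 * K * s * (b - a)"
proof -
  obtain Kv where Kv: "Kv \<ge> 0" "AE t in lebesgue_on {0..}. norm (v t) \<le> Kv"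
    using Linf_AE_bound[OF v] by blast
  let ?m = "\<lambda>n c. mollify y n c"
  have *: "\<bar>(?m n (b + s) - ?m n b) - (?m n (a + s) - ?m n a)\<bar> \<le> K * s * (b + s + 1 / real n - a)" if n: "n > 0" for n
  proof -
    define P where "P c t = iramp (real n * (t - c)) / real n" for c t
    define R where "R c t = ramp (real n * (t - c))" for c t
    define H where "H c t = real n * hat (real n * (t - c))" for c t
    have dP: "(P c has_real_derivative R c t) (at t)" for c t
    proof -
      have "((\<lambda>t. iramp (real n * (t - c))) has_real_derivative ramp (real n * (t - c)) * real n) (at t)"
        by (rule DERIV_chain'[OF _ iramp_has_derivative]) (auto intro!: derivative_eq_intros)
      from DERIV_cdivide[OF this, of "real n"] show ?thesis using n unfolding P_def[abs_def] R_def by simp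
    qed
    have dR: "(R c has_real_derivative H c t) (at t)" for c t
      unfolding R_def[abs_def] H_def by (rule scaled_ramp_has_derivative)
    have cR: "continuous_on S (R c)" and cH: "continuous_on S (H c)" for c S
      unfolding R_def[abs_def] H_def[abs_def] by (intro continuous_intros)+
    have Rl: "R c t = 0" if "t \<le> c" for c t
      using that n unfolding R_def by (intro ramp_left) (auto simp: mult_le_0_iff)
    have Rr: "R c t = 1" if "c + 1 / real n \<le> t" for c t
      using that n unfolding R_def by (intro ramp_right) (auto simp: field_simps)
    have R01: "0 \<le> R c t" "R c t \<le> 1" for c t using ramp_bounds by (auto simp: R_def)
    have Pl: "P c t = 0" if "t \<le> c" for c t
    proof -
      have "real n * (t - c) \<le> 0" using that by (simp add: mult_le_0_iff)
      then show ?thesis by (simp add: P_def iramp_left)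
    qed
    have Pr: "P c t = t - c - 1 / (2 * real n)" if "c + 1 / real n \<le> t" for c t
    proof -
      have "1 \<le> real n * (t - c)" using that n by (simp add: field_simps)
      then show ?thesis using n by (simp add: P_def iramp_right field_simps)
    qed
    have Pd: "0 \<le> P c t - P (c + s) t" "P c t - P (c + s) t \<le> s" for c t
    proof -
      have le: "real n * (t - (c + s)) \<le> real n * (t - c)" using s by (intro mult_left_mono) auto
      show "0 \<le> P c t - P (c + s) t" using iramp_mono[OF le] n by (simp add: P_def divide_right_mono)
      have "iramp (real n * (t - c)) - iramp (real n * (t - (c + s))) \<le> real n * s"
        using iramp_lip[OF le] by (simp add: algebra_simps)
      then show "P c t - P (c + s) t \<le> s" using n by (simp add: P_def field_simps)
    qed
    define \<phi> where "\<phi> t = (P a t - P (a + s) t) - (P b t - P (b + s) t)" for t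
    define \<phi>' where "\<phi>' t = (R a t - R (a + s) t) - (R b t - R (b + s) t)" for t
    have d: "(\<phi> has_real_derivative \<phi>' t) (at t)" for t
      unfolding \<phi>_def[abs_def] \<phi>'_def by (intro DERIV_diff dP)
    have c: "continuous_on UNIV \<phi>'" unfolding \<phi>'_def[abs_def] by (intro continuous_intros cR)
    note C = C_k_1_realI[OF d c]
    have out: "\<phi> t = 0" if nt: "t \<notin> {a..b + s + 1 / real n}" for t
    proof -
      consider "t < a" | "t > b + s + 1 / real n" using nt unfolding atLeastAtMost_iff de_Morgan_conj not_le by blast
      then show ?thesis using ab s by cases (auto simp: \<phi>_def Pl Pr)
    qed
    have bd: "\<bar>\<phi> t\<bar> \<le> s" for t
      using Pd[where c=a and t=t] Pd[where c=b and t=t] by (simp add: \<phi>_def abs_le_iff)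
    have b1: "\<bar>LINT t:{0..}|lebesgue. v t * deriv \<phi> t\<bar> \<le> K * s * (b + s + 1 / real n - a)"
      by (rule weak_derivative_bound(1)[OF wd(2) w C(1) out bd]) (use ab s divide_nonneg_nonneg[of 1 "real n"] in linarith)+
    have first: "set_integrable lebesgue {0..} (\<lambda>t. v t * (R c t - R (c + s) t))"
      "(LINT t:{0..}|lebesgue. v t * (R c t - R (c + s) t)) = ?m n (c + s) - ?m n c" if c0: "0 < c" for c
    proof -
      define \<rho> where "\<rho> t = R c t - R (c + s) t" for t
      have d: "(\<rho> has_real_derivative (H c t - H (c + s) t)) (at t)" for t
        unfolding \<rho>_def[abs_def] by (intro DERIV_diff dR)
      have cc: "continuous_on UNIV (\<lambda>t. H c t - H (c + s) t)" by (intro continuous_intros cH)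
      note D = C_k_1_realI[OF d cc]
      have out: "\<rho> t = 0" if nt: "t \<notin> {c..c + s + 1 / real n}" for t
      proof -
        consider "t < c" | "t > c + s + 1 / real n" using nt unfolding atLeastAtMost_iff de_Morgan_conj not_le by blast
        then show ?thesis using s by cases (auto simp: \<rho>_def Rl Rr)
      qed
      have bd: "\<bar>\<rho> t\<bar> \<le> 1" for t
        using R01[of c t] R01[of "c + s" t] by (simp add: \<rho>_def abs_le_iff)
      have "(LINT t:{0..}|lebesgue. y t * deriv \<rho> t) = - (LINT t:{0..}|lebesgue. v t * \<rho> t)"
        by (rule weak_derivative_bound(2)[where p=c and q="c + s + 1 / real n", OF wd(1) Kv(2,1) D(1) out bd]) (use c0 s divide_nonneg_nonneg[of 1 "real n"] in linarith)+
      moreover have "(LINT t:{0..}|lebesgue. y t * deriv \<rho> t) = ?m n c - ?m n (c + s)"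
        unfolding D(2) H_def mollify_def right_diff_distrib[of "y t" for t]
        by (rule set_integral_diff(2)) (use mollify_integrable(1)[OF y] c0 s n in auto)
      ultimately show "(LINT t:{0..}|lebesgue. v t * (R c t - R (c + s) t)) = ?m n (c + s) - ?m n c"
        by (simp add: \<rho>_def)
      show "set_integrable lebesgue {0..} (\<lambda>t. v t * (R c t - R (c + s) t))"
        unfolding set_integrable_def
      proof (rule Bochner_Integration.integrable_bound)
        show "integrable lebesgue (\<lambda>t. Kv * indicat_real {c..c + s + 1 / real n} t)"
          by (intro integrable_mult_right integrable_lebesgue_indicator_Icc)
        have "(\<lambda>t. indicat_real {0..} t *\<^sub>R v t) \<in> borel_measurable lebesgue"
          using v by (simp add: Linf_def borel_measurable_restrict_space_iff)
        moreover have "\<rho> \<in> borel_measurable lebesgue"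
        proof -
          have "continuous_on UNIV \<rho>" unfolding \<rho>_def[abs_def] by (intro continuous_intros cR)
          then have "\<rho> \<in> borel_measurable lborel" by (simp add: borel_measurable_continuous_onI)
          then show ?thesis by (rule measurable_completion)
        qed
        ultimately have "(\<lambda>t. (indicat_real {0..} t *\<^sub>R v t) * \<rho> t) \<in> borel_measurable lebesgue"
          by (rule borel_measurable_times)
        then show "(\<lambda>t. indicat_real {0..} t *\<^sub>R (v t * (R c t - R (c + s) t))) \<in> borel_measurable lebesgue"
          by (simp add: \<rho>_def mult.assoc)
        have "AE t in lebesgue. t \<in> {0..} \<longrightarrow> norm (v t) \<le> Kv"
          using Kv(2) by (simp add: AE_restrict_space_iff)
        then show "AE t in lebesgue. norm (indicat_real {0..} t *\<^sub>R (v t * (R c t - R (c + s) t)))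
            \<le> norm (Kv * indicat_real {c..c + s + 1 / real n} t)"
        proof eventually_elim
          case (elim t)
          show ?case
          proof (cases "t \<in> {c..c + s + 1 / real n}")
            case True
            then have "\<bar>v t\<bar> * \<bar>\<rho> t\<bar> \<le> Kv * 1" using elim bd[of t] c0 Kv(1) by (intro mult_mono) auto
            then show ?thesis using True c0 Kv(1) by (simp add: abs_mult \<rho>_def)
          next
            case False
            then show ?thesis using out[of t] by (simp add: \<rho>_def)
          qed
        qed
      qed
    qed
    have "(LINT t:{0..}|lebesgue. v t * deriv \<phi> t) = (?m n (a + s) - ?m n a) - (?m n (b + s) - ?m n b)"
    proof -
      have "(LINT t:{0..}|lebesgue. v t * deriv \<phi> t) = (LINT t:{0..}|lebesgue. v t * (R a t - R (a + s) t) - v t * (R b t - R (b + s) t))"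
        unfolding C(2) \<phi>'_def by (simp add: algebra_simps)
      also have "\<dots> = (LINT t:{0..}|lebesgue. v t * (R a t - R (a + s) t)) - (LINT t:{0..}|lebesgue. v t * (R b t - R (b + s) t))"
        by (rule set_integral_diff(2)) (use first(1) ab in auto)
      finally show ?thesis using first(2)[of a] first(2)[of b] ab by simp
    qed
    with b1 show ?thesis by (simp add: abs_minus_commute)
  qed
  have "\<bar>(y (b + s) - y b) - (y (a + s) - y a)\<bar> \<le> K * s * (b + s + 0 - a)"
  proof (rule LIMSEQ_le)
    show "(\<lambda>n. \<bar>(?m n (b + s) - ?m n b) - (?m n (a + s) - ?m n a)\<bar>) \<longlonglongrightarrow> \<bar>(y (b + s) - y b) - (y (a + s) - y a)\<bar>"
      by (intro tendsto_intros mollify_tendsto[OF y]) (use ab s in auto)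
    show "(\<lambda>n. K * s * (b + s + 1 / real n - a)) \<longlonglongrightarrow> K * s * (b + s + 0 - a)"
      by (intro tendsto_intros lim_1_over_n)
    show "\<exists>N. \<forall>n\<ge>N. \<bar>(?m n (b + s) - ?m n b) - (?m n (a + s) - ?m n a)\<bar> \<le> K * s * (b + s + 1 / real n - a)"
      using * by (intro exI[of _ 1]) auto
  qed
  also have "\<dots> \<le> K * s * (2 * (b - a))" using w(2) s by (intro mult_left_mono) auto
  finally show ?thesis by (simp add: algebra_simps)
qed

lemma at_within_Icc_Ici: "at s within {a..s + 1} = at s within {a..}" for s :: real
  by (rule at_within_nhd[of s "{..<s + 1}"]) auto

lemma W2inf_regular:
  assumes y: "y \<in> W2inf"
  obtains dy K where "K \<ge> 0" "\<And>t. t \<ge> 0 \<Longrightarrow> (y has_vector_derivative dy t) (at t within {0..})"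
    "\<And>t. t \<ge> 0 \<Longrightarrow> \<bar>y t\<bar> \<le> K" "\<And>t. t \<ge> 0 \<Longrightarrow> \<bar>dy t\<bar> \<le> K"
    "\<And>s t. s \<ge> 0 \<Longrightarrow> t \<ge> 0 \<Longrightarrow> \<bar>dy s - dy t\<bar> \<le> K * \<bar>s - t\<bar>"
proof -
  have yc: "continuous_on {0..} y" and yL: "y \<in> Linf {0..}"
    using y by (auto simp: W2inf_def numeral_2_eq_2)
  obtain v w where vw: "weak_derivative {0..} y v" "v \<in> Linf {0..}" "weak_derivative {0..} v w" "w \<in> Linf {0..}"
    using y by (auto simp: W2inf_def numeral_2_eq_2)
  obtain Ky where Ky: "Ky \<ge> 0" "AE t in lebesgue_on {0..}. norm (y t) \<le> Ky" by (rule Linf_AE_bound[OF yL])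
  obtain Kv where Kv: "Kv \<ge> 0" "AE t in lebesgue_on {0..}. norm (v t) \<le> Kv" by (rule Linf_AE_bound[OF vw(2)])
  obtain Kw where Kw: "Kw \<ge> 0" "AE t in lebesgue_on {0..}. norm (w t) \<le> Kw" by (rule Linf_AE_bound[OF vw(4)])
  have yb: "\<bar>y t\<bar> \<le> Ky" if "t \<ge> 0" for t
    using AE_bound_continuous_on_Ici[OF Ky(2) yc that] by simp
  note lip1 = weak_derivative_lipschitz[OF vw(1) Kv(2,1) yc]
  note lip2 = weak_derivative_second_difference[OF vw(1,3,2) Kw(2,1) yc]
  define Y where "Y t = y (max 0 t)" for t
  have Y0: "Kv-lipschitz_on {0..} y"
  proof -
    have "Kv-lipschitz_on {0<..} y"
      using lip1 Kv(1) by (intro lipschitz_on_leI) (auto simp: dist_real_def abs_minus_commute)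
    then have "Kv-lipschitz_on (closure {0<..}) y"
      by (rule lipschitz_on_closure) (use yc in simp)
    then show ?thesis by simp
  qed
  have Ylip: "\<bar>Y s - Y t\<bar> \<le> Kv * \<bar>s - t\<bar>" for s t
  proof -
    have "\<bar>Y s - Y t\<bar> \<le> Kv * \<bar>max 0 s - max 0 t\<bar>"
      using lipschitz_onD[OF Y0, of "max 0 s" "max 0 t"] by (simp add: Y_def dist_real_def)
    also have "\<dots> \<le> Kv * \<bar>s - t\<bar>" using Kv(1) by (intro mult_left_mono) auto
    finally show ?thesis .
  qed
  obtain f N where f: "\<And>t. \<bar>f t\<bar> \<le> Kv" "negligible N" "\<And>t. t \<notin> N \<Longrightarrow> (Y has_vector_derivative f t) (at t)"
    by (rule lipschitz_AE_has_vector_derivative[OF Ylip]) (rule that; assumption)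
  have fd: "\<bar>f b - f a\<bar> \<le> 2 * Kw * (b - a)" if ab: "0 < a" "a < b" "a \<notin> N" "b \<notin> N" for a b
  proof -
    have lim: "((\<lambda>h. (Y (t + h) - Y t) / h) \<longlongrightarrow> f t) (at_right 0)" if "t \<notin> N" for t
    proof -
      have "(Y has_real_derivative f t) (at t)"
        using f(3)[OF that] by (simp only: has_real_derivative_iff_has_vector_derivative)
      then have "((\<lambda>h. (Y (t + h) - Y t) / h) \<longlongrightarrow> f t) (at 0)" by (simp only: DERIV_def)
      then show ?thesis by (rule tendsto_mono[OF at_le[OF subset_UNIV]])
    qed
    show ?thesis
    proof (rule tendsto_upperbound)
      show "((\<lambda>h. \<bar>(Y (b + h) - Y b) / h - (Y (a + h) - Y a) / h\<bar>) \<longlongrightarrow> \<bar>f b - f a\<bar>) (at_right 0)"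
        by (intro tendsto_intros lim ab)
      show "\<forall>\<^sub>F h in at_right 0. \<bar>(Y (b + h) - Y b) / h - (Y (a + h) - Y a) / h\<bar> \<le> 2 * Kw * (b - a)"
        unfolding eventually_at_right_field
      proof (intro exI[of _ "b - a"] conjI allI impI)
        fix h assume h: "0 < h" "h < b - a"
        have "\<bar>(y (b + h) - y b) - (y (a + h) - y a)\<bar> \<le> 2 * Kw * h * (b - a)"
          using lip2[of a b h] ab h by simp
        then have "\<bar>(Y (b + h) - Y b) - (Y (a + h) - Y a)\<bar> \<le> (2 * Kw * (b - a)) * h"
          using ab h by (simp add: Y_def mult_ac)
        then have "\<bar>(Y (b + h) - Y b) - (Y (a + h) - Y a)\<bar> / h \<le> 2 * Kw * (b - a)"
          using h by (simp add: pos_divide_le_eq)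
        moreover have "\<bar>(Y (b + h) - Y b) / h - (Y (a + h) - Y a) / h\<bar> = \<bar>(Y (b + h) - Y b) - (Y (a + h) - Y a)\<bar> / h"
          using h by (simp add: diff_divide_distrib[symmetric] abs_divide)
        ultimately show "\<bar>(Y (b + h) - Y b) / h - (Y (a + h) - Y a) / h\<bar> \<le> 2 * Kw * (b - a)" by simp
      qed (use ab in simp)
    qed simp
  qed
  have "(2 * Kw)-lipschitz_on ({0<..} - N) f"
  proof (rule lipschitz_on_leI)
    fix a b assume ab: "a \<in> {0<..} - N" "b \<in> {0<..} - N" "a \<le> b"
    show "dist (f a) (f b) \<le> 2 * Kw * dist a b"
      using fd[of a b] ab by (cases "a = b") (auto simp: dist_real_def abs_minus_commute)
  qed (use Kw in simp)
  then obtain g where g: "(2 * Kw)-lipschitz_on (closure ({0<..} - N)) g" "\<And>t. t \<in> {0<..} - N \<Longrightarrow> g t = f t"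
    using lipschitz_extend_closure by blast
  have cl: "closure ({0<..} - N) \<supseteq> {0..}"
  proof
    fix t :: real assume t: "t \<in> {0..}"
    show "t \<in> closure ({0<..} - N)"
      unfolding closure_approachable
    proof (intro allI impI)
      fix e :: real assume e: "e > 0"
      obtain s where "t < s" "s < t + e" "s \<notin> N" using negligible_Diff_dense[OF f(2), of t "t + e"] e by auto
      then show "\<exists>s\<in>{0<..} - N. dist s t < e" using t by (intro bexI[of _ s]) (auto simp: dist_real_def)
    qed
  qed
  have glip: "\<bar>g s - g t\<bar> \<le> 2 * Kw * \<bar>s - t\<bar>" if "s \<ge> 0" "t \<ge> 0" for s t
    using lipschitz_onD[OF g(1), of s t] cl that by (auto simp: dist_real_def)
  have gc: "continuous_on {0..} g"
    using lipschitz_on_continuous_on[OF g(1)] cl by (rule continuous_on_subset)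
  have gb: "\<bar>g t\<bar> \<le> Kv" if "t \<ge> 0" for t
  proof -
    have "AE t in lebesgue_on {0..}. norm (g t) \<le> Kv"
      by (rule AE_lebesgue_on_negligibleI[of "insert 0 N"]) (use f(1,2) g(2) in auto)
    from AE_bound_continuous_on_Ici[OF this gc that] show ?thesis by simp
  qed
  have der: "(y has_vector_derivative g t) (at t within {0..})" if t: "t \<ge> 0" for t
  proof -
    have int: "(g has_integral (y s - y 0)) {0..s}" if s: "0 \<le> s" for s
    proof -
      have "lipschitz_solution (\<lambda>t z. g t) 0 s Y"
        by (rule lipschitz_solutionI[of _ _ _ Kv N]) (use Ylip f(2,3) g(2) in auto)
      from lipschitz_solution_has_integral[OF this order_refl s order_refl]
      show ?thesis using s by (simp add: Y_def)
    qed
    have "((\<lambda>s. integral {0..s} g) has_vector_derivative g t) (at t within {0..t + 1})"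
      by (rule integral_has_vector_derivative[OF continuous_on_subset[OF gc]]) (use t in auto)
    then have "((\<lambda>s. integral {0..s} g + y 0) has_vector_derivative g t) (at t within {0..t + 1})"
      by (auto intro!: derivative_eq_intros)
    then have "(y has_vector_derivative g t) (at t within {0..t + 1})"
      by (rule has_vector_derivative_transform[rotated 2]) (use t integral_unique[OF int] in auto)
    moreover have "at t within {0..t + 1} = at t within {0..}"
      by (rule at_within_Icc_Ici)
    ultimately show ?thesis by simp
  qed
  define K where "K = max Ky (max Kv (2 * Kw))"
  show ?thesis
  proof (rule that[of K g])
    show "K \<ge> 0" using Ky by (simp add: K_def)
    show "\<bar>y t\<bar> \<le> K" "\<bar>g t\<bar> \<le> K" if "t \<ge> 0" for t
      using yb[OF that] gb[OF that] by (auto simp: K_def)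
    show "\<bar>g s - g t\<bar> \<le> K * \<bar>s - t\<bar>" if "s \<ge> 0" "t \<ge> 0" for s t
      using order_trans[OF glip[OF that] mult_right_mono[of "2 * Kw" K "\<bar>s - t\<bar>"]] by (auto simp: K_def)
  qed (rule der)
qed

subsection \<open>Steering the tracking error inside the funnels\<close>

lemma vector_derivative_nonneg_imp_le:
  fixes f :: "real \<Rightarrow> real"
  assumes "a \<le> b" "\<And>x. x \<in> {a..b} \<Longrightarrow> (f has_vector_derivative f' x) (at x within {a..b})"
    and "\<And>x. x \<in> {a..b} \<Longrightarrow> 0 \<le> f' x"
  shows "f a \<le> f b"
  using has_integral_nonneg[OF fundamental_theorem_of_calculus[OF assms(1,2)] assms(3)] by simp

lemma lipschitz_mult_bound:
  fixes f1 f2 g1 g2 :: real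
  assumes "\<bar>f1 - f2\<bar> \<le> p * r" "\<bar>g1 - g2\<bar> \<le> q * r" "\<bar>f1\<bar> \<le> A" "\<bar>g2\<bar> \<le> B" "0 \<le> A" "0 \<le> B"
  shows "\<bar>f1 * g1 - f2 * g2\<bar> \<le> (A * q + B * p) * r"
proof -
  have "f1 * g1 - f2 * g2 = f1 * (g1 - g2) + g2 * (f1 - f2)" by (simp add: algebra_simps)
  then have "\<bar>f1 * g1 - f2 * g2\<bar> \<le> \<bar>f1\<bar> * \<bar>g1 - g2\<bar> + \<bar>g2\<bar> * \<bar>f1 - f2\<bar>"
    by (metis abs_mult abs_triangle_ineq)
  also have "\<dots> \<le> A * (q * r) + B * (p * r)" using assms by (intro add_mono mult_mono) auto
  finally show ?thesis by (simp add: algebra_simps)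
qed

locale funnel_pair =
  fixes \<psi>0 d\<psi>0 \<psi>1 :: "real \<Rightarrow> real" and K m \<epsilon> :: real
  assumes m: "0 < m" and \<epsilon>: "0 < \<epsilon>" "\<epsilon> \<le> m"
    and \<psi>0_deriv: "\<And>t. t \<ge> 0 \<Longrightarrow> (\<psi>0 has_vector_derivative d\<psi>0 t) (at t within {0..})"
    and bounds: "\<And>t. t \<ge> 0 \<Longrightarrow> m \<le> \<psi>0 t" "\<And>t. t \<ge> 0 \<Longrightarrow> \<psi>0 t \<le> K"
      "\<And>t. t \<ge> 0 \<Longrightarrow> m \<le> \<psi>1 t" "\<And>t. t \<ge> 0 \<Longrightarrow> \<psi>1 t \<le> K"
    and lip: "\<And>s t. s \<ge> 0 \<Longrightarrow> t \<ge> 0 \<Longrightarrow> \<bar>d\<psi>0 s - d\<psi>0 t\<bar> \<le> K * \<bar>s - t\<bar>"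
      "\<And>s t. s \<ge> 0 \<Longrightarrow> t \<ge> 0 \<Longrightarrow> \<bar>\<psi>1 s - \<psi>1 t\<bar> \<le> K * \<bar>s - t\<bar>"
    and compat: "\<And>t. t \<ge> 0 \<Longrightarrow> \<epsilon> - d\<psi>0 t \<le> \<psi>1 t"
begin

lemma K_pos: "0 < K" "m \<le> K"
  using m bounds(1,2)[of 0] by auto

lemma \<psi>1_cont: "continuous_on {0..} \<psi>1" and d\<psi>0_cont: "continuous_on {0..} d\<psi>0"
  using lip K_pos by (auto intro!: lipschitz_on_continuous_on[of K] lipschitz_onI simp: dist_real_def)

lemma \<psi>0_cont: "continuous_on {0..} \<psi>0"
  using \<psi>0_deriv by (auto simp: continuous_on_eq_continuous_within intro!: has_vector_derivative_continuous)

text \<open>If the error is near the boundary of the funnel and approaches it, braking with an acceleration of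
  \<open>W > M\<close> relative to the boundary, over the remaining distance \<open>d\<close>, is possible iff \<open>v\<^sup>2 < 2 W d\<close>.\<close>

definition safe :: "real \<Rightarrow> real \<Rightarrow> real \<Rightarrow> real \<Rightarrow> bool" where
  "safe M t e v \<longleftrightarrow>
     (m / 2 \<le> e \<and> d\<psi>0 t < v \<longrightarrow> (v - d\<psi>0 t)\<^sup>2 \<le> 2 * M * (\<psi>0 t - e)) \<and>
     (m / 2 \<le> - e \<and> d\<psi>0 t < - v \<longrightarrow> (- v - d\<psi>0 t)\<^sup>2 \<le> 2 * M * (\<psi>0 t + e))"

lemma safe_uminus: "safe M t (- e) (- v) \<longleftrightarrow> safe M t e v"
  unfolding safe_def by auto

definition funnel_path :: "real \<Rightarrow> real \<Rightarrow> real \<Rightarrow> real \<Rightarrow> (real \<Rightarrow> real) \<Rightarrow> (real \<Rightarrow> real) \<Rightarrow> bool" where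
  "funnel_path W t e0 v0 e v \<longleftrightarrow> e t = e0 \<and> v t = v0 \<and>
     (\<forall>s\<ge>t. (e has_vector_derivative v s) (at s within {t..}) \<and> \<bar>e s\<bar> < \<psi>0 s \<and> \<bar>v s\<bar> < \<psi>1 s) \<and>
     (\<forall>s\<ge>t. \<forall>r\<ge>t. \<bar>v s - v r\<bar> \<le> W * \<bar>s - r\<bar>)"

lemma funnel_path_uminus:
  "funnel_path W t e0 v0 e v \<Longrightarrow> funnel_path W t (- e0) (- v0) (\<lambda>s. - e s) (\<lambda>s. - v s)"
  unfolding funnel_path_def by (auto intro!: derivative_eq_intros simp: abs_minus_commute)

lemma integral_path_deriv:
  fixes v :: "real \<Rightarrow> real"
  assumes "continuous_on {t..} v" "s \<ge> t"
  shows "((\<lambda>s. e0 + integral {t..s} v) has_vector_derivative v s) (at s within {t..})"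
proof -
  have "((\<lambda>s. integral {t..s} v) has_vector_derivative v s) (at s within {t..s + 1})"
    by (rule integral_has_vector_derivative[OF continuous_on_subset[OF assms(1)]]) (use assms in auto)
  moreover have "at s within {t..s + 1} = at s within {t..}"
    by (rule at_within_Icc_Ici)
  ultimately show ?thesis by (auto intro!: derivative_eq_intros)
qed

lemma displacement_bound:
  fixes v :: "real \<Rightarrow> real"
  assumes "continuous_on {t..} v" "s \<ge> t" "\<And>r. r \<in> {t..s} \<Longrightarrow> \<bar>v r\<bar> \<le> c"
  shows "\<bar>integral {t..s} v\<bar> \<le> c * (s - t)"
proof -
  have "continuous_on {t..s} v" by (rule continuous_on_subset[OF assms(1)]) auto
  then show ?thesis using integral_bound[of t s v c] assms(2,3) by auto
qed

definition brake_time :: "real \<Rightarrow> real" where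
  "brake_time M = min (m / (4 * K)) (\<epsilon> / (2 * (M + 1 + 4 * K)))"

definition ramp_up :: "real \<Rightarrow> real \<Rightarrow> real \<Rightarrow> real" where
  "ramp_up \<theta> t s = min 1 ((s - t) / \<theta>)"

lemma brake_time:
  assumes "M \<ge> 0"
  shows "0 < brake_time M" "K * brake_time M \<le> m / 4" "M + 1 \<le> \<epsilon> / (2 * brake_time M) - 4 * K"
proof -
  let ?\<theta> = "brake_time M" and ?a = "M + 1 + 4 * K"
  have a: "?a > 0" using assms K_pos by simp
  show p: "0 < ?\<theta>" using assms K_pos m \<epsilon> by (simp add: brake_time_def)
  have "?\<theta> \<le> m / (4 * K)" by (simp add: brake_time_def)
  then show "K * ?\<theta> \<le> m / 4" using K_pos by (simp add: field_simps)
  have "?\<theta> \<le> \<epsilon> / (2 * ?a)" by (simp add: brake_time_def)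
  then have "?\<theta> * (2 * ?a) \<le> \<epsilon>" using a by (simp add: pos_le_divide_eq)
  then have "?a * (2 * ?\<theta>) \<le> \<epsilon>" by (simp add: algebra_simps)
  then have "?a \<le> \<epsilon> / (2 * ?\<theta>)" using p by (simp add: pos_le_divide_eq)
  then show "M + 1 \<le> \<epsilon> / (2 * ?\<theta>) - 4 * K" by simp
qed

lemma ramp_up:
  assumes "\<theta> > 0"
  shows "s \<ge> t \<Longrightarrow> 0 \<le> ramp_up \<theta> t s" "ramp_up \<theta> t s \<le> 1" "ramp_up \<theta> t t = 0" "s \<ge> t + \<theta> \<Longrightarrow> ramp_up \<theta> t s = 1"
    "s \<le> t + \<theta> \<Longrightarrow> ramp_up \<theta> t s = (s - t) / \<theta>" "\<bar>ramp_up \<theta> t s - ramp_up \<theta> t r\<bar> \<le> 1 / \<theta> * \<bar>s - r\<bar>"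
proof -
  have "\<bar>ramp_up \<theta> t s - ramp_up \<theta> t r\<bar> \<le> \<bar>(s - t) / \<theta> - (r - t) / \<theta>\<bar>"
    by (auto simp: ramp_up_def min_def)
  also have "\<dots> = \<bar>(s - r) / \<theta>\<bar>" by (simp add: diff_divide_distrib[symmetric])
  finally show "\<bar>ramp_up \<theta> t s - ramp_up \<theta> t r\<bar> \<le> 1 / \<theta> * \<bar>s - r\<bar>" using assms by (simp add: abs_divide)
qed (use assms in \<open>auto simp: ramp_up_def field_simps\<close>)

lemma steer_center:
  assumes t: "t \<ge> 0" and e0: "\<bar>e0\<bar> < m / 2" and v0: "\<bar>v0\<bar> < \<psi>1 t" and \<theta>: "\<theta> > 0" "K * \<theta> \<le> m / 4"
  shows "\<exists>e v. funnel_path (K + K / \<theta>) t e0 v0 e v"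
proof -
  define b where "b = v0 / \<psi>1 t"
  have p1: "0 < \<psi>1 s" if "s \<ge> 0" for s using bounds(3)[OF that] m by simp
  have b: "\<bar>b\<bar> < 1" using v0 p1[OF t] by (simp add: b_def abs_divide)
  define v where "v s = (1 - ramp_up \<theta> t s) * (b * \<psi>1 s)" for s
  define e where "e s = e0 + integral {t..s} v" for s
  have bl: "\<bar>b * \<psi>1 s - b * \<psi>1 r\<bar> \<le> K * \<bar>s - r\<bar>" if "s \<ge> t" "r \<ge> t" for s r
  proof -
    have "\<bar>b * \<psi>1 s - b * \<psi>1 r\<bar> = \<bar>b\<bar> * \<bar>\<psi>1 s - \<psi>1 r\<bar>" by (simp add: right_diff_distrib[symmetric] abs_mult)
    also have "\<dots> \<le> 1 * (K * \<bar>s - r\<bar>)" using b lip(2)[of s r] that t by (intro mult_mono) auto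
    finally show ?thesis by simp
  qed
  have bb: "\<bar>b * \<psi>1 s\<bar> < \<psi>1 s" if "s \<ge> t" for s
    using b p1[of s] that t by (simp add: abs_mult)
  have vl: "\<bar>v s - v r\<bar> \<le> (K + K / \<theta>) * \<bar>s - r\<bar>" if sr: "s \<ge> t" "r \<ge> t" for s r
  proof -
    have "\<bar>v s - v r\<bar> \<le> (1 * K + K * (1 / \<theta>)) * \<bar>s - r\<bar>"
      unfolding v_def
    proof (rule lipschitz_mult_bound[OF _ bl])
      show "\<bar>1 - ramp_up \<theta> t s - (1 - ramp_up \<theta> t r)\<bar> \<le> 1 / \<theta> * \<bar>s - r\<bar>"
        using ramp_up(6)[OF \<theta>(1), of t s r] by (simp add: abs_minus_commute)
      show "\<bar>1 - ramp_up \<theta> t s\<bar> \<le> 1" using ramp_up(1,2)[OF \<theta>(1)] sr by auto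
      show "\<bar>b * \<psi>1 r\<bar> \<le> K" using bb[of r] bounds(4)[of r] sr t by auto
    qed (use sr K_pos in auto)
    then show ?thesis by simp
  qed
  have vc: "continuous_on {t..} v"
    using vl K_pos \<theta> by (intro lipschitz_on_continuous_on[of "K + K / \<theta>"] lipschitz_onI) (auto simp: dist_real_def)
  have vb: "\<bar>v s\<bar> < \<psi>1 s" if s: "s \<ge> t" for s
  proof -
    have "\<bar>v s\<bar> \<le> 1 * \<bar>b * \<psi>1 s\<bar>"
      unfolding v_def abs_mult[of "1 - _"] using ramp_up(1,2)[OF \<theta>(1)] s by (intro mult_right_mono) auto
    then show ?thesis using bb[OF s] by simp
  qed
  have disp: "\<bar>integral {t..s} v\<bar> \<le> m / 4" if s: "s \<ge> t" for s
  proof -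
    have le: "\<bar>integral {t..r} v\<bar> \<le> m / 4" if r: "t \<le> r" "r \<le> t + \<theta>" for r
    proof -
      have "\<bar>v r'\<bar> \<le> K" if "r' \<in> {t..r}" for r'
        using that vb[of r'] bounds(4)[of r'] t by auto
      from displacement_bound[OF vc r(1) this] have "\<bar>integral {t..r} v\<bar> \<le> K * (r - t)" .
      also have "\<dots> \<le> K * \<theta>" using r K_pos by (intro mult_left_mono) auto
      finally show ?thesis using \<theta> by simp
    qed
    show ?thesis
    proof (cases "s \<le> t + \<theta>")
      case False
      have "integral {t..s} v = integral {t..t + \<theta>} v + integral {t + \<theta>..s} v"
        using False \<theta> continuous_on_subset[OF vc, of "{t..s}"]
        by (intro Henstock_Kurzweil_Integration.integral_combine[symmetric] integrable_continuous_real) auto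
      moreover have "integral {t + \<theta>..s} v = integral {t + \<theta>..s} (\<lambda>_. 0)"
        by (rule Henstock_Kurzweil_Integration.integral_cong) (use ramp_up(4)[OF \<theta>(1)] in \<open>auto simp: v_def\<close>)
      ultimately show ?thesis using le[of "t + \<theta>"] \<theta> by simp
    qed (use le s in auto)
  qed
  have "funnel_path (K + K / \<theta>) t e0 v0 e v"
    unfolding funnel_path_def
  proof (intro conjI allI impI vl vb)
    show "e t = e0" by (simp add: e_def)
    show "v t = v0" using ramp_up(3)[OF \<theta>(1)] p1[OF t] by (simp add: v_def b_def)
    fix s assume s: "s \<ge> t"
    show "(e has_vector_derivative v s) (at s within {t..})"
      unfolding e_def[abs_def] by (rule integral_path_deriv[OF vc s])
    show "\<bar>e s\<bar> < \<psi>0 s" using disp[OF s] e0 bounds(1)[of s] s t m by (auto simp: e_def)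
  qed auto
  then show ?thesis by blast
qed

lemma steer_upper:
  assumes t: "t \<ge> 0" and e0: "m / 2 \<le> e0" "e0 < \<psi>0 t" and v0: "\<bar>v0\<bar> < \<psi>1 t" and M: "M \<ge> 0"
    and safe: "safe M t e0 v0"
  defines "\<theta> \<equiv> brake_time M"
  shows "\<exists>e v. funnel_path (K + K / \<theta> + (K + K * (4 / m * K + 1 / \<theta>))) t e0 v0 e v"
proof -
  note \<theta> = brake_time[OF M, folded \<theta>_def]
  define b where "b = v0 / \<psi>1 t"
  have p1: "0 < \<psi>1 s" if "s \<ge> 0" for s using bounds(3)[OF that] m by simp
  have b: "\<bar>b\<bar> < 1" using v0 p1[OF t] by (simp add: b_def abs_divide)
  define w where "w s = \<psi>1 s - \<epsilon> / 2" for s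
  have w: "m / 2 \<le> w s" "w s \<le> K" "0 \<le> w s" "w s < \<psi>1 s" if "s \<ge> 0" for s
    using bounds(3,4)[OF that] \<epsilon> m by (auto simp: w_def)
  have wc: "continuous_on {0..} w" unfolding w_def[abs_def] by (intro continuous_intros \<psi>1_cont)
  have wl: "\<bar>w s - w r\<bar> \<le> K * \<bar>s - r\<bar>" if "s \<ge> t" "r \<ge> t" for s r
    using lip(2)[of s r] that t by (simp add: w_def)
  let ?\<beta> = "ramp_up \<theta> t"
  define v1 where "v1 s = (1 - ?\<beta> s) * (b * \<psi>1 s) - ?\<beta> s * w s" for s
  define E where "E = e0 + integral {t..t + \<theta>} v1"
  define S where "S s = integral {t + \<theta>..s} w" for s
  define \<kappa> where "\<kappa> s = max 0 (min 1 (4 / m * (E - S s)))" for s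
  define v where "v s = (1 - ?\<beta> s) * (b * \<psi>1 s) - (?\<beta> s * \<kappa> s) * w s" for s
  define e where "e s = e0 + integral {t..s} v" for s
  have bl: "\<bar>b * \<psi>1 s - b * \<psi>1 r\<bar> \<le> K * \<bar>s - r\<bar>" if "s \<ge> t" "r \<ge> t" for s r
  proof -
    have "\<bar>b * \<psi>1 s - b * \<psi>1 r\<bar> = \<bar>b\<bar> * \<bar>\<psi>1 s - \<psi>1 r\<bar>" by (simp add: right_diff_distrib[symmetric] abs_mult)
    also have "\<dots> \<le> 1 * (K * \<bar>s - r\<bar>)" using b lip(2)[of s r] that t by (intro mult_mono) auto
    finally show ?thesis by simp
  qed
  have bb: "\<bar>b * \<psi>1 s\<bar> < \<psi>1 s" if "s \<ge> t" for s
    using b p1[of s] that t by (simp add: abs_mult)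
  have \<beta>: "0 \<le> ?\<beta> s" "?\<beta> s \<le> 1" if "s \<ge> t" for s using ramp_up(1,2)[OF \<theta>(1)] that by auto
  have \<kappa>: "0 \<le> \<kappa> s" "\<kappa> s \<le> 1" for s by (auto simp: \<kappa>_def)
  have Sl0: "0 \<le> S s - S r" "S s - S r \<le> K * (s - r)" if "t + \<theta> \<le> r" "r \<le> s" for r s
  proof -
    have i: "w integrable_on {x..y}" if "x \<ge> 0" for x y
      using that by (intro integrable_continuous_real continuous_on_subset[OF wc]) auto
    have "S s = S r + integral {r..s} w"
      unfolding S_def using that t \<theta>
      by (intro Henstock_Kurzweil_Integration.integral_combine[symmetric] i) auto
    moreover have "0 \<le> integral {r..s} w"
      using w(3) that t \<theta> by (intro Henstock_Kurzweil_Integration.integral_nonneg i) auto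
    moreover have "\<bar>integral {r..s} w\<bar> \<le> K * (s - r)"
      by (rule displacement_bound[OF continuous_on_subset[OF wc]]) (use that t \<theta> w in auto)
    ultimately show "0 \<le> S s - S r" "S s - S r \<le> K * (s - r)" by auto
  qed
  have S0: "S s = 0" if "s \<le> t + \<theta>" for s using that by (cases "s = t + \<theta>") (auto simp: S_def)
  have Smono: "S r \<le> S s" "S s - S r \<le> K * (s - r)" if rs: "r \<le> s" for r s
  proof -
    consider "s \<le> t + \<theta>" | "r < t + \<theta>" "t + \<theta> < s" | "t + \<theta> \<le> r" using rs by linarith
    then have "S r \<le> S s \<and> S s - S r \<le> K * (s - r)"
    proof cases
      case 1 then show ?thesis using S0 rs K_pos by simp
    next
      case 2
      have "K * (s - (t + \<theta>)) \<le> K * (s - r)" using 2 K_pos by (intro mult_left_mono) auto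
      then show ?thesis using 2 S0[of r] S0[of "t + \<theta>"] Sl0[of "t + \<theta>" s] by auto
    next
      case 3 then show ?thesis using Sl0[of r s] rs by auto
    qed
    then show "S r \<le> S s" "S s - S r \<le> K * (s - r)" by auto
  qed
  have \<kappa>l: "\<bar>\<kappa> s - \<kappa> r\<bar> \<le> 4 / m * K * \<bar>s - r\<bar>" for s r
  proof -
    have "\<bar>S s - S r\<bar> \<le> K * \<bar>s - r\<bar>"
      using Smono[of s r] Smono[of r s] by (cases "s \<le> r") auto
    then have "4 / m * \<bar>S s - S r\<bar> \<le> 4 / m * (K * \<bar>s - r\<bar>)" using m by (intro mult_left_mono) auto
    moreover have "\<bar>\<kappa> s - \<kappa> r\<bar> \<le> \<bar>4 / m * (E - S s) - 4 / m * (E - S r)\<bar>"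
      unfolding \<kappa>_def by (auto simp: min_def max_def)
    moreover have "\<bar>4 / m * (E - S s) - 4 / m * (E - S r)\<bar> = 4 / m * \<bar>S s - S r\<bar>"
      using m unfolding right_diff_distrib[symmetric] abs_mult by auto
    ultimately show ?thesis by (simp add: mult.assoc)
  qed
  have vl: "\<bar>v s - v r\<bar> \<le> (K + K / \<theta> + (K + K * (4 / m * K + 1 / \<theta>))) * \<bar>s - r\<bar>" if sr: "s \<ge> t" "r \<ge> t" for s r
  proof -
    have "\<bar>(1 - ?\<beta> s) * (b * \<psi>1 s) - (1 - ?\<beta> r) * (b * \<psi>1 r)\<bar> \<le> (1 * K + K * (1 / \<theta>)) * \<bar>s - r\<bar>"
    proof (rule lipschitz_mult_bound[OF _ bl])
      show "\<bar>1 - ?\<beta> s - (1 - ?\<beta> r)\<bar> \<le> 1 / \<theta> * \<bar>s - r\<bar>"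
        using ramp_up(6)[OF \<theta>(1), of t s r] by (simp add: abs_minus_commute)
      show "\<bar>b * \<psi>1 r\<bar> \<le> K" using bb[of r] bounds(4)[of r] sr t by auto
    qed (use sr K_pos \<beta> in auto)
    moreover have "\<bar>?\<beta> s * \<kappa> s * w s - ?\<beta> r * \<kappa> r * w r\<bar> \<le> (1 * K + K * (1 * (4 / m * K) + 1 * (1 / \<theta>))) * \<bar>s - r\<bar>"
    proof (rule lipschitz_mult_bound[OF _ wl])
      show "\<bar>?\<beta> s * \<kappa> s - ?\<beta> r * \<kappa> r\<bar> \<le> (1 * (4 / m * K) + 1 * (1 / \<theta>)) * \<bar>s - r\<bar>"
        by (rule lipschitz_mult_bound[OF ramp_up(6)[OF \<theta>(1)] \<kappa>l]) (use \<beta> \<kappa> sr in auto)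
      show "\<bar>?\<beta> s * \<kappa> s\<bar> \<le> 1" using \<beta>[of s] \<kappa>[of s] sr by (simp add: abs_mult mult_le_one)
      show "\<bar>w r\<bar> \<le> K" using w[of r] sr t by auto
    qed (use sr K_pos in auto)
    ultimately have "\<bar>v s - v r\<bar> \<le> (1 * K + K * (1 / \<theta>)) * \<bar>s - r\<bar> + (1 * K + K * (1 * (4 / m * K) + 1 * (1 / \<theta>))) * \<bar>s - r\<bar>"
      unfolding v_def by linarith
    also have "\<dots> = (K + K / \<theta> + (K + K * (4 / m * K + 1 / \<theta>))) * \<bar>s - r\<bar>"
      by (simp add: algebra_simps)
    finally show ?thesis .
  qed
  have vc: "continuous_on {t..} v"
    using vl K_pos \<theta> m by (intro lipschitz_on_continuous_on[of "K + K / \<theta> + (K + K * (4 / m * K + 1 / \<theta>))"] lipschitz_onI) (auto simp: dist_real_def)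
  have vb: "\<bar>v s\<bar> < \<psi>1 s" if s: "s \<ge> t" for s
  proof -
    have 1: "\<bar>(?\<beta> s * \<kappa> s) * w s\<bar> \<le> ?\<beta> s * w s"
    proof -
      have "\<bar>(?\<beta> s * \<kappa> s) * w s\<bar> = (?\<beta> s * w s) * \<kappa> s" using \<beta>[OF s] \<kappa>[of s] w[of s] s t by (simp add: abs_mult)
      also have "\<dots> \<le> (?\<beta> s * w s) * 1" using \<beta>[OF s] \<kappa>[of s] w[of s] s t by (intro mult_left_mono) auto
      finally show ?thesis by simp
    qed
    have 2: "\<bar>(1 - ?\<beta> s) * (b * \<psi>1 s)\<bar> = (1 - ?\<beta> s) * \<bar>b * \<psi>1 s\<bar>" using \<beta>[OF s] by (simp add: abs_mult)
    have "\<bar>v s\<bar> \<le> (1 - ?\<beta> s) * \<bar>b * \<psi>1 s\<bar> + ?\<beta> s * w s"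
      unfolding v_def using 1 2 by linarith
    also have "\<dots> < \<psi>1 s"
    proof (cases "?\<beta> s = 0")
      case True then show ?thesis using bb[OF s] by simp
    next
      case False
      have "(1 - ?\<beta> s) * \<bar>b * \<psi>1 s\<bar> \<le> (1 - ?\<beta> s) * \<psi>1 s" using bb[OF s] \<beta>[OF s] by (intro mult_left_mono) auto
      moreover have "?\<beta> s * w s < ?\<beta> s * \<psi>1 s" using False \<beta>[OF s] w(4)[of s] s t by (intro mult_strict_left_mono) auto
      ultimately show ?thesis by (simp add: algebra_simps)
    qed
    finally show ?thesis .
  qed
  have v1c: "continuous_on {t..} v1"
    unfolding v1_def[abs_def] ramp_up_def[abs_def] using t \<theta>
    by (intro continuous_intros continuous_on_subset[OF wc] continuous_on_subset[OF \<psi>1_cont]) auto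
  have v1b: "\<bar>v1 s\<bar> \<le> K" if s: "s \<ge> t" for s
  proof -
    have "\<bar>v1 s\<bar> \<le> (1 - ?\<beta> s) * \<bar>b * \<psi>1 s\<bar> + ?\<beta> s * w s"
      unfolding v1_def using \<beta>[OF s] w[of s] s t
      by (intro order_trans[OF abs_triangle_ineq4]) (simp add: abs_mult)
    also have "\<dots> \<le> (1 - ?\<beta> s) * K + ?\<beta> s * K"
      using \<beta>[OF s] w[of s] bb[OF s] bounds(4)[of s] s t by (intro add_mono mult_left_mono) auto
    finally show ?thesis by (simp add: algebra_simps)
  qed
  have E: "m / 4 \<le> E"
  proof -
    have "\<bar>integral {t..t + \<theta>} v1\<bar> \<le> K * (t + \<theta> - t)"
      by (rule displacement_bound[OF v1c]) (use v1b \<theta> in auto)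
    then show ?thesis using \<theta> e0 by (simp add: E_def)
  qed
  have v_eq: "v s = v1 s" if "s \<le> t + \<theta>" for s
  proof -
    have "4 / m * (E - S s) \<ge> 1" using E S0[OF that] m by (simp add: field_simps)
    then show ?thesis by (simp add: v_def v1_def \<kappa>_def)
  qed
  have e_deriv: "(e has_vector_derivative v s) (at s within {t..})" if "s \<ge> t" for s
    unfolding e_def[abs_def] by (rule integral_path_deriv[OF vc that])
  have eE: "e (t + \<theta>) = E"
    unfolding e_def E_def using v_eq by (auto intro!: Henstock_Kurzweil_Integration.integral_cong)
  define D where "D s = \<psi>0 s - e s" for s
  define D' where "D' s = d\<psi>0 s - v s" for s
  have D_deriv: "(D has_vector_derivative D' s) (at s within {x..y})" if "s \<in> {x..y}" "x \<ge> t" for s x y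
  proof -
    have "(\<psi>0 has_vector_derivative d\<psi>0 s) (at s within {x..y})"
      by (rule has_vector_derivative_within_subset[OF \<psi>0_deriv]) (use that t in auto)
    moreover have "(e has_vector_derivative v s) (at s within {x..y})"
      by (rule has_vector_derivative_within_subset[OF e_deriv]) (use that t in auto)
    ultimately show ?thesis unfolding D_def[abs_def] D'_def by (rule has_vector_derivative_diff)
  qed
  define Wc where "Wc = \<epsilon> / (2 * \<theta>) - 4 * K"
  have Wc: "M < Wc" "0 < Wc" using \<theta>(3) M by (auto simp: Wc_def)
  have brake: "D' r + Wc * (s - r) \<le> D' s" if rs: "t \<le> r" "r \<le> s" "s \<le> t + \<theta>" and neg: "D' r < 0" for r s
  proof (cases "r = s")
    case False
    then have r: "r < s" using rs by simp
    define A where "A x = b * \<psi>1 x + w x" for x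
    have va: "v x = b * \<psi>1 x - ?\<beta> x * A x" if "x \<le> t + \<theta>" for x
      using v_eq[OF that] by (simp add: v1_def A_def algebra_simps)
    have Apos: "\<epsilon> / 2 \<le> A r"
    proof -
      have \<beta>r: "?\<beta> r < 1" using ramp_up(5)[OF \<theta>(1), of r t] r rs \<theta>(1) by (simp add: pos_divide_less_eq)
      have "- w r + \<epsilon> / 2 < v r" using neg compat[of r] rs t by (simp add: D'_def w_def)
      moreover have "v r + w r = (1 - ?\<beta> r) * A r" using va[of r] rs by (simp add: A_def algebra_simps)
      ultimately have *: "\<epsilon> / 2 < (1 - ?\<beta> r) * A r" by simp
      then have "0 < (1 - ?\<beta> r) * A r" using \<epsilon> by simp
      then have "0 < A r" using \<beta>r by (simp add: zero_less_mult_iff)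
      then have "(1 - ?\<beta> r) * A r \<le> 1 * A r" using \<beta>[of r] rs by (intro mult_right_mono) auto
      then show ?thesis using * by simp
    qed
    have \<beta>d: "?\<beta> s - ?\<beta> r = (s - r) / \<theta>"
      using ramp_up(5)[OF \<theta>(1), of s t] ramp_up(5)[OF \<theta>(1), of r t] rs by (simp add: diff_divide_distrib[symmetric])
    have "v s - v r = (b * \<psi>1 s - b * \<psi>1 r) - ?\<beta> s * (A s - A r) - (?\<beta> s - ?\<beta> r) * A r"
      using va[of s] va[of r] rs by (simp add: algebra_simps)
    also have "\<dots> \<le> K * (s - r) + 2 * K * (s - r) - (s - r) / \<theta> * (\<epsilon> / 2)"
    proof -
      have "b * \<psi>1 s - b * \<psi>1 r \<le> K * (s - r)" using bl[of s r] rs by auto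
      moreover have "\<bar>?\<beta> s * (A s - A r)\<bar> \<le> 1 * (2 * K * (s - r))"
        unfolding abs_mult using \<beta>[of s] rs bl[of s r] wl[of s r] K_pos
        by (intro mult_mono) (auto simp: A_def)
      moreover have "(s - r) / \<theta> * (\<epsilon> / 2) \<le> (?\<beta> s - ?\<beta> r) * A r"
        unfolding \<beta>d using Apos r \<theta>(1) by (intro mult_left_mono) auto
      ultimately show ?thesis by linarith
    qed
    finally have "v s - v r \<le> 3 * K * (s - r) - \<epsilon> / (2 * \<theta>) * (s - r)" by (simp add: algebra_simps)
    moreover have "d\<psi>0 r - K * (s - r) \<le> d\<psi>0 s" using lip(1)[of s r] rs t by auto
    ultimately show ?thesis by (simp add: D'_def Wc_def algebra_simps)
  qed simp
  have D'c: "continuous_on {t..t + \<theta>} D'"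
    unfolding D'_def[abs_def] using t
    by (intro continuous_intros continuous_on_subset[OF vc] continuous_on_subset[OF d\<psi>0_cont]) auto
  have D0: "D t > 0" using e0 by (simp add: D_def e_def)
  have phase1: "D s > 0" if s: "t \<le> s" "s \<le> t + \<theta>" for s
  proof (cases "D' t < 0")
    case False
    have "0 \<le> D' r" if r: "r \<in> {t..s}" for r
    proof (rule ccontr)
      assume *: "\<not> 0 \<le> D' r"
      have "\<exists>x\<ge>t. x \<le> r \<and> D' x = D' r / 2"
        by (rule IVT2') (use * False r s continuous_on_subset[OF D'c, of "{t..r}"] in auto)
      then obtain x where x: "t \<le> x" "x \<le> r" "D' x = D' r / 2" by blast
      have "D' x + Wc * (r - x) \<le> D' r" using x * r s by (intro brake) auto
      moreover have "0 \<le> Wc * (r - x)" using Wc x by simp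
      ultimately show False using x * by linarith
    qed
    then have "D t \<le> D s" using s D_deriv by (intro vector_derivative_nonneg_imp_le[of t s D D']) auto
    then show ?thesis using D0 by simp
  next
    case True
    define p where "p = - D' t"
    have p: "p > 0" "p = v0 - d\<psi>0 t"
      using True v_eq[of t] ramp_up(3)[OF \<theta>(1)] p1[OF t] \<theta>(1) by (auto simp: p_def D'_def v1_def b_def)
    have "p\<^sup>2 \<le> 2 * M * D t"
      using safe e0 p by (auto simp: safe_def D_def e_def)
    have lower: "D' r \<ge> - p + Wc * (r - t)" if "r \<in> {t..s}" for r
      using brake[of t r] that s True by (simp add: p_def)
    define F where "F r = D r - (- p * (r - t) + Wc * (r - t)\<^sup>2 / 2)" for r
    have "F t \<le> F s"
    proof (rule vector_derivative_nonneg_imp_le[OF s(1)])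
      fix r assume r: "r \<in> {t..s}"
      have "((\<lambda>r. - p * (r - t) + Wc * (r - t)\<^sup>2 / 2) has_real_derivative - p + Wc * (r - t)) (at r within {t..s})"
        by (auto intro!: derivative_eq_intros)
      then show "(F has_vector_derivative D' r - (- p + Wc * (r - t))) (at r within {t..s})"
        unfolding F_def[abs_def] has_real_derivative_iff_has_vector_derivative
        by (intro has_vector_derivative_diff D_deriv) (use r in auto)
      show "0 \<le> D' r - (- p + Wc * (r - t))" using lower[OF r] by simp
    qed
    then have *: "D t - p * (s - t) + Wc * (s - t)\<^sup>2 / 2 \<le> D s" by (simp add: F_def)
    have "0 \<le> (Wc * (s - t) - p)\<^sup>2" by simp
    then have "2 * Wc * (p * (s - t)) - Wc * (Wc * (s - t)\<^sup>2) \<le> p\<^sup>2"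
      by (simp add: power2_eq_square algebra_simps)
    moreover have "2 * M * D t < 2 * Wc * D t" using Wc D0 by simp
    ultimately have "0 < 2 * Wc * D t - 2 * Wc * (p * (s - t)) + Wc * (Wc * (s - t)\<^sup>2)"
      using \<open>p\<^sup>2 \<le> 2 * M * D t\<close> by linarith
    also have "\<dots> = 2 * Wc * (D t - p * (s - t) + Wc * (s - t)\<^sup>2 / 2)" by (simp add: algebra_simps)
    finally have "0 < D t - p * (s - t) + Wc * (s - t)\<^sup>2 / 2" using Wc by (simp add: zero_less_mult_iff)
    then show ?thesis using * by simp
  qed
  define hh where "hh \<sigma> = 2 / m * (tpow 2 \<sigma> - tpow 2 (\<sigma> - m / 4))" for \<sigma>
  have phase2: "e s = hh (E - S s) + m / 8" if s: "t + \<theta> \<le> s" for s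
  proof -
    have hd: "(hh has_real_derivative max 0 (min 1 (4 / m * \<sigma>))) (at \<sigma>)" for \<sigma>
    proof -
      have "(hh has_real_derivative 2 / m * (2 * tpow 1 \<sigma> - 2 * tpow 1 (\<sigma> - m / 4))) (at \<sigma>)"
        unfolding hh_def[abs_def] numeral_2_eq_2
        by (rule derivative_eq_intros DERIV_chain'[OF _ tpow_has_derivative] refl)+ simp
      moreover have "2 / m * (2 * tpow 1 \<sigma> - 2 * tpow 1 (\<sigma> - m / 4)) = max 0 (min 1 (4 / m * \<sigma>))"
        using m by (auto simp: tpow_def max_def min_def field_simps)
      ultimately show ?thesis by simp
    qed
    define G where "G s = hh (E - S s) + m / 8" for s
    have Gd: "(G has_vector_derivative - (\<kappa> r * w r)) (at r within {t + \<theta>..s})" if r: "r \<in> {t + \<theta>..s}" for r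
    proof -
      have "(S has_vector_derivative w r) (at r within {t + \<theta>..s})"
        unfolding S_def[abs_def]
        by (rule integral_has_vector_derivative[OF continuous_on_subset[OF wc]]) (use r t \<theta> in auto)
      then have "((\<lambda>s. E - S s) has_real_derivative - w r) (at r within {t + \<theta>..s})"
        unfolding has_real_derivative_iff_has_vector_derivative[symmetric]
        by (auto intro!: derivative_eq_intros)
      from DERIV_chain'[OF this hd] have "(G has_real_derivative - (\<kappa> r * w r)) (at r within {t + \<theta>..s})"
        unfolding G_def[abs_def] \<kappa>_def by (auto intro!: derivative_eq_intros)
      then show ?thesis by (simp add: has_real_derivative_iff_has_vector_derivative)
    qed
    have ed: "(e has_vector_derivative - (\<kappa> r * w r)) (at r within {t + \<theta>..s})" if r: "r \<in> {t + \<theta>..s}" for r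
    proof -
      have "v r = - (\<kappa> r * w r)" using ramp_up(4)[OF \<theta>(1), of t r] r by (simp add: v_def)
      moreover have "(e has_vector_derivative v r) (at r within {t + \<theta>..s})"
        by (rule has_vector_derivative_within_subset[OF e_deriv]) (use r \<theta> in auto)
      ultimately show ?thesis by simp
    qed
    have "G s - G (t + \<theta>) = e s - e (t + \<theta>)"
      using fundamental_theorem_of_calculus[OF s Gd] fundamental_theorem_of_calculus[OF s ed]
      by (rule has_integral_unique)
    moreover have "G (t + \<theta>) = E"
      using S0[of "t + \<theta>"] E m by (simp add: G_def hh_def tpow_def power2_eq_square field_simps)
    ultimately show ?thesis using eE by (simp add: G_def)
  qed
  have hh: "0 \<le> hh \<sigma>" "\<sigma> \<le> m / 4 \<Longrightarrow> hh \<sigma> \<le> m / 8" "m / 4 \<le> \<sigma> \<Longrightarrow> hh \<sigma> = \<sigma> - m / 8" for \<sigma>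
  proof -
    have "tpow 2 (\<sigma> - m / 4) \<le> tpow 2 \<sigma>" unfolding tpow_def using m by (intro power_mono) auto
    then show "0 \<le> hh \<sigma>" unfolding hh_def using m by simp
    show "hh \<sigma> = \<sigma> - m / 8" if "m / 4 \<le> \<sigma>"
      using that m by (simp add: hh_def tpow_def power2_eq_square field_simps)
    show "hh \<sigma> \<le> m / 8" if "\<sigma> \<le> m / 4"
    proof -
      have "(max 0 \<sigma>)\<^sup>2 \<le> (m / 4)\<^sup>2" using that m by (intro power_mono) auto
      then have "2 / m * (max 0 \<sigma>)\<^sup>2 \<le> 2 / m * (m / 4)\<^sup>2" using m by (intro mult_left_mono) auto
      then show ?thesis using that m by (simp add: hh_def tpow_def power2_eq_square)
    qed
  qed
  have e_low: "- \<psi>0 s < e s" if s: "s \<ge> t" for s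
  proof (cases "s \<le> t + \<theta>")
    case True
    have "\<bar>integral {t..s} v\<bar> \<le> K * (s - t)"
    proof (rule displacement_bound[OF vc s])
      show "\<bar>v r\<bar> \<le> K" if "r \<in> {t..s}" for r using vb[of r] bounds(4)[of r] that t by auto
    qed
    also have "\<dots> \<le> K * \<theta>" using True K_pos by (intro mult_left_mono) auto
    finally show ?thesis using e0 \<theta>(2) bounds(1)[of s] s t m by (simp add: e_def)
  next
    case False
    then show ?thesis using phase2[of s] hh(1)[of "E - S s"] bounds(1)[of s] s t m by simp
  qed
  have e_up: "e s < \<psi>0 s" if s: "s \<ge> t" for s
  proof (cases "s \<le> t + \<theta>")
    case True
    then show ?thesis using phase1[of s] s by (simp add: D_def)
  next
    case False
    then have sT: "t + \<theta> \<le> s" by simp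
    show ?thesis
    proof (cases "E - S s \<le> m / 4")
      case True
      then show ?thesis using phase2[OF sT] hh(2)[of "E - S s"] bounds(1)[of s] s t m by simp
    next
      case F: False
      have "D (t + \<theta>) \<le> D s"
      proof (rule vector_derivative_nonneg_imp_le[OF sT D_deriv])
        fix r assume r: "r \<in> {t + \<theta>..s}"
        have "S r \<le> S s" using Smono r by auto
        then have "E - S r \<ge> m / 4" using F by simp
        then have "4 / m * (E - S r) \<ge> 1" using m by (simp add: field_simps)
        then have "v r = - w r" using ramp_up(4)[OF \<theta>(1), of t r] r by (simp add: v_def \<kappa>_def)
        then show "0 \<le> D' r" using compat[of r] r t \<theta>(1) \<epsilon> by (simp add: D'_def w_def)
      qed (use \<theta> in auto)
      then show ?thesis using phase1[of "t + \<theta>"] \<theta>(1) by (simp add: D_def)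
    qed
  qed
  have "funnel_path (K + K / \<theta> + (K + K * (4 / m * K + 1 / \<theta>))) t e0 v0 e v"
    unfolding funnel_path_def
  proof (intro conjI allI impI vl vb e_deriv)
    show "e t = e0" by (simp add: e_def)
    show "v t = v0" using v_eq[of t] \<theta>(1) ramp_up(3)[OF \<theta>(1)] p1[OF t] by (simp add: v1_def b_def)
    show "\<bar>e s\<bar> < \<psi>0 s" if "s \<ge> t" for s using e_low[OF that] e_up[OF that] by auto
  qed auto
  then show ?thesis by blast
qed

lemma steer:
  assumes M: "M \<ge> 0"
  obtains W where "W \<ge> 0" "\<And>t e0 v0. \<lbrakk>t \<ge> 0; \<bar>e0\<bar> < \<psi>0 t; \<bar>v0\<bar> < \<psi>1 t; safe M t e0 v0\<rbrakk>
    \<Longrightarrow> \<exists>e v. funnel_path W t e0 v0 e v"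
proof -
  let ?\<theta> = "brake_time M"
  define W where "W = K + K / ?\<theta> + (K + K * (4 / m * K + 1 / ?\<theta>))"
  note \<theta> = brake_time[OF M]
  have W: "K + K / ?\<theta> \<le> W" using K_pos m \<theta> by (simp add: W_def)
  have W0: "W \<ge> 0" using W K_pos \<theta>(1) by (smt (verit) divide_nonneg_pos)
  show ?thesis
  proof (rule that[OF W0])
    fix t e0 v0 assume *: "t \<ge> 0" "\<bar>e0\<bar> < \<psi>0 t" "\<bar>v0\<bar> < \<psi>1 t" "safe M t e0 v0"
    consider "m / 2 \<le> e0" | "m / 2 \<le> - e0" | "\<bar>e0\<bar> < m / 2" by linarith
    then show "\<exists>e v. funnel_path W t e0 v0 e v"
    proof cases
      case 1
      then show ?thesis using steer_upper[of t e0 v0 M] * M by (auto simp: W_def)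
    next
      case 2
      then have "\<exists>e v. funnel_path W t (- e0) (- v0) e v"
        using steer_upper[of t "- e0" "- v0" M] * M by (auto simp: W_def safe_uminus)
      then obtain e v where "funnel_path W t (- e0) (- v0) e v" by blast
      from funnel_path_uminus[OF this] show ?thesis by auto
    next
      case 3
      obtain e v where ev: "funnel_path (K + K / ?\<theta>) t e0 v0 e v"
        using steer_center[OF *(1) 3 *(3) \<theta>(1,2)] by blast
      have "(K + K / ?\<theta>) * \<bar>s - r\<bar> \<le> W * \<bar>s - r\<bar>" for s r using W by (intro mult_right_mono) auto
      then have "funnel_path W t e0 v0 e v"
        using ev unfolding funnel_path_def by (meson order_trans)
      then show ?thesis by blast
    qed
  qed
qed

lemma unsafe_upper_False:
  assumes t: "0 \<le> t" and M: "2 * K \<le> M"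
    and e: "\<And>s. s \<in> {t..t + 1} \<Longrightarrow> (e has_vector_derivative v s) (at s within {t..t + 1})"
    and b: "\<And>s. s \<in> {t..t + 1} \<Longrightarrow> e s < \<psi>0 s"
    and u: "\<And>s. s \<in> {t..t + 1} \<Longrightarrow> 0 \<le> e s \<and> d\<psi>0 s < v s \<and> 2 * M * (\<psi>0 s - e s) < (v s - d\<psi>0 s)\<^sup>2"
  shows False
proof -
  let ?I = "{t..t + 1}"
  define D where "D s = \<psi>0 s - e s" for s
  have D: "(D has_vector_derivative d\<psi>0 s - v s) (at s within ?I)" if s: "s \<in> ?I" for s
    unfolding D_def[abs_def]
    by (intro has_vector_derivative_diff e s has_vector_derivative_within_subset[OF \<psi>0_deriv]) (use s t in auto)
  have Dp: "D s > 0" if "s \<in> ?I" for s using b[OF that] by (simp add: D_def)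
  have M0: "M > 0" using M K_pos by simp
  define c where "c = sqrt (M / 2)"
  define F where "F s = - sqrt (D s) - c * (s - t)" for s
  have "F t \<le> F (t + 1)"
  proof (rule vector_derivative_nonneg_imp_le[where a=t and b="t + 1" and f=F and f'="\<lambda>s. (v s - d\<psi>0 s) / (2 * sqrt (D s)) - c"])
    fix s assume s: "s \<in> ?I"
    have sq: "((\<lambda>s. sqrt (D s)) has_real_derivative inverse (sqrt (D s)) / 2 * (d\<psi>0 s - v s)) (at s within ?I)"
      using DERIV_chain'[OF D[OF s, folded has_real_derivative_iff_has_vector_derivative] DERIV_real_sqrt[OF Dp[OF s]]]
      by (simp add: mult.commute)
    have "((\<lambda>s. c * (s - t)) has_real_derivative c) (at s within ?I)"
      by (auto intro!: derivative_eq_intros)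
    with sq have "(F has_real_derivative - (inverse (sqrt (D s)) / 2 * (d\<psi>0 s - v s)) - c) (at s within ?I)"
      unfolding F_def[abs_def] by (intro DERIV_diff DERIV_minus)
    then show "(F has_vector_derivative (v s - d\<psi>0 s) / (2 * sqrt (D s)) - c) (at s within ?I)"
      unfolding has_real_derivative_iff_has_vector_derivative[symmetric]
      by (rule back_subst[of "\<lambda>x. (F has_real_derivative x) (at s within ?I)"]) (use Dp[OF s] in \<open>simp add: field_simps\<close>)
    have "sqrt (2 * M * D s) < sqrt ((v s - d\<psi>0 s)\<^sup>2)"
      using u[OF s] by (intro real_sqrt_less_mono) (simp add: D_def)
    then have 1: "sqrt (2 * M) * sqrt (D s) < v s - d\<psi>0 s" using u[OF s] by (simp add: real_sqrt_mult)
    have "c = sqrt (2 * M) / 2"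
    proof -
      have "sqrt (M / 2) = sqrt ((2 * M) / 4)" by simp
      then show ?thesis unfolding c_def real_sqrt_divide by simp
    qed
    then have "c * (2 * sqrt (D s)) = sqrt (2 * M) * sqrt (D s)" by simp
    then have "c * (2 * sqrt (D s)) \<le> v s - d\<psi>0 s" using 1 by linarith
    then show "0 \<le> (v s - d\<psi>0 s) / (2 * sqrt (D s)) - c" using Dp[OF s] by (simp add: pos_le_divide_eq)
  qed simp
  then have "sqrt (D (t + 1)) + c \<le> sqrt (D t)" by (simp add: F_def)
  moreover have "0 < sqrt (D (t + 1))" using Dp by simp
  moreover have "D t \<le> M / 2" using bounds(2)[OF t] u[of t] M by (simp add: D_def)
  then have "sqrt (D t) \<le> c" unfolding c_def by simp
  ultimately show False by simp
qed

lemma safe_time_exists: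
  assumes t: "0 \<le> t" and M: "2 * K \<le> M"
    and e: "\<And>s. s \<in> {t..t + 1} \<Longrightarrow> (e has_vector_derivative v s) (at s within {t..t + 1})"
    and b: "\<And>s. s \<in> {t..t + 1} \<Longrightarrow> \<bar>e s\<bar> < \<psi>0 s"
  shows "\<exists>s\<in>{t..t + 1}. safe M s (e s) (v s)"
proof (rule ccontr)
  let ?I = "{t..t + 1}"
  assume "\<not> ?thesis"
  then have n: "\<not> safe M s (e s) (v s)" if "s \<in> ?I" for s using that by blast
  have ec: "continuous_on ?I e"
    unfolding continuous_on_eq_continuous_within using e has_vector_derivative_continuous by blast
  have nz: "e s \<noteq> 0" if "s \<in> ?I" for s using n[OF that] m by (auto simp: safe_def)
  have "(\<forall>s\<in>?I. 0 < e s) \<or> (\<forall>s\<in>?I. e s < 0)"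
  proof (rule ccontr)
    assume "\<not> ?thesis"
    then obtain r s where rs': "r \<in> ?I" "\<not> 0 < e r" "s \<in> ?I" "\<not> e s < 0" by blast
    then have rs: "r \<in> ?I" "e r < 0" "s \<in> ?I" "0 < e s"
      using nz[OF rs'(1)] nz[OF rs'(3)] by linarith+
    have "connected (e ` ?I)" using ec by (intro connected_continuous_image) auto
    then have "0 \<in> e ` ?I"
      using connectedD_interval[of "e ` ?I" "e r" "e s" 0] rs by auto
    then show False using nz by auto
  qed
  then show False
  proof
    assume p: "\<forall>s\<in>?I. 0 < e s"
    show False
    proof (rule unsafe_upper_False[OF t M e])
      show "0 \<le> e s \<and> d\<psi>0 s < v s \<and> 2 * M * (\<psi>0 s - e s) < (v s - d\<psi>0 s)\<^sup>2" if "s \<in> ?I" for s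
        using n[OF that] p that m by (force simp: safe_def)
    qed (use b in force)+
  next
    assume p: "\<forall>s\<in>?I. e s < 0"
    show False
    proof (rule unsafe_upper_False[OF t M, of "\<lambda>s. - e s" "\<lambda>s. - v s"])
      show "((\<lambda>s. - e s) has_vector_derivative - v s) (at s within ?I)" if "s \<in> ?I" for s
        using e[OF that] by (auto intro!: derivative_eq_intros)
      show "0 \<le> - e s \<and> d\<psi>0 s < - v s \<and> 2 * M * (\<psi>0 s - - e s) < (- v s - d\<psi>0 s)\<^sup>2" if "s \<in> ?I" for s
        using n[OF that] p that m by (force simp: safe_def)
    qed (use b in force)+
  qed
qed

end

subsection \<open>The system in Byrnes-Isidori coordinates\<close>

definition inner_part :: "'n \<Rightarrow> 'n \<Rightarrow> real^'n \<Rightarrow> real^'n::finite" where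
  "inner_part i0 i1 z = z - (z $ i0) *\<^sub>R axis i0 1 - (z $ i1) *\<^sub>R axis i1 1"

lemma inner_part_nth:
  "i0 \<noteq> i1 \<Longrightarrow> inner_part i0 i1 z $ i = (if i = i0 \<or> i = i1 then 0 else z $ i)"
  by (auto simp: inner_part_def axis_def)

lemma bi_vec_eq:
  assumes "i0 \<noteq> i1" "\<eta> \<in> internal_space i0 i1"
  shows "bi_vec i0 i1 \<zeta> \<eta> = fst \<zeta> *\<^sub>R axis i0 1 + snd \<zeta> *\<^sub>R axis i1 1 + \<eta>"
  using assms by (auto simp: bi_vec_def vec_eq_iff axis_def internal_space_def)

lemma inner_part_internal: "i0 \<noteq> i1 \<Longrightarrow> inner_part i0 i1 z \<in> internal_space i0 i1"
  by (simp add: internal_space_def inner_part_nth)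

lemma bi_vec_inner_part: "i0 \<noteq> i1 \<Longrightarrow> bi_vec i0 i1 (z $ i0, z $ i1) (inner_part i0 i1 z) = z"
  by (auto simp: bi_vec_def vec_eq_iff inner_part_nth)

lemma bounded_linear_inner_part: "bounded_linear (inner_part i0 i1)"
  unfolding inner_part_def[abs_def]
  by (intro bounded_linear_sub bounded_linear_ident
      bounded_linear_compose[OF bounded_linear_scaleR_left bounded_linear_vec_nth])

lemma has_integral_imp_has_vector_derivative:
  fixes x :: "real \<Rightarrow> 'a::euclidean_space"
  assumes c: "continuous_on {a..b} g" and i: "\<And>d. d \<in> {a..b} \<Longrightarrow> (g has_integral (x d - x a)) {a..d}"
    and t: "t \<in> {a..b}"
  shows "(x has_vector_derivative g t) (at t within {a..b})"
proof -
  have "((\<lambda>s. x a + integral {a..s} g) has_vector_derivative g t) (at t within {a..b})"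
    using integral_has_vector_derivative[OF c t] by (auto intro!: derivative_eq_intros)
  then show ?thesis
    by (rule has_vector_derivative_transform[rotated 2]) (use t integral_unique[OF i] in auto)
qed

lemma has_vector_derivative_imp_lipschitz_solution:
  assumes d: "\<And>t. t \<in> {a..b} \<Longrightarrow> (x has_vector_derivative F t (x t)) (at t within {a..b})"
    and c: "\<And>t. t \<in> {a..b} \<Longrightarrow> norm (F t (x t)) \<le> c"
  shows "lipschitz_solution F a b x"
proof (rule lipschitz_solutionI[of _ _ _ c "{}"])
  have *: "norm (x t - x s) \<le> c * (t - s)" if "s \<in> {a..b}" "t \<in> {a..b}" "s \<le> t" for s t
  proof (rule has_integral_norm_bound_AE[OF fundamental_theorem_of_calculus[OF that(3)]])
    show "(x has_vector_derivative F r (x r)) (at r within {s..t})" if "r \<in> {s..t}" for r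
      by (rule has_vector_derivative_within_subset[OF d]) (use that \<open>s \<in> _\<close> \<open>t \<in> _\<close> in auto)
    show "0 \<le> c" using order_trans[OF norm_ge_zero c[OF that(1)]] .
    show "negligible {}" by simp
    show "norm (F r (x r)) \<le> c" if "r \<in> {s..t}" for r
      using c[of r] that \<open>s \<in> _\<close> \<open>t \<in> _\<close> by auto
  qed (use that in auto)
  show "norm (x s - x t) \<le> c * \<bar>s - t\<bar>" if "s \<in> {a..b}" "t \<in> {a..b}" for s t
    using *[of s t] *[of t s] that by (cases "s \<le> t") (auto simp: norm_minus_commute)
  show "(x has_vector_derivative F t (x t)) (at t)" if "t \<in> {a<..<b}" for t
  proof -
    have "at t within {a..b} = at t" using that by (intro at_within_interior) auto
    then show ?thesis using d[of t] that by auto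
  qed
qed simp

lemma D1_Ici:
  assumes "(u has_vector_derivative d) (at t within {a..})" "a \<le> t"
  shows "D1 {a..} u t = d"
  using vector_derivative_within_closed_interval[of a "t + 1" t u d] assms
  by (simp add: D1_def at_within_Icc_Ici[symmetric])

lemma D1_Icc:
  assumes "(u has_vector_derivative d) (at t within {a..b})" "a < b" "t \<in> {a..b}"
  shows "D1 {a..b} u t = d"
  using vector_derivative_within_closed_interval[of a b t u d] assms by (simp add: D1_def)

lemma continuous_on_IciI:
  fixes x :: "real \<Rightarrow> 'a::topological_space"
  assumes "\<And>b. a \<le> b \<Longrightarrow> continuous_on {a..b} x"
  shows "continuous_on {a..} x"
  unfolding continuous_on_eq_continuous_within
proof
  fix t assume t: "t \<in> {a..}"
  then have "continuous (at t within {a..t + 1}) x"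
    using assms[of "t + 1"] by (simp add: continuous_on_eq_continuous_within)
  then show "continuous (at t within {a..}) x" by (simp add: at_within_Icc_Ici)
qed

lemma continuous_on_Icc_norm_bound:
  fixes x :: "real \<Rightarrow> 'a::real_normed_vector"
  assumes "continuous_on {a..b} x"
  obtains c where "c \<ge> 0" "\<And>t. t \<in> {a..b} \<Longrightarrow> norm (x t) \<le> c"
proof -
  have "bounded (x ` {a..b})" using assms by (intro compact_imp_bounded compact_continuous_image) auto
  then obtain c where c: "c > 0" "\<forall>y\<in>x ` {a..b}. norm y \<le> c" unfolding bounded_pos by blast
  show ?thesis by (rule that[of c]) (use c in auto)
qed

lemma control_lipschitz_solution_Icc:
  fixes A Bv :: "'a::euclidean_space \<Rightarrow> 'a"
  assumes sol: "control_solution A Bv u {s..<b} x" and sb: "s < b" and xc: "continuous_on {s..b} x"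
    and AB: "continuous_on UNIV A" "continuous_on UNIV Bv" and u: "\<And>t. t \<in> {s..b} \<Longrightarrow> \<bar>u t\<bar> \<le> M"
  shows "lipschitz_solution (\<lambda>t z. A z + u t *\<^sub>R Bv z) s b x"
proof -
  have "continuous_on {s..b} (\<lambda>t. A (x t))" "continuous_on {s..b} (\<lambda>t. Bv (x t))"
    using continuous_on_compose2[OF AB(1) xc] continuous_on_compose2[OF AB(2) xc] by auto
  then obtain ca cb where c: "ca \<ge> 0" "\<And>t. t \<in> {s..b} \<Longrightarrow> norm (A (x t)) \<le> ca"
    "cb \<ge> 0" "\<And>t. t \<in> {s..b} \<Longrightarrow> norm (Bv (x t)) \<le> cb"
    using continuous_on_Icc_norm_bound[of s b "\<lambda>t. A (x t)"] continuous_on_Icc_norm_bound[of s b "\<lambda>t. Bv (x t)"] by metis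
  have M0: "M \<ge> 0" using u[of s] sb by auto
  have bd: "norm (A (x t) + u t *\<^sub>R Bv (x t)) \<le> ca + M * cb" if t: "t \<in> {s..b}" for t
  proof -
    have "\<bar>u t\<bar> * norm (Bv (x t)) \<le> M * cb" using u[OF t] c t M0 by (intro mult_mono) auto
    then show ?thesis
      using norm_triangle_ineq[of "A (x t)" "u t *\<^sub>R Bv (x t)"] c(2)[OF t] by simp
  qed
  show ?thesis
  proof (rule lipschitz_solution_closure[OF _ xc sb])
    show "norm (A (x t) + u t *\<^sub>R Bv (x t)) \<le> ca + M * cb" if "t \<in> {s..<b}" for t
      using bd[of t] that by auto
    show "lipschitz_solution (\<lambda>t z. A z + u t *\<^sub>R Bv z) s b' x" if "s \<le> b'" "b' < b" for b'
      by (rule caratheodory_imp_lipschitz_solution[OF sol[unfolded control_solution_def], where c="ca + M * cb"])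
        (use that bd in auto)
  qed
qed

lemma lipschitz_solution_control_Ico:
  assumes "lipschitz_solution (\<lambda>t z. A z + u t *\<^sub>R Bv z) s b x"
  shows "control_solution A Bv u {s..<b} x"
  unfolding control_solution_def
  by (rule caratheodory_solution_subset[OF lipschitz_solution_caratheodory_Icc[OF assms]]) auto

lemma Linf_loc_extend_zero:
  fixes u :: "real \<Rightarrow> real"
  assumes "u \<in> borel_measurable (lebesgue_on {s..b})" "0 \<le> s" "\<And>t. t \<in> {s..b} \<Longrightarrow> \<bar>u t\<bar> \<le> M"
  shows "(\<lambda>t. if t \<in> {s..b} then u t else 0) \<in> Linf_loc {0..}"
proof -
  let ?u = "\<lambda>t. if t \<in> {s..b} then u t else (0::real)"
  have m: "?u \<in> borel_measurable lebesgue"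
    using assms(1) by (subst (asm) borel_measurable_if[symmetric]) auto
  have b: "norm (?u t) \<le> max M 0" for t using assms(3)[of t] by auto
  have "?u \<in> Linf S" if "S \<in> sets lebesgue" for S
    using m b by (intro bounded_in_Linf[of _ _ "max M 0"]) (auto intro: measurable_restrict_space1)
  moreover have "?u \<in> borel_measurable (lebesgue_on {0..})" using m by (rule measurable_restrict_space1)
  ultimately show ?thesis by (auto simp: Linf_loc_def intro: fmeasurableD[OF lmeasurable_compact])
qed

locale fmpc = funnel_pair \<psi>0 d\<psi>0 \<psi>1 K m \<epsilon>
  for \<psi>0 d\<psi>0 \<psi>1 :: "real \<Rightarrow> real" and K m \<epsilon> :: real +
  fixes f g :: "real^'n::finite \<Rightarrow> real^'n"
    and h :: "real^'n \<Rightarrow> real"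
    and \<Phi> :: "real^'n \<Rightarrow> real^'n"
    and p \<gamma> :: "real^'n \<Rightarrow> real"
    and q :: "real^'n \<Rightarrow> real^'n"
    and i0 i1 :: 'n
    and yref dyref :: "real \<Rightarrow> real"
    and lu t0 \<delta> :: real
    and B :: "(real^'n) set"
  assumes f: "C_k 1 f" and g: "C_k 1 g"
    and \<gamma>: "\<gamma> = lie g (lie f h) \<circ> inv \<Phi>" "continuous_on UNIV \<gamma>" "\<And>z. \<gamma> z \<noteq> 0"
    and i01: "i0 \<noteq> i1"
    and \<Phi>: "bij \<Phi>" "continuous_on UNIV \<Phi>" "continuous_on UNIV (inv \<Phi>)"
    and bi: "byrnes_isidori_form i0 i1 f g h \<Phi> p q"
    and bibs: "bibs i0 i1 q"
    and d\<psi>0_bound: "\<And>t. t \<ge> 0 \<Longrightarrow> \<bar>d\<psi>0 t\<bar> \<le> K"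
    and yref_deriv: "\<And>t. t \<ge> 0 \<Longrightarrow> (yref has_vector_derivative dyref t) (at t within {0..})"
    and yref_bounds: "\<And>t. t \<ge> 0 \<Longrightarrow> \<bar>yref t\<bar> \<le> K" "\<And>t. t \<ge> 0 \<Longrightarrow> \<bar>dyref t\<bar> \<le> K"
      "\<And>s t. s \<ge> 0 \<Longrightarrow> t \<ge> 0 \<Longrightarrow> \<bar>dyref s - dyref t\<bar> \<le> K * \<bar>s - t\<bar>"
    and lu: "lu \<ge> 0" and t0: "t0 \<ge> 0" and \<delta>: "\<delta> > 0"
    and B: "compact B" "B \<subseteq> D_set i0 i1 (\<psi>0, \<psi>1) yref t0"
begin

abbreviation inner :: "real^'n \<Rightarrow> real^'n" where "inner \<equiv> inner_part i0 i1"

abbreviation rhs :: "(real \<Rightarrow> real) \<Rightarrow> real \<Rightarrow> real^'n \<Rightarrow> real^'n" where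
  "rhs u \<equiv> \<lambda>t x. f x + u t *\<^sub>R g x"

definition bi_rhs :: "(real \<Rightarrow> real) \<Rightarrow> real \<Rightarrow> real^'n \<Rightarrow> real^'n" where
  "bi_rhs u t z = (z $ i1) *\<^sub>R axis i0 1 + (p z + u t * \<gamma> z) *\<^sub>R axis i1 1 + q z"

lemma f_cont: "continuous_on UNIV f" and g_cont: "continuous_on UNIV g"
  using C_k_Suc_imp[of 0 f] C_k_Suc_imp[of 0 g] f g by auto

lemma p_cont: "continuous_on UNIV p" and q_cont: "continuous_on UNIV q"
  and q_internal: "q z \<in> internal_space i0 i1" and \<Phi>_output: "\<Phi> x $ i0 = h x"
  using bi by (auto simp: byrnes_isidori_form_def)

lemma \<Phi>_inv[simp]: "\<Phi> (inv \<Phi> z) = z" "inv \<Phi> (\<Phi> z) = z"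
  using \<Phi>(1) by (auto simp: bij_is_surj surj_f_inv_f bij_is_inj)

lemma D1_yref: "t \<ge> 0 \<Longrightarrow> D1 {0..} yref t = dyref t"
  using D1_Ici[OF yref_deriv] by simp

definition in_funnel :: "real \<Rightarrow> real^'n \<Rightarrow> bool" where
  "in_funnel t z \<longleftrightarrow> \<bar>z $ i0 - yref t\<bar> < \<psi>0 t \<and> \<bar>z $ i1 - dyref t\<bar> < \<psi>1 t"

lemma in_funnel_D_set: "t \<ge> 0 \<Longrightarrow> in_funnel t z \<longleftrightarrow> z \<in> D_set i0 i1 (\<psi>0, \<psi>1) yref t"
  by (auto simp: in_funnel_def D_set_def err0_def err1_def D1_yref)

lemma bi_form_rhs:
  "bi_vec i0 i1 (z $ i1, p z) (q z) + u t *\<^sub>R bi_vec i0 i1 (0, \<gamma> z) 0 = bi_rhs u t z"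
proof -
  have "0 \<in> internal_space i0 i1" by (simp add: internal_space_def)
  then show ?thesis
    using bi_vec_eq[OF i01 q_internal[of z]] bi_vec_eq[OF i01] by (simp add: bi_rhs_def algebra_simps)
qed

lemma bi_coefficients_cont:
  "continuous_on UNIV (\<lambda>z. bi_vec i0 i1 (z $ i1, p z) (q z))"
  "continuous_on UNIV (\<lambda>z. bi_vec i0 i1 (0, \<gamma> z) 0)"
proof -
  have 0: "0 \<in> internal_space i0 i1" by (simp add: internal_space_def)
  show "continuous_on UNIV (\<lambda>z. bi_vec i0 i1 (z $ i1, p z) (q z))"
    using p_cont q_cont unfolding bi_vec_eq[OF i01 q_internal] by (auto intro!: continuous_intros)
  show "continuous_on UNIV (\<lambda>z. bi_vec i0 i1 (0, \<gamma> z) 0)"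
    using \<gamma>(2) unfolding bi_vec_eq[OF i01 0] by (auto intro!: continuous_intros)
qed

lemma lipschitz_solution_bi_iff:
  assumes u: "u \<in> borel_measurable (lebesgue_on {s..b})" "\<And>t. t \<in> {s..b} \<Longrightarrow> \<bar>u t\<bar> \<le> M"
    and s: "0 \<le> s" "s < b"
  shows "lipschitz_solution (rhs u) s b x \<longleftrightarrow> lipschitz_solution (bi_rhs u) s b (\<Phi> \<circ> x)"
proof -
  define v where "v t = (if t \<in> {s..b} then u t else 0)" for t
  have vL: "v \<in> Linf_loc {0..}"
    using Linf_loc_extend_zero[OF u(1) s(1) u(2)] by (simp add: v_def[abs_def])
  have vb: "\<bar>v t\<bar> \<le> M" if "t \<in> {s..b}" for t using u(2)[OF that] that by (simp add: v_def)
  have bi': "control_solution f g v {s..<b} x \<longleftrightarrow>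
         control_solution (\<lambda>z. bi_vec i0 i1 (z $ i1, p z) (q z))
           (\<lambda>z. bi_vec i0 i1 (0, \<gamma> z) 0) v {s..<b} (\<Phi> \<circ> x)"
    using bi vL s unfolding byrnes_isidori_form_def \<gamma>(1) by auto
  have bieq: "(\<lambda>t z. bi_vec i0 i1 (z $ i1, p z) (q z) + v t *\<^sub>R bi_vec i0 i1 (0, \<gamma> z) 0) = bi_rhs v"
    by (intro ext) (rule bi_form_rhs)
  have cong1: "lipschitz_solution (rhs u) s b x \<longleftrightarrow> lipschitz_solution (rhs v) s b x" for x
    using lipschitz_solution_cong[of "rhs u" s b x x "{}" "rhs v"]
      lipschitz_solution_cong[of "rhs v" s b x x "{}" "rhs u"] by (auto simp: v_def)
  have cong2: "lipschitz_solution (bi_rhs u) s b x \<longleftrightarrow> lipschitz_solution (bi_rhs v) s b x" for x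
    using lipschitz_solution_cong[of "bi_rhs u" s b x x "{}" "bi_rhs v"]
      lipschitz_solution_cong[of "bi_rhs v" s b x x "{}" "bi_rhs u"] by (auto simp: v_def bi_rhs_def)
  show ?thesis unfolding cong1 cong2
  proof
    assume sol: "lipschitz_solution (rhs v) s b x"
    have "continuous_on {s..b} (\<Phi> \<circ> x)"
      using continuous_on_compose2[OF \<Phi>(2) lipschitz_solution_continuous_on[OF sol]] by (auto simp: o_def)
    from control_lipschitz_solution_Icc[OF bi'[THEN iffD1, OF lipschitz_solution_control_Ico[OF sol]] s(2) this bi_coefficients_cont vb]
    show "lipschitz_solution (bi_rhs v) s b (\<Phi> \<circ> x)" unfolding bieq .
  next
    assume sol: "lipschitz_solution (bi_rhs v) s b (\<Phi> \<circ> x)"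
    have "continuous_on {s..b} (\<lambda>t. inv \<Phi> ((\<Phi> \<circ> x) t))"
      by (rule continuous_on_compose2[OF \<Phi>(3) lipschitz_solution_continuous_on[OF sol]]) auto
    then have "continuous_on {s..b} x" by simp
    from control_lipschitz_solution_Icc[OF bi'[THEN iffD2, OF lipschitz_solution_control_Ico[OF sol[folded bieq]]] s(2) this f_cont g_cont vb]
    show "lipschitz_solution (rhs v) s b x" .
  qed
qed

lemma bi_solution_has_integral:
  assumes sol: "lipschitz_solution (bi_rhs u) a b z" and cd: "a \<le> c" "c \<le> d" "d \<le> b"
  shows "((\<lambda>t. z t $ i1) has_integral (z d $ i0 - z c $ i0)) {c..d}"
    "((\<lambda>t. q (z t)) has_integral (inner (z d) - inner (z c))) {c..d}"
proof -
  note int = lipschitz_solution_has_integral[OF sol cd]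
  have q0: "q z $ i0 = 0" "q z $ i1 = 0" for z using q_internal[of z] by (auto simp: internal_space_def)
  have "(\<lambda>x. x $ i0) \<circ> (\<lambda>t. bi_rhs u t (z t)) = (\<lambda>t. z t $ i1)"
    using i01 by (auto simp: bi_rhs_def q0 axis_def)
  with has_integral_linear[OF int bounded_linear_vec_nth[of i0]]
  show "((\<lambda>t. z t $ i1) has_integral (z d $ i0 - z c $ i0)) {c..d}" by simp
  have "inner \<circ> (\<lambda>t. bi_rhs u t (z t)) = (\<lambda>t. q (z t))"
    using i01 by (auto simp: bi_rhs_def vec_eq_iff inner_part_nth q0 axis_def)
  with has_integral_linear[OF int bounded_linear_inner_part[of i0 i1]]
  show "((\<lambda>t. q (z t)) has_integral (inner (z d) - inner (z c))) {c..d}"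
    by (simp add: linear_diff[OF bounded_linear.linear[OF bounded_linear_inner_part]])
qed

lemma bi_solution_output_deriv:
  assumes sol: "lipschitz_solution (bi_rhs u) a b z" and t: "t \<in> {a..b}"
  shows "((\<lambda>t. z t $ i0) has_vector_derivative z t $ i1) (at t within {a..b})"
proof (rule has_integral_imp_has_vector_derivative[OF _ _ t])
  show "continuous_on {a..b} (\<lambda>t. z t $ i1)"
    using lipschitz_solution_continuous_on[OF sol] by (intro continuous_intros)
  show "((\<lambda>t. z t $ i1) has_integral z d $ i0 - z a $ i0) {a..d}" if "d \<in> {a..b}" for d
    by (rule bi_solution_has_integral(1)[OF sol]) (use that in auto)
qed

subsection \<open>Boundedness of trajectories inside the funnels\<close>

text \<open>Along a path only the internal dynamics are imposed; the outputs are arbitrary as long as they stay in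
  the funnels. The BIBS condition bounds all such paths.\<close>

definition path :: "real \<Rightarrow> real \<Rightarrow> (real \<Rightarrow> real^'n) \<Rightarrow> bool" where
  "path a b z \<longleftrightarrow> continuous_on {a..b} z \<and> (\<forall>t\<in>{a..b}. in_funnel t (z t) \<and>
     ((\<lambda>s. q (z s)) has_integral (inner (z t) - inner (z a))) {a..t})"

definition reach :: "real \<Rightarrow> real^'n \<Rightarrow> bool" where
  "reach t z \<longleftrightarrow> (\<exists>w. path t0 t w \<and> w t0 \<in> B \<and> w t = z)"

lemma path_subset: "path a b z \<Longrightarrow> a \<le> b' \<Longrightarrow> b' \<le> b \<Longrightarrow> path a b' z"
  by (auto simp: path_def elim: continuous_on_subset)

lemma bi_solution_path:
  assumes "lipschitz_solution (bi_rhs u) a b z" "\<And>t. t \<in> {a..b} \<Longrightarrow> in_funnel t (z t)"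
  shows "path a b z"
  using assms lipschitz_solution_continuous_on[OF assms(1)] bi_solution_has_integral(2)[OF assms(1)]
  by (auto simp: path_def)

lemma path_glue:
  assumes ab: "path a b z" and bc: "path b c w" and eq: "z b = w b" and le: "a \<le> b" "b \<le> c"
  shows "path a c (\<lambda>t. if t \<le> b then z t else w t)"
proof -
  let ?y = "\<lambda>t. if t \<le> b then z t else w t"
  have cz: "continuous_on {a..b} z" and cw: "continuous_on {b..c} w" using ab bc by (auto simp: path_def)
  have "continuous_on ({a..b} \<union> {b..c}) ?y"
    using cz cw eq by (intro continuous_on_If) auto
  moreover have "{a..b} \<union> {b..c} = {a..c}" using le by auto
  ultimately have 1: "continuous_on {a..c} ?y" by simp
  have 2: "((\<lambda>s. q (?y s)) has_integral (inner (z t) - inner (z a))) {a..t}" if t: "t \<in> {a..b}" for t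
  proof (rule has_integral_eq[of _ "\<lambda>s. q (z s)"])
    show "((\<lambda>s. q (z s)) has_integral (inner (z t) - inner (z a))) {a..t}" using ab t by (auto simp: path_def)
  qed (use t in auto)
  have 3: "((\<lambda>s. q (?y s)) has_integral (inner (w t) - inner (w b))) {b..t}" if t: "t \<in> {b..c}" for t
  proof (rule has_integral_eq[of _ "\<lambda>s. q (w s)"])
    show "((\<lambda>s. q (w s)) has_integral (inner (w t) - inner (w b))) {b..t}" using bc t by (auto simp: path_def)
  qed (use t eq in auto)
  have 4: "((\<lambda>s. q (?y s)) has_integral (inner (?y t) - inner (?y a))) {a..t}" if t: "t \<in> {a..c}" for t
  proof (cases "t \<le> b")
    case True then show ?thesis using 2[of t] t le by auto
  next
    case False
    have "((\<lambda>s. q (?y s)) has_integral ((inner (z b) - inner (z a)) + (inner (w t) - inner (w b)))) {a..t}"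
      by (rule has_integral_combine[of a b t]) (use 2[of b] 3[of t] t False le in auto)
    then show ?thesis using False eq le by simp
  qed
  have "in_funnel t (?y t)" if "t \<in> {a..c}" for t using ab bc that by (auto simp: path_def)
  with 1 4 show ?thesis unfolding path_def by blast
qed

lemma reach_extend:
  assumes "reach a z0" "path a b z" "z a = z0" "t0 \<le> a" "a \<le> b"
  obtains w where "path t0 b w" "w t0 \<in> B" "\<And>t. t \<in> {a..b} \<Longrightarrow> w t = z t"
proof -
  obtain w where w: "path t0 a w" "w t0 \<in> B" "w a = z0" using assms(1) by (auto simp: reach_def)
  show ?thesis
  proof (rule that[of "\<lambda>t. if t \<le> a then w t else z t"])
    show "path t0 b (\<lambda>t. if t \<le> a then w t else z t)"
      by (rule path_glue[OF w(1) assms(2)]) (use w assms in auto)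
  qed (use w assms in auto)
qed

lemma reach_path_end:
  assumes "reach a z0" "path a b z" "z a = z0" "t0 \<le> a" "a \<le> b" "t \<in> {a..b}"
  shows "reach t (z t)"
proof -
  obtain w where w: "path t0 b w" "w t0 \<in> B" "\<And>t. t \<in> {a..b} \<Longrightarrow> w t = z t"
    by (rule reach_extend[OF assms(1-5)]) blast
  show ?thesis unfolding reach_def
    by (rule exI[of _ w]) (use w assms path_subset[OF w(1), of t] in auto)
qed

lemma in_funnel_bounds:
  assumes "in_funnel t z" "t \<ge> 0"
  shows "\<bar>z $ i0\<bar> \<le> 2 * K" "\<bar>z $ i1\<bar> \<le> 2 * K" "norm (z $ i0, z $ i1) \<le> 4 * K"
proof -
  show 1: "\<bar>z $ i0\<bar> \<le> 2 * K" "\<bar>z $ i1\<bar> \<le> 2 * K"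
    using assms yref_bounds(1,2)[of t] bounds(2,4)[of t] by (auto simp: in_funnel_def)
  show "norm (z $ i0, z $ i1) \<le> 4 * K"
    using norm_Pair_le[of "z $ i0" "z $ i1"] 1 by simp
qed

lemma norm_le_inner:
  assumes "in_funnel t z" "t \<ge> 0" shows "norm z \<le> 4 * K + norm (inner z)"
proof -
  have "norm z = norm ((z $ i0) *\<^sub>R axis i0 (1::real) + ((z $ i1) *\<^sub>R axis i1 1 + inner z))"
    by (simp add: inner_part_def)
  also have "\<dots> \<le> norm ((z $ i0) *\<^sub>R axis i0 (1::real)) + norm ((z $ i1) *\<^sub>R axis i1 (1::real) + inner z)"
    by (rule norm_triangle_ineq)
  also have "\<dots> \<le> norm ((z $ i0) *\<^sub>R axis i0 (1::real)) + (norm ((z $ i1) *\<^sub>R axis i1 (1::real)) + norm (inner z))"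
    by (intro add_left_mono norm_triangle_ineq)
  finally have "norm z \<le> \<bar>z $ i0\<bar> + (\<bar>z $ i1\<bar> + norm (inner z))" by simp
  then show ?thesis using in_funnel_bounds[OF assms] by simp
qed

lemma continuous_Linf_loc:
  fixes \<zeta> :: "real \<Rightarrow> 'b::euclidean_space"
  assumes c: "continuous_on {s..} \<zeta>" and b: "\<And>t. t \<ge> s \<Longrightarrow> norm (\<zeta> t) \<le> c"
  shows "\<zeta> \<in> Linf_loc {s..}" "Linf_norm {s..} \<zeta> \<le> ereal c"
proof -
  have m: "\<zeta> \<in> borel_measurable (lebesgue_on {s..})"
    using c by (intro continuous_imp_measurable_on_sets_lebesgue) auto
  have "\<zeta> \<in> Linf S" if S: "S \<subseteq> {s..}" "compact S" for S
    using continuous_on_subset[OF c S(1)] b S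
    by (intro bounded_in_Linf[of _ _ c] continuous_imp_measurable_on_sets_lebesgue) (auto intro: fmeasurableD[OF lmeasurable_compact])
  then show "\<zeta> \<in> Linf_loc {s..}" using m by (auto simp: Linf_loc_def)
  show "Linf_norm {s..} \<zeta> \<le> ereal c" using m b by (intro Linf_norm_le) auto
qed

lemma internal_solution_classical:
  assumes sol: "internal_solution i0 i1 q \<zeta> s \<eta>0 \<eta>" and c: "continuous_on {s..} \<zeta>" and t: "s \<le> t"
  shows "continuous_on {s..t} \<eta>" "((\<lambda>r. q (bi_vec i0 i1 (\<zeta> r) (\<eta> r))) has_integral (\<eta> t - \<eta>0)) {s..t}"
    "continuous_on {s..t} (\<lambda>r. bi_vec i0 i1 (\<zeta> r) (\<eta> r))"
    "lipschitz_solution (\<lambda>t z. q (bi_vec i0 i1 (\<zeta> t) z)) s t \<eta>"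
proof -
  have car: "caratheodory_solution (\<lambda>t z. q (bi_vec i0 i1 (\<zeta> t) z)) {s..} \<eta>" and i: "\<eta> s = \<eta>0"
    and int: "\<And>t. t \<ge> s \<Longrightarrow> \<eta> t \<in> internal_space i0 i1"
    using sol by (auto simp: internal_solution_def)
  show c\<eta>: "continuous_on {s..t} \<eta>" by (rule caratheodory_solution_continuous_on[OF car]) auto
  show "((\<lambda>r. q (bi_vec i0 i1 (\<zeta> r) (\<eta> r))) has_integral (\<eta> t - \<eta>0)) {s..t}"
    using caratheodory_solution_has_integral[OF car _ _ t] i by auto
  have eq: "bi_vec i0 i1 (\<zeta> r) (\<eta> r) = fst (\<zeta> r) *\<^sub>R axis i0 1 + snd (\<zeta> r) *\<^sub>R axis i1 1 + \<eta> r" if "r \<in> {s..t}" for r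
    by (rule bi_vec_eq[OF i01 int]) (use that in auto)
  have "continuous_on {s..t} (\<lambda>r. fst (\<zeta> r) *\<^sub>R axis i0 1 + snd (\<zeta> r) *\<^sub>R axis i1 1 + \<eta> r)"
    by (intro continuous_intros c\<eta> continuous_on_subset[OF c]) auto
  then show cb: "continuous_on {s..t} (\<lambda>r. bi_vec i0 i1 (\<zeta> r) (\<eta> r))"
    by (rule continuous_on_eq) (use eq in auto)
  have "continuous_on {s..t} (\<lambda>r. q (bi_vec i0 i1 (\<zeta> r) (\<eta> r)))"
    by (rule continuous_on_compose2[OF q_cont cb]) auto
  then obtain c where "\<And>r. r \<in> {s..t} \<Longrightarrow> norm (q (bi_vec i0 i1 (\<zeta> r) (\<eta> r))) \<le> c"
    by (rule continuous_on_Icc_norm_bound) blast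
  then show "lipschitz_solution (\<lambda>t z. q (bi_vec i0 i1 (\<zeta> t) z)) s t \<eta>"
    by (intro caratheodory_imp_lipschitz_solution[OF car]) auto
qed

lemma bibs_solution:
  assumes "s \<ge> 0" "\<eta>0 \<in> internal_space i0 i1" "continuous_on {s..} \<zeta>" "\<And>t. t \<ge> s \<Longrightarrow> norm (\<zeta> t) \<le> c"
  obtains \<eta> where "internal_solution i0 i1 q \<zeta> s \<eta>0 \<eta>"
proof -
  have c0: "0 \<le> c" using order_trans[OF norm_ge_zero assms(4)[of s]] by simp
  then have "norm \<eta>0 + c + 1 > 0" by (simp add: add_nonneg_pos)
  then obtain c1 where *: "\<And>s \<eta>0' \<zeta>. \<lbrakk>s \<ge> 0; \<eta>0' \<in> internal_space i0 i1; \<zeta> \<in> Linf_loc {s..};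
    ereal (norm \<eta>0') + Linf_norm {s..} \<zeta> \<le> ereal (norm \<eta>0 + c + 1)\<rbrakk> \<Longrightarrow> \<exists>\<eta>. internal_solution i0 i1 q \<zeta> s \<eta>0' \<eta>"
    using bibs unfolding bibs_def by meson
  note L = continuous_Linf_loc[OF assms(3,4)]
  have "ereal (norm \<eta>0) + Linf_norm {s..} \<zeta> \<le> ereal (norm \<eta>0) + ereal c" using L(2) by (intro add_left_mono)
  also have "\<dots> \<le> ereal (norm \<eta>0 + c + 1)" by simp
  finally show ?thesis using *[OF assms(1,2) L(1)] that by blast
qed

lemma path_bounded:
  obtains R where "R > 0" "\<And>b z t. \<lbrakk>path t0 b z; z t0 \<in> B; t \<in> {t0..b}\<rbrakk> \<Longrightarrow> norm (z t) \<le> R"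
proof -
  have "bounded (inner ` B)"
    using B(1) linear_continuous_on[OF bounded_linear_inner_part]
    by (intro compact_imp_bounded compact_continuous_image) auto
  then obtain CB where CB: "CB > 0" "\<And>z. z \<in> B \<Longrightarrow> norm (inner z) \<le> CB"
    unfolding bounded_pos by auto
  have "CB + 4 * K > 0" using CB K_pos by simp
  then obtain c1 where c1: "c1 > 0" "\<And>\<eta>0 \<zeta>. \<lbrakk>\<eta>0 \<in> internal_space i0 i1; \<zeta> \<in> Linf_loc {t0..};
    ereal (norm \<eta>0) + Linf_norm {t0..} \<zeta> \<le> ereal (CB + 4 * K)\<rbrakk> \<Longrightarrow>
        (\<exists>\<eta>. internal_solution i0 i1 q \<zeta> t0 \<eta>0 \<eta> \<and>
             (\<forall>\<eta>'. internal_solution i0 i1 q \<zeta> t0 \<eta>0 \<eta>' \<longrightarrow> (\<forall>t\<ge>t0. \<eta>' t = \<eta> t)) \<and>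
             Linf_norm {t0..} \<eta> \<le> ereal c1)"
    using bibs t0 unfolding bibs_def by meson
  show ?thesis
  proof (rule that[of "4 * K + c1"])
    show "4 * K + c1 > 0" using K_pos c1 by simp
    fix b z t assume z: "path t0 b z" "z t0 \<in> B" and t: "t \<in> {t0..b}"
    have b: "t0 \<le> b" using t by simp
    define \<zeta> where "\<zeta> s = (z (min s b) $ i0, z (min s b) $ i1)" for s
    have zc: "continuous_on {t0..b} z" using z by (simp add: path_def)
    have zc': "continuous_on {t0..} (\<lambda>s. z (min s b))"
      by (rule continuous_on_compose2[OF zc]) (use b in \<open>auto intro!: continuous_intros\<close>)
    have \<zeta>c: "continuous_on {t0..} \<zeta>" unfolding \<zeta>_def[abs_def] by (intro continuous_intros zc')
    have \<zeta>b: "norm (\<zeta> s) \<le> 4 * K" if "s \<ge> t0" for s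
      unfolding \<zeta>_def by (rule in_funnel_bounds(3)[of "min s b"]) (use z that b t0 in \<open>auto simp: path_def\<close>)
    obtain \<eta>2 where \<eta>2: "internal_solution i0 i1 q \<zeta> b (inner (z b)) \<eta>2"
      by (rule bibs_solution[of b "inner (z b)" \<zeta> "4 * K"])
        (use b t0 \<zeta>b inner_part_internal[OF i01] continuous_on_subset[OF \<zeta>c, of "{b..}"] in auto)
    define \<eta>h where "\<eta>h s = (if s \<le> b then inner (z s) else \<eta>2 s)" for s
    have \<eta>2b: "\<eta>2 b = inner (z b)" and \<eta>2i: "s \<ge> b \<Longrightarrow> \<eta>2 s \<in> internal_space i0 i1" for s
      using \<eta>2 by (auto simp: internal_solution_def)
    let ?F = "\<lambda>t w. q (bi_vec i0 i1 (\<zeta> t) w)"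
    have l1: "lipschitz_solution ?F t0 b \<eta>h"
    proof (rule lipschitz_solution_cong[of ?F t0 b "\<lambda>s. inner (z s)" _ "{}"])
      have eq: "?F s (inner (z s)) = q (z s)" if "s \<in> {t0..b}" for s
        using that bi_vec_inner_part[OF i01, of "z s"] by (simp add: \<zeta>_def min_def)
      have qc: "continuous_on {t0..b} (\<lambda>s. q (z s))" by (rule continuous_on_compose2[OF q_cont zc]) auto
      obtain c where c: "\<And>s. s \<in> {t0..b} \<Longrightarrow> norm (q (z s)) \<le> c"
        using continuous_on_Icc_norm_bound[OF qc] by blast
      show "lipschitz_solution ?F t0 b (\<lambda>s. inner (z s))"
      proof (rule has_vector_derivative_imp_lipschitz_solution[where c=c])
        fix s assume s: "s \<in> {t0..b}"
        have "((\<lambda>s. inner (z s)) has_vector_derivative q (z s)) (at s within {t0..b})"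
          by (rule has_integral_imp_has_vector_derivative[OF qc _ s]) (use z in \<open>auto simp: path_def\<close>)
        then show "((\<lambda>s. inner (z s)) has_vector_derivative ?F s (inner (z s))) (at s within {t0..b})"
          using eq[OF s] by simp
        show "norm (?F s (inner (z s))) \<le> c" using eq[OF s] c[OF s] by simp
      qed
    qed (auto simp: \<eta>h_def)
    have l2: "lipschitz_solution ?F b b' \<eta>h" if "b \<le> b'" for b'
      by (rule lipschitz_solution_cong[OF internal_solution_classical(4)[OF \<eta>2 _ that], of _ "{}"])
        (use continuous_on_subset[OF \<zeta>c, of "{b..}"] b \<eta>2b in \<open>auto simp: \<eta>h_def\<close>)
    have l3: "lipschitz_solution ?F t0 b' \<eta>h" if "t0 \<le> b'" for b'
    proof (cases "b' \<le> b")
      case True then show ?thesis using lipschitz_solution_subset[OF l1, of t0 b'] by simp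
    next
      case False then show ?thesis using lipschitz_solution_glue[OF l1 l2[of b']] b by simp
    qed
    have isol: "internal_solution i0 i1 q \<zeta> t0 (inner (z t0)) \<eta>h"
      unfolding internal_solution_def
      using lipschitz_solution_caratheodory_Ici[OF l3] b \<eta>2i inner_part_internal[OF i01] by (auto simp: \<eta>h_def)
    note L = continuous_Linf_loc[OF \<zeta>c \<zeta>b]
    have "ereal (norm (inner (z t0))) + Linf_norm {t0..} \<zeta> \<le> ereal CB + ereal (4 * K)"
      using L(2) CB(2)[OF z(2)] by (intro add_mono) auto
    then obtain \<eta> where \<eta>: "\<And>\<eta>'. internal_solution i0 i1 q \<zeta> t0 (inner (z t0)) \<eta>' \<Longrightarrow> (\<forall>t\<ge>t0. \<eta>' t = \<eta> t)"
      "Linf_norm {t0..} \<eta> \<le> ereal c1"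
      using c1(2)[OF inner_part_internal[OF i01] L(1)] by (metis plus_ereal.simps(1))
    have eq: "\<eta> s = \<eta>h s" if "s \<ge> t0" for s using \<eta>(1)[OF isol] that by simp
    have "continuous_on {t0..} \<eta>h"
      by (rule continuous_on_IciI[OF lipschitz_solution_continuous_on[OF l3]])
    then have "continuous_on {t0..} \<eta>" by (rule continuous_on_eq) (use eq in auto)
    from AE_bound_continuous_on_Ici[OF Linf_norm_leD[OF \<eta>(2)] this, of t]
    have "norm (inner (z t)) \<le> c1" using eq[of t] t by (simp add: \<eta>h_def)
    moreover have "norm (z t) \<le> 4 * K + norm (inner (z t))"
      by (rule norm_le_inner[of t]) (use z t t0 in \<open>auto simp: path_def\<close>)
    ultimately show "norm (z t) \<le> 4 * K + c1" by simp
  qed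
qed

end

lemma derivative_bound_lipschitz:
  fixes y :: "real \<Rightarrow> real"
  assumes d: "\<And>t. t \<ge> 0 \<Longrightarrow> (y has_vector_derivative dy t) (at t within {0..})"
    and b: "\<And>t. t \<ge> 0 \<Longrightarrow> \<bar>dy t\<bar> \<le> K" and st: "s \<ge> 0" "t \<ge> 0"
  shows "\<bar>y s - y t\<bar> \<le> K * \<bar>s - t\<bar>"
proof -
  have *: "\<bar>y t - y s\<bar> \<le> K * (t - s)" if "0 \<le> s" "s \<le> t" for s t
  proof -
    have K: "0 \<le> K" using b[of 0] by simp
    have "(y has_vector_derivative dy r) (at r within {s..t})" if "r \<in> {s..t}" for r
      by (rule has_vector_derivative_within_subset[OF d]) (use that \<open>0 \<le> s\<close> in auto)
    from has_integral_norm_bound_AE[OF fundamental_theorem_of_calculus[OF that(2) this] that(2), of "{}" K]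
    show ?thesis using b K that by auto
  qed
  show ?thesis using *[of s t] *[of t s] st by (cases "s \<le> t") (auto simp: abs_minus_commute)
qed

lemma abs_diff_abs_le:
  fixes a b c d e f :: real
  shows "\<bar>a - b\<bar> \<le> A \<Longrightarrow> \<bar>c - d\<bar> \<le> C \<Longrightarrow> \<bar>e - f\<bar> \<le> E \<Longrightarrow> \<bar>(a - \<bar>c - e\<bar>) - (b - \<bar>d - f\<bar>)\<bar> \<le> A + C + E"
  by linarith

lemma abs_min_diff_le:
  fixes a b c d :: real
  shows "\<bar>a - c\<bar> \<le> A \<Longrightarrow> \<bar>b - d\<bar> \<le> A \<Longrightarrow> \<bar>min a b - min c d\<bar> \<le> A"
  by linarith

lemma reciprocal_barrier:
  fixes e \<psi> m :: real
  assumes "\<bar>e\<bar> < \<psi>" "m \<le> \<psi>" "0 < m"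
  shows "m / (2 * (\<psi> - \<bar>e\<bar>)) \<le> 1 / (1 - e\<^sup>2 / \<psi>\<^sup>2)" "1 \<le> 1 / (1 - e\<^sup>2 / \<psi>\<^sup>2)" "0 < 1 - e\<^sup>2 / \<psi>\<^sup>2"
proof -
  have \<psi>: "0 < \<psi>" using assms by simp
  have "e\<^sup>2 < \<psi>\<^sup>2" using assms(1) \<psi> abs_less_iff power2_strict_mono[of e \<psi>] by (metis abs_of_pos)
  then show pos: "0 < 1 - e\<^sup>2 / \<psi>\<^sup>2" using \<psi> by simp
  show "1 \<le> 1 / (1 - e\<^sup>2 / \<psi>\<^sup>2)" using pos \<psi> by (simp add: le_divide_eq)
  have "1 - e\<^sup>2 / \<psi>\<^sup>2 = (\<psi> - \<bar>e\<bar>) * (\<psi> + \<bar>e\<bar>) / \<psi>\<^sup>2"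
  proof -
    have "(\<psi> - \<bar>e\<bar>) * (\<psi> + \<bar>e\<bar>) = \<psi>\<^sup>2 - e\<^sup>2" by (simp add: algebra_simps power2_eq_square)
    then show ?thesis using \<psi> by (simp add: diff_divide_distrib)
  qed
  also have "\<dots> \<le> (\<psi> - \<bar>e\<bar>) * (2 * \<psi>) / \<psi>\<^sup>2"
    using assms by (intro divide_right_mono mult_left_mono) auto
  also have "\<dots> = 2 * (\<psi> - \<bar>e\<bar>) / \<psi>" using \<psi> by (simp add: power2_eq_square)
  also have "\<dots> \<le> 2 * (\<psi> - \<bar>e\<bar>) / m" using assms by (intro divide_left_mono) auto
  finally have "1 - e\<^sup>2 / \<psi>\<^sup>2 \<le> 2 * (\<psi> - \<bar>e\<bar>) / m" .
  then have "1 / (2 * (\<psi> - \<bar>e\<bar>) / m) \<le> 1 / (1 - e\<^sup>2 / \<psi>\<^sup>2)"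
    using pos by (intro divide_left_mono) (auto intro!: mult_pos_pos divide_pos_pos simp: assms)
  then show "m / (2 * (\<psi> - \<bar>e\<bar>)) \<le> 1 / (1 - e\<^sup>2 / \<psi>\<^sup>2)" by simp
qed

lemma nn_integral_reciprocal_infinite:
  fixes F :: "real \<Rightarrow> ennreal"
  assumes s: "s < \<tau>" "\<tau> \<le> b" and c: "0 < c"
    and F: "\<And>r. s \<le> r \<Longrightarrow> r < \<tau> \<Longrightarrow> ennreal (c / (\<tau> - r)) \<le> F r"
  shows "(\<integral>\<^sup>+r. F r \<partial>lebesgue_on {s..b}) = \<infinity>"
proof -
  have *: "ennreal (real k) \<le> (\<integral>\<^sup>+r. F r \<partial>lebesgue_on {s..b})" for k
  proof -
    define d where "d = (\<tau> - s) * exp (- (real k / c))"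
    have d: "0 < d" "d \<le> \<tau> - s" "ln d = ln (\<tau> - s) - real k / c"
      using s c by (auto simp: d_def ln_mult mult_le_cancel_left1)
    define f where "f r = c / max d (\<tau> - r)" for r
    have fc: "continuous_on UNIV f" unfolding f_def[abs_def] using d by (intro continuous_intros) (auto simp: max_def)
    have "(\<integral>\<^sup>+r. ennreal (f r) * indicator {s..\<tau> - d} r \<partial>lborel) = ennreal (- c * ln (\<tau> - (\<tau> - d)) - (- c * ln (\<tau> - s)))"
    proof (rule nn_integral_FTC_Icc)
      show "f \<in> borel_measurable borel" using fc by (rule borel_measurable_continuous_onI)
      fix r assume r: "r \<in> {s..\<tau> - d}"
      have "((\<lambda>r. - c * ln (\<tau> - r)) has_real_derivative c / (\<tau> - r)) (at r)"
        using r d by (auto intro!: derivative_eq_intros simp: field_simps)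
      then show "((\<lambda>r. - c * ln (\<tau> - r)) has_real_derivative f r) (at r)"
        using r d by (simp add: f_def max_def)
      show "0 \<le> f r" using r d c by (simp add: f_def)
    qed (use d in auto)
    also have "- c * ln (\<tau> - (\<tau> - d)) - (- c * ln (\<tau> - s)) = real k"
      using d c by (simp add: field_simps)
    finally have "ennreal (real k) = (\<integral>\<^sup>+r. ennreal (f r) * indicator {s..\<tau> - d} r \<partial>lborel)" by simp
    also have "\<dots> = (\<integral>\<^sup>+r. ennreal (f r) * indicator {s..\<tau> - d} r \<partial>lebesgue)"
      by (rule nn_integral_completion[symmetric])
    also have "\<dots> \<le> (\<integral>\<^sup>+r. F r * indicator {s..b} r \<partial>lebesgue)"
    proof (rule nn_integral_mono)
      fix r show "ennreal (f r) * indicator {s..\<tau> - d} r \<le> F r * indicator {s..b} r"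
        using F[of r] d s by (auto simp: indicator_def f_def max_def)
    qed
    also have "\<dots> = (\<integral>\<^sup>+r. F r \<partial>lebesgue_on {s..b})" by (simp add: nn_integral_restrict_space)
    finally show ?thesis .
  qed
  show ?thesis
  proof (rule ccontr)
    assume "\<not> ?thesis"
    then obtain r where r: "(\<integral>\<^sup>+r. F r \<partial>lebesgue_on {s..b}) = ennreal r" "0 \<le> r"
      by (metis ennreal_cases infinity_ennreal_def)
    obtain k where "r < real k" using reals_Archimedean2 by blast
    then show False using *[of k] r by (simp add: ennreal_le_iff)
  qed
qed

context fmpc
begin

lemma \<psi>0_lip: "s \<ge> 0 \<Longrightarrow> t \<ge> 0 \<Longrightarrow> \<bar>\<psi>0 s - \<psi>0 t\<bar> \<le> K * \<bar>s - t\<bar>"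
  by (rule derivative_bound_lipschitz[OF \<psi>0_deriv d\<psi>0_bound])

lemma yref_lip: "s \<ge> 0 \<Longrightarrow> t \<ge> 0 \<Longrightarrow> \<bar>yref s - yref t\<bar> \<le> K * \<bar>s - t\<bar>"
  by (rule derivative_bound_lipschitz[OF yref_deriv yref_bounds(2)])

lemma yref_cont: "continuous_on {0..} yref" and dyref_cont: "continuous_on {0..} dyref"
  using yref_lip yref_bounds(3) K_pos
  by (auto intro!: lipschitz_on_continuous_on[of K] lipschitz_onI simp: dist_real_def)

definition safe_state :: "real \<Rightarrow> real \<Rightarrow> real^'n \<Rightarrow> bool" where
  "safe_state Ms t z \<longleftrightarrow> safe Ms t (z $ i0 - yref t) (z $ i1 - dyref t)"

definition steerable :: "real \<Rightarrow> real \<Rightarrow> bool" where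
  "steerable Ms M \<longleftrightarrow> (\<forall>t z0 b. t \<ge> t0 \<longrightarrow> reach t z0 \<longrightarrow> safe_state Ms t z0 \<longrightarrow> t < b \<longrightarrow>
    (\<exists>z u. u \<in> borel_measurable borel \<and> (\<forall>r. r \<ge> t \<longrightarrow> \<bar>u r\<bar> \<le> M) \<and> z t = z0 \<and>
      lipschitz_solution (bi_rhs u) t b z \<and> (\<forall>r\<in>{t..b}. in_funnel r (z r))))"

lemma steerable_exists:
  assumes Ms: "Ms \<ge> 0"
  obtains M where "M > 0" "steerable Ms M"
proof -
  obtain W where W: "W \<ge> 0" "\<And>t e0 v0. \<lbrakk>t \<ge> 0; \<bar>e0\<bar> < \<psi>0 t; \<bar>v0\<bar> < \<psi>1 t; safe Ms t e0 v0\<rbrakk>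
    \<Longrightarrow> \<exists>e v. funnel_path W t e0 v0 e v"
    by (rule steer[OF Ms]) blast
  obtain R where R: "R > 0" "\<And>b z t. \<lbrakk>path t0 b z; z t0 \<in> B; t \<in> {t0..b}\<rbrakk> \<Longrightarrow> norm (z t) \<le> R"
    by (rule path_bounded) blast
  have "bounded (p ` cball 0 R)"
    by (intro compact_imp_bounded compact_continuous_image continuous_on_subset[OF p_cont]) auto
  then obtain P where P: "P > 0" "\<And>z. norm z \<le> R \<Longrightarrow> \<bar>p z\<bar> \<le> P" unfolding bounded_pos by auto
  have "\<exists>z1\<in>cball 0 R. \<forall>z\<in>cball 0 R. \<bar>\<gamma> z1\<bar> \<le> \<bar>\<gamma> z\<bar>"
    using R(1) by (intro continuous_attains_inf continuous_intros continuous_on_subset[OF \<gamma>(2)]) auto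
  then obtain z1 where "\<forall>z\<in>cball 0 R. \<bar>\<gamma> z1\<bar> \<le> \<bar>\<gamma> z\<bar>" by blast
  then have z1: "\<bar>\<gamma> z1\<bar> \<le> \<bar>\<gamma> z\<bar>" if "norm z \<le> R" for z using that by simp
  define \<gamma>m where "\<gamma>m = \<bar>\<gamma> z1\<bar>"
  have \<gamma>m: "\<gamma>m > 0" using \<gamma>(3)[of z1] by (simp add: \<gamma>m_def)
  define M where "M = (K + W + P) / \<gamma>m"
  have M: "M > 0" using K_pos W P \<gamma>m by (simp add: M_def)
  have "steerable Ms M"
    unfolding steerable_def
  proof (intro allI impI)
    fix t z0 b assume t: "t \<ge> t0" and reach: "reach t z0" and safe: "safe_state Ms t z0" and tb: "t < b"
    have t': "t \<ge> 0" using t t0 by simp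
    have inf0: "in_funnel t z0" using reach t by (auto simp: reach_def path_def)
    obtain e v where ev: "funnel_path W t (z0 $ i0 - yref t) (z0 $ i1 - dyref t) e v"
      using W(2)[OF t' _ _ safe[unfolded safe_state_def]] inf0 by (auto simp: in_funnel_def)
    have ed: "(e has_vector_derivative v r) (at r within {t..})" and efun: "\<bar>e r\<bar> < \<psi>0 r" "\<bar>v r\<bar> < \<psi>1 r" if "r \<ge> t" for r
      using ev that by (auto simp: funnel_path_def)
    have ev0: "e t = z0 $ i0 - yref t" "v t = z0 $ i1 - dyref t"
      and vl: "\<And>r s. r \<ge> t \<Longrightarrow> s \<ge> t \<Longrightarrow> \<bar>v r - v s\<bar> \<le> W * \<bar>r - s\<bar>"
      using ev by (auto simp: funnel_path_def)
    have ec: "continuous_on {t..} e"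
      unfolding continuous_on_eq_continuous_within using ed has_vector_derivative_continuous by blast
    have vc: "continuous_on {t..} v"
      using vl W(1) by (intro lipschitz_on_continuous_on[of W] lipschitz_onI) (auto simp: dist_real_def)
    have sub: "{t..} \<subseteq> {0..}" using t' by auto
    define \<zeta> where "\<zeta> r = (yref r + e r, dyref r + v r)" for r
    have \<zeta>c: "continuous_on {t..} \<zeta>"
      unfolding \<zeta>_def[abs_def]
      by (intro continuous_intros ec vc continuous_on_subset[OF yref_cont sub] continuous_on_subset[OF dyref_cont sub])
    have \<zeta>b: "\<bar>fst (\<zeta> r)\<bar> \<le> 2 * K" "\<bar>snd (\<zeta> r)\<bar> \<le> 2 * K" if "r \<ge> t" for r
      using yref_bounds(1,2)[of r] bounds(2,4)[of r] efun[OF that] that t' by (auto simp: \<zeta>_def)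
    have \<zeta>n: "norm (\<zeta> r) \<le> 4 * K" if "r \<ge> t" for r
      using norm_Pair_le[of "fst (\<zeta> r)" "snd (\<zeta> r)"] \<zeta>b[OF that] by simp
    obtain \<eta> where \<eta>: "internal_solution i0 i1 q \<zeta> t (inner z0) \<eta>"
      by (rule bibs_solution[OF t' inner_part_internal[OF i01] \<zeta>c \<zeta>n])
    have \<eta>0: "\<eta> t = inner z0" and \<eta>i: "\<And>r. r \<ge> t \<Longrightarrow> \<eta> r \<in> internal_space i0 i1"
      using \<eta> by (auto simp: internal_solution_def)
    define y where "y r = bi_vec i0 i1 (\<zeta> r) (\<eta> r)" for r
    have yc: "continuous_on {t..} y"
      unfolding y_def[abs_def] by (rule continuous_on_IciI[OF internal_solution_classical(3)[OF \<eta> \<zeta>c]])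
    have y01: "y r $ i0 = yref r + e r" "y r $ i1 = dyref r + v r" for r
      using i01 by (auto simp: y_def bi_vec_def \<zeta>_def)
    have yeq: "y r = (yref r + e r) *\<^sub>R axis i0 1 + (dyref r + v r) *\<^sub>R axis i1 1 + \<eta> r" if "r \<ge> t" for r
      using bi_vec_eq[OF i01 \<eta>i[OF that]] by (simp add: y_def \<zeta>_def)
    have yin: "inner (y r) = \<eta> r" if "r \<ge> t" for r
      unfolding inner_part_def y01 by (subst yeq[OF that]) simp
    have y0: "y t = z0"
      using bi_vec_inner_part[OF i01, of z0] by (simp add: y_def \<zeta>_def ev0 \<eta>0)
    have yf: "in_funnel r (y r)" if "r \<ge> t" for r using efun[OF that] by (simp add: in_funnel_def y01)
    have yp: "path t b' y" if "t \<le> b'" for b'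
      unfolding path_def
    proof (intro conjI ballI)
      show "continuous_on {t..b'} y" by (rule continuous_on_subset[OF yc]) auto
      fix r assume r: "r \<in> {t..b'}"
      then show "in_funnel r (y r)" using yf by simp
      show "((\<lambda>s. q (y s)) has_integral inner (y r) - inner (y t)) {t..r}"
        using internal_solution_classical(2)[OF \<eta> \<zeta>c, of r] r yin[of r] yin[of t] by (simp add: y_def[abs_def] \<eta>0)
    qed
    have yR: "norm (y r) \<le> R" if r: "r \<ge> t" for r
    proof -
      obtain w where w: "path t0 r w" "w t0 \<in> B" "\<And>s. s \<in> {t..r} \<Longrightarrow> w s = y s"
        by (rule reach_extend[OF reach yp[OF r] y0 t r]) blast
      show ?thesis using R(2)[OF w(1,2), of r] w(3)[of r] r t by auto
    qed
    define vh where "vh r = dyref (max 0 r) + v (max t r)" for r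
    have vhl: "\<bar>vh r - vh s\<bar> \<le> (K + W) * \<bar>r - s\<bar>" for r s
    proof -
      have "\<bar>dyref (max 0 r) - dyref (max 0 s)\<bar> \<le> K * \<bar>max 0 r - max 0 s\<bar>" by (rule yref_bounds(3)) auto
      also have "\<dots> \<le> K * \<bar>r - s\<bar>" using K_pos by (intro mult_left_mono) auto
      finally have 1: "\<bar>dyref (max 0 r) - dyref (max 0 s)\<bar> \<le> K * \<bar>r - s\<bar>" .
      have "\<bar>v (max t r) - v (max t s)\<bar> \<le> W * \<bar>max t r - max t s\<bar>" by (rule vl) auto
      also have "\<dots> \<le> W * \<bar>r - s\<bar>" using W(1) by (intro mult_left_mono) auto
      finally have 2: "\<bar>v (max t r) - v (max t s)\<bar> \<le> W * \<bar>r - s\<bar>" .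
      show ?thesis
        unfolding vh_def distrib_right by (rule order_trans[OF abs_diff_triangle_ineq add_mono[OF 1 2]])
    qed
    obtain w N where w: "w \<in> borel_measurable borel" "\<And>r. \<bar>w r\<bar> \<le> K + W" "negligible N"
      "\<And>r. r \<notin> N \<Longrightarrow> (vh has_vector_derivative w r) (at r)"
      by (rule lipschitz_AE_has_vector_derivative[OF vhl]) (rule that; assumption)
    define u where "u r = (w r - p (y (max t r))) / \<gamma> (y (max t r))" for r
    have ymc: "continuous_on UNIV (\<lambda>r. y (max t r))"
      by (rule continuous_on_compose2[OF yc]) (auto intro!: continuous_intros)
    have um: "u \<in> borel_measurable borel"
    proof -
      have "(\<lambda>r. p (y (max t r))) \<in> borel_measurable borel"
        by (rule borel_measurable_continuous_onI) (rule continuous_on_compose2[OF p_cont ymc], auto)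
      moreover have "(\<lambda>r. \<gamma> (y (max t r))) \<in> borel_measurable borel"
        by (rule borel_measurable_continuous_onI) (rule continuous_on_compose2[OF \<gamma>(2) ymc], auto)
      ultimately show ?thesis unfolding u_def[abs_def] using w(1) by measurable
    qed
    have ub: "\<bar>u r\<bar> \<le> M" if "r \<ge> t" for r
    proof -
      have n: "norm (y (max t r)) \<le> R" by (rule yR) simp
      have "\<bar>w r - p (y (max t r))\<bar> \<le> K + W + P" using w(2)[of r] P(2)[OF n] by linarith
      moreover have "\<gamma>m \<le> \<bar>\<gamma> (y (max t r))\<bar>" using z1[OF n] by (simp add: \<gamma>m_def)
      ultimately show ?thesis
        unfolding u_def abs_divide M_def using \<gamma>m K_pos W(1) P(1) by (intro frac_le) auto
    qed
    have "lipschitz_solution (bi_rhs u) t b y"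
    proof -
      obtain Ln Nn where Ln: "Ln \<ge> 0" "\<And>r s. r \<in> {t..b} \<Longrightarrow> s \<in> {t..b} \<Longrightarrow> norm (\<eta> r - \<eta> s) \<le> Ln * \<bar>r - s\<bar>"
        "negligible Nn" "\<And>r. r \<in> {t<..<b} \<Longrightarrow> r \<notin> Nn \<Longrightarrow> (\<eta> has_vector_derivative q (bi_vec i0 i1 (\<zeta> r) (\<eta> r))) (at r)"
        by (rule lipschitz_solutionE[OF internal_solution_classical(4)[OF \<eta> \<zeta>c less_imp_le[OF tb]]]) blast
      have el: "\<bar>e r - e s\<bar> \<le> K * \<bar>r - s\<bar>" if "r \<ge> t" "s \<ge> t" for r s
      proof -
        have *: "\<bar>e s - e r\<bar> \<le> K * (s - r)" if "t \<le> r" "r \<le> s" for r s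
        proof -
          have "(e has_vector_derivative v x) (at x within {r..s})" if "x \<in> {r..s}" for x
            by (rule has_vector_derivative_within_subset[OF ed]) (use that \<open>t \<le> r\<close> in auto)
          from has_integral_norm_bound_AE[OF fundamental_theorem_of_calculus[OF that(2) this] that(2), of "{}" K]
          have "(\<And>x. x \<in> {r..s} \<Longrightarrow> \<bar>v x\<bar> \<le> K) \<Longrightarrow> ?thesis" using K_pos by auto
          moreover have "\<bar>v x\<bar> \<le> K" if "x \<in> {r..s}" for x
            using efun(2)[of x] bounds(4)[of x] that \<open>t \<le> r\<close> t' by auto
          ultimately show ?thesis by blast
        qed
        show ?thesis using *[of r s] *[of s r] that by (cases "r \<le> s") (auto simp: abs_minus_commute)
      qed
      show ?thesis
      proof (rule lipschitz_solutionI[of t b y "2 * K + (K + W) + Ln" "N \<union> Nn"])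
        fix r s assume rs: "r \<in> {t..b}" "s \<in> {t..b}"
        have "y r - y s = ((yref r - yref s) + (e r - e s)) *\<^sub>R axis i0 1
           + (vh r - vh s) *\<^sub>R axis i1 1 + (\<eta> r - \<eta> s)"
          using yeq[of r] yeq[of s] rs t' by (simp add: vh_def max_def algebra_simps)
        also have "norm \<dots> \<le> (norm (((yref r - yref s) + (e r - e s)) *\<^sub>R axis i0 (1::real))
           + norm ((vh r - vh s) *\<^sub>R axis i1 (1::real))) + norm (\<eta> r - \<eta> s)"
          by (intro order_trans[OF norm_triangle_ineq] add_right_mono norm_triangle_ineq)
        also have "\<dots> \<le> (2 * K * \<bar>r - s\<bar> + (K + W) * \<bar>r - s\<bar>) + Ln * \<bar>r - s\<bar>"
        proof (intro add_mono)
          show "norm (((yref r - yref s) + (e r - e s)) *\<^sub>R axis i0 (1::real)) \<le> 2 * K * \<bar>r - s\<bar>"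
            using yref_lip[of r s] el[of r s] rs t' by auto
          show "norm ((vh r - vh s) *\<^sub>R axis i1 (1::real)) \<le> (K + W) * \<bar>r - s\<bar>" using vhl[of r s] by simp
          show "norm (\<eta> r - \<eta> s) \<le> Ln * \<bar>r - s\<bar>" by (rule Ln(2)[OF rs])
        qed
        finally show "norm (y r - y s) \<le> (2 * K + (K + W) + Ln) * \<bar>r - s\<bar>" by (simp add: algebra_simps)
      next
        show "negligible (N \<union> Nn)" using w(3) Ln(3) by (rule negligible_Un)
        fix r assume r: "r \<in> {t<..<b}" "r \<notin> N \<union> Nn"
        have at1: "at r within {0..} = at r" "at r within {t..} = at r"
          using r t' by (auto intro!: at_within_interior simp: interior_real_atLeast)
        have d1: "(yref has_vector_derivative dyref r) (at r)" "(e has_vector_derivative v r) (at r)"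
          using yref_deriv[of r] ed[of r] r t' unfolding at1 by auto
        have d2: "(vh has_vector_derivative w r) (at r)" using w(4) r by auto
        have d3: "(\<eta> has_vector_derivative q (y r)) (at r)" using Ln(4)[of r] r by (simp add: y_def)
        have "((\<lambda>r. (yref r + e r) *\<^sub>R axis i0 1 + vh r *\<^sub>R axis i1 1 + \<eta> r) has_vector_derivative
          (dyref r + v r) *\<^sub>R axis i0 1 + w r *\<^sub>R axis i1 1 + q (y r)) (at r)"
          by (intro has_vector_derivative_add d3
              bounded_linear.has_vector_derivative[OF bounded_linear_scaleR_left] d1 d2)
        then have "(y has_vector_derivative
          (dyref r + v r) *\<^sub>R axis i0 1 + w r *\<^sub>R axis i1 1 + q (y r)) (at r)"
          by (rule has_vector_derivative_transform_within_open[where S="{t<..<b}"])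
            (use r yeq t' in \<open>auto simp: vh_def max_def\<close>)
        moreover have "(dyref r + v r) *\<^sub>R axis i0 1 + w r *\<^sub>R axis i1 1 + q (y r) = bi_rhs u r (y r)"
          using r \<gamma>(3)[of "y r"] by (simp add: bi_rhs_def y01 u_def max_def)
        ultimately show "(y has_vector_derivative bi_rhs u r (y r)) (at r)" by simp
      qed
    qed
    then show "\<exists>z u. u \<in> borel_measurable borel \<and> (\<forall>r. r \<ge> t \<longrightarrow> \<bar>u r\<bar> \<le> M) \<and> z t = z0 \<and>
      lipschitz_solution (bi_rhs u) t b z \<and> (\<forall>r\<in>{t..b}. in_funnel r (z r))"
      using um ub y0 yf by (intro exI[of _ y] exI[of _ u]) auto
  qed
  then show ?thesis by (rule that[OF M])
qed

subsection \<open>The cost functional\<close>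

lemma admissible_iff:
  assumes "0 \<le> s" "0 < T"
  shows "ocp_admissible f g T M s xh x u \<longleftrightarrow> u \<in> borel_measurable (lebesgue_on {s..s + T}) \<and>
     (\<forall>t\<in>{s..s + T}. \<bar>u t\<bar> \<le> M) \<and> lipschitz_solution (rhs u) s (s + T) x \<and> x s = xh"
proof -
  have "control_solution f g u {s..s + T} x \<longleftrightarrow> lipschitz_solution (rhs u) s (s + T) x"
    if b: "\<forall>t\<in>{s..s + T}. \<bar>u t\<bar> \<le> M"
  proof
    assume c: "control_solution f g u {s..s + T} x"
    then have c1: "control_solution f g u {s..<s + T} x"
      unfolding control_solution_def by (rule caratheodory_solution_subset) auto
    have c2: "continuous_on {s..s + T} x"
      using c unfolding control_solution_def by (rule caratheodory_solution_continuous_on) auto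
    show "lipschitz_solution (rhs u) s (s + T) x"
      by (rule control_lipschitz_solution_Icc[OF c1 _ c2 f_cont g_cont]) (use b assms in auto)
  qed (simp add: control_solution_def lipschitz_solution_caratheodory_Icc)
  moreover have "u \<in> Linf {s..s + T}" if "u \<in> borel_measurable (lebesgue_on {s..s + T})" "\<forall>t\<in>{s..s + T}. \<bar>u t\<bar> \<le> M"
    using that by (intro bounded_in_Linf[of _ _ M]) auto
  ultimately show ?thesis by (auto simp: ocp_admissible_def Linf_def)
qed

definition barrier :: "real \<Rightarrow> real^'n \<Rightarrow> real" where
  "barrier t z = 1 / (1 - (z $ i0 - yref t)\<^sup>2 / (\<psi>0 t)\<^sup>2) + 1 / (1 - (z $ i1 - dyref t)\<^sup>2 / (\<psi>1 t)\<^sup>2)"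

definition state_cost :: "real \<Rightarrow> real^'n \<Rightarrow> real \<Rightarrow> ereal" where
  "state_cost t z v = (if \<bar>z $ i0 - yref t\<bar> \<noteq> \<psi>0 t \<and> \<bar>z $ i1 - dyref t\<bar> \<noteq> \<psi>1 t
     then ereal (barrier t z + lu * v\<^sup>2) else \<infinity>)"

lemma in_funnel_cost:
  assumes "in_funnel t z" "t \<ge> 0"
  shows "state_cost t z v = ereal (barrier t z + lu * v\<^sup>2)" "0 \<le> barrier t z + lu * v\<^sup>2"
    "m / (2 * (\<psi>0 t - \<bar>z $ i0 - yref t\<bar>)) \<le> barrier t z + lu * v\<^sup>2"
    "m / (2 * (\<psi>1 t - \<bar>z $ i1 - dyref t\<bar>)) \<le> barrier t z + lu * v\<^sup>2" "0 \<le> barrier t z"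
proof -
  have 0: "0 \<le> lu * v\<^sup>2" using lu by simp
  note b0 = reciprocal_barrier[of "z $ i0 - yref t" "\<psi>0 t" m] and b1 = reciprocal_barrier[of "z $ i1 - dyref t" "\<psi>1 t" m]
  have i: "\<bar>z $ i0 - yref t\<bar> < \<psi>0 t" "\<bar>z $ i1 - dyref t\<bar> < \<psi>1 t" "m \<le> \<psi>0 t" "m \<le> \<psi>1 t"
    using assms bounds(1,3) by (auto simp: in_funnel_def)
  show "state_cost t z v = ereal (barrier t z + lu * v\<^sup>2)" using i by (simp add: state_cost_def)
  show "0 \<le> barrier t z + lu * v\<^sup>2" "0 \<le> barrier t z"
    "m / (2 * (\<psi>0 t - \<bar>z $ i0 - yref t\<bar>)) \<le> barrier t z + lu * v\<^sup>2"
    "m / (2 * (\<psi>1 t - \<bar>z $ i1 - dyref t\<bar>)) \<le> barrier t z + lu * v\<^sup>2"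
    using b0[OF i(1,3) m] b1[OF i(2,4) m] 0 unfolding barrier_def by linarith+
qed

lemma ocp_cost_eq:
  assumes s: "0 \<le> s" "0 < T" and adm: "ocp_admissible f g T M s xh x u"
  shows "ocp_cost h (\<psi>0, \<psi>1) yref lu T s x u = ereal_integral {s..s + T} (\<lambda>t. state_cost t (\<Phi> (x t)) (u t))"
    "lipschitz_solution (bi_rhs u) s (s + T) (\<Phi> \<circ> x)"
proof -
  have a: "u \<in> borel_measurable (lebesgue_on {s..s + T})" "\<And>t. t \<in> {s..s + T} \<Longrightarrow> \<bar>u t\<bar> \<le> M"
    "lipschitz_solution (rhs u) s (s + T) x" using adm s by (auto simp: admissible_iff)
  show sol: "lipschitz_solution (bi_rhs u) s (s + T) (\<Phi> \<circ> x)"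
    using lipschitz_solution_bi_iff[OF a(1,2) s(1)] a(3) s by simp
  have "stage_cost (\<psi>0, \<psi>1) yref lu t ((h \<circ> x) t, D1 {s..s + T} (h \<circ> x) t) (u t) = state_cost t (\<Phi> (x t)) (u t)"
    if t: "t \<in> {s..s + T}" for t
  proof -
    have "((\<lambda>t. (\<Phi> \<circ> x) t $ i0) has_vector_derivative (\<Phi> \<circ> x) t $ i1) (at t within {s..s + T})"
      by (rule bi_solution_output_deriv[OF sol t])
    moreover have "(\<lambda>t. (\<Phi> \<circ> x) t $ i0) = h \<circ> x" by (auto simp: \<Phi>_output)
    ultimately have "D1 {s..s + T} (h \<circ> x) t = \<Phi> (x t) $ i1"
      using D1_Icc[of "h \<circ> x" _ t s "s + T"] t s by simp
    then show ?thesis using t s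
      by (simp add: stage_cost_def state_cost_def barrier_def err0_def err1_def D1_yref \<Phi>_output[symmetric])
  qed
  then have "(\<integral>\<^sup>+t. e2ennreal (stage_cost (\<psi>0, \<psi>1) yref lu t ((h \<circ> x) t, D1 {s..s + T} (h \<circ> x) t) (u t)) \<partial>lebesgue_on {s..s + T})
      = (\<integral>\<^sup>+t. e2ennreal (state_cost t (\<Phi> (x t)) (u t)) \<partial>lebesgue_on {s..s + T})"
    "(\<integral>\<^sup>+t. e2ennreal (- stage_cost (\<psi>0, \<psi>1) yref lu t ((h \<circ> x) t, D1 {s..s + T} (h \<circ> x) t) (u t)) \<partial>lebesgue_on {s..s + T})
      = (\<integral>\<^sup>+t. e2ennreal (- state_cost t (\<Phi> (x t)) (u t)) \<partial>lebesgue_on {s..s + T})"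
    by (auto intro!: nn_integral_cong simp del: o_apply)
  then show "ocp_cost h (\<psi>0, \<psi>1) yref lu T s x u = ereal_integral {s..s + T} (\<lambda>t. state_cost t (\<Phi> (x t)) (u t))"
    unfolding ocp_cost_def ereal_integral_def by (simp only:)
qed

lemma finite_cost_in_funnel:
  assumes s: "0 \<le> s" "0 < T" and adm: "ocp_admissible f g T M s xh x u"
    and init: "in_funnel s (\<Phi> xh)" and fin: "ocp_cost h (\<psi>0, \<psi>1) yref lu T s x u \<noteq> \<infinity>"
    and t: "t \<in> {s..s + T}"
  shows "in_funnel t (\<Phi> (x t))"
proof (rule ccontr)
  assume nt: "\<not> ?thesis"
  let ?b = "s + T"
  define z where "z = \<Phi> \<circ> x"
  have sol: "lipschitz_solution (bi_rhs u) s ?b z" unfolding z_def by (rule ocp_cost_eq(2)[OF s adm])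
  obtain L N where L: "L \<ge> 0" "\<And>r t. r \<in> {s..?b} \<Longrightarrow> t \<in> {s..?b} \<Longrightarrow> norm (z r - z t) \<le> L * \<bar>r - t\<bar>"
    by (rule lipschitz_solutionE[OF sol]) blast
  define G where "G r = min (\<psi>0 r - \<bar>z r $ i0 - yref r\<bar>) (\<psi>1 r - \<bar>z r $ i1 - dyref r\<bar>)" for r
  define C where "C = 2 * K + L"
  have C: "C > 0" using K_pos L(1) by (simp add: C_def)
  have Gl: "\<bar>G r - G t\<bar> \<le> C * \<bar>r - t\<bar>" if rt: "r \<in> {s..?b}" "t \<in> {s..?b}" for r t
  proof -
    have "\<bar>z r $ i - z t $ i\<bar> \<le> L * \<bar>r - t\<bar>" for i
      using component_le_norm_cart[of "z r - z t" i] L(2)[OF rt] by simp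
    note Z = this[of i0] this[of i1]
    have Q: "\<bar>\<psi>0 r - \<psi>0 t\<bar> \<le> K * \<bar>r - t\<bar>" "\<bar>\<psi>1 r - \<psi>1 t\<bar> \<le> K * \<bar>r - t\<bar>"
      "\<bar>yref r - yref t\<bar> \<le> K * \<bar>r - t\<bar>" "\<bar>dyref r - dyref t\<bar> \<le> K * \<bar>r - t\<bar>"
      using \<psi>0_lip[of r t] lip(2)[of r t] yref_lip[of r t] yref_bounds(3)[of r t] rt s by auto
    have eq: "C * \<bar>r - t\<bar> = K * \<bar>r - t\<bar> + L * \<bar>r - t\<bar> + K * \<bar>r - t\<bar>" by (simp add: C_def algebra_simps)
    show ?thesis
      unfolding G_def eq
      by (rule abs_min_diff_le[OF abs_diff_abs_le[OF Q(1) Z(1) Q(3)] abs_diff_abs_le[OF Q(2) Z(2) Q(4)]])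
  qed
  have Gc: "continuous_on {s..?b} G"
    using Gl C by (intro lipschitz_on_continuous_on[of C] lipschitz_onI) (auto simp: dist_real_def)
  define S where "S = {r \<in> {s..?b}. G r \<le> 0}"
  have Sne: "t \<in> S" using nt t by (auto simp: S_def G_def in_funnel_def z_def min_def)
  have Scl: "closed S" unfolding S_def
    using continuous_closed_preimage[OF Gc, of "{..0}"] by (simp add: vimage_def Int_def)
  define \<tau> where "\<tau> = Inf S"
  have bdd: "bdd_below S" by (rule bdd_belowI[of _ s]) (auto simp: S_def)
  have \<tau>S: "\<tau> \<in> S" unfolding \<tau>_def using Sne by (intro closed_contains_Inf bdd Scl) auto
  have \<tau>: "s \<le> \<tau>" "\<tau> \<le> ?b" "G \<tau> \<le> 0" using \<tau>S by (auto simp: S_def)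
  have "x s = xh" using adm by (simp add: ocp_admissible_def)
  then have "G s > 0" using init by (auto simp: G_def in_funnel_def z_def)
  then have s\<tau>: "s < \<tau>" using \<tau> by (metis le_less not_less)
  have before: "0 < G r" "G r \<le> C * (\<tau> - r)" if r: "s \<le> r" "r < \<tau>" for r
  proof -
    have "r \<notin> S" using r cInf_lower[OF _ bdd, of r] by (auto simp: \<tau>_def)
    then show "0 < G r" using r \<tau> by (auto simp: S_def)
    show "G r \<le> C * (\<tau> - r)" using Gl[of r \<tau>] r \<tau> by auto
  qed
  have "(\<integral>\<^sup>+r. e2ennreal (state_cost r (z r) (u r)) \<partial>lebesgue_on {s..?b}) = \<infinity>"
  proof (rule nn_integral_reciprocal_infinite[OF s\<tau> \<tau>(2)])
    show "0 < m / (2 * C)" using m C by simp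
    fix r assume r: "s \<le> r" "r < \<tau>"
    have r0: "0 \<le> r" using r s by simp
    have fu: "in_funnel r (z r)" using before(1)[OF r] by (auto simp: G_def in_funnel_def)
    have "m / (2 * C) / (\<tau> - r) = m / (2 * (C * (\<tau> - r)))" by simp
    also have "\<dots> \<le> m / (2 * G r)" using before[OF r] m r C by (intro divide_left_mono) auto
    also have "\<dots> \<le> barrier r (z r) + lu * (u r)\<^sup>2"
      using in_funnel_cost(3,4)[OF fu r0, of "u r"] by (auto simp: G_def min_def)
    finally have "ereal (m / (2 * C) / (\<tau> - r)) \<le> state_cost r (z r) (u r)"
      using in_funnel_cost(1)[OF fu r0, of "u r"] by simp
    from e2ennreal_mono[OF this]
    show "ennreal (m / (2 * C) / (\<tau> - r)) \<le> e2ennreal (state_cost r (z r) (u r))" by simp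
  qed
  then have "ocp_cost h (\<psi>0, \<psi>1) yref lu T s x u = \<infinity>"
    unfolding ocp_cost_eq(1)[OF s adm] by (simp add: ereal_integral_def z_def)
  then show False using fin by simp
qed

lemma barrier_continuous_on:
  assumes "continuous_on {a..b} z" "0 \<le> a" "\<And>t. t \<in> {a..b} \<Longrightarrow> in_funnel t (z t)"
  shows "continuous_on {a..b} (\<lambda>t. barrier t (z t))"
proof -
  have sub: "{a..b} \<subseteq> {0..}" using assms(2) by auto
  have "1 - (z t $ i0 - yref t)\<^sup>2 / (\<psi>0 t)\<^sup>2 \<noteq> 0" "1 - (z t $ i1 - dyref t)\<^sup>2 / (\<psi>1 t)\<^sup>2 \<noteq> 0"
    "(\<psi>0 t)\<^sup>2 \<noteq> 0" "(\<psi>1 t)\<^sup>2 \<noteq> 0" if t: "t \<in> {a..b}" for t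
    using reciprocal_barrier(3)[of "z t $ i0 - yref t" "\<psi>0 t" m] reciprocal_barrier(3)[of "z t $ i1 - dyref t" "\<psi>1 t" m]
      assms(3)[OF t] bounds(1,3)[of t] m t assms(2) by (auto simp: in_funnel_def)
  then show ?thesis
    unfolding barrier_def
    by (intro continuous_intros assms(1) continuous_on_subset[OF yref_cont sub] continuous_on_subset[OF dyref_cont sub]
        continuous_on_subset[OF \<psi>0_cont sub] continuous_on_subset[OF \<psi>1_cont sub]) auto
qed

lemma in_funnel_ocp_cost:
  assumes s: "0 \<le> s" "0 < T" and adm: "ocp_admissible f g T M s xh x u"
    and inf: "\<And>t. t \<in> {s..s + T} \<Longrightarrow> in_funnel t (\<Phi> (x t))"
  defines "I \<equiv> \<integral>\<^sup>+t. ennreal (barrier t (\<Phi> (x t)) + lu * (u t)\<^sup>2) \<partial>lebesgue_on {s..s + T}"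
  shows "ocp_cost h (\<psi>0, \<psi>1) yref lu T s x u = enn2ereal I" "I < \<infinity>"
proof -
  have e1: "e2ennreal (state_cost t (\<Phi> (x t)) (u t)) = ennreal (barrier t (\<Phi> (x t)) + lu * (u t)\<^sup>2)"
    "e2ennreal (- state_cost t (\<Phi> (x t)) (u t)) = 0" if t: "t \<in> {s..s + T}" for t
    using in_funnel_cost(1,2)[OF inf[OF t], of "u t"] t s by (auto simp: ennreal_neg)
  have P: "(\<integral>\<^sup>+t. e2ennreal (state_cost t (\<Phi> (x t)) (u t)) \<partial>lebesgue_on {s..s + T}) = I"
    unfolding I_def using e1 by (intro nn_integral_cong) auto
  have Nn: "(\<integral>\<^sup>+t. e2ennreal (- state_cost t (\<Phi> (x t)) (u t)) \<partial>lebesgue_on {s..s + T}) = (\<integral>\<^sup>+t. 0 \<partial>lebesgue_on {s..s + T})"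
    using e1 by (intro nn_integral_cong) auto
  have "continuous_on {s..s + T} (\<lambda>t. barrier t (\<Phi> (x t)))"
    using barrier_continuous_on[of s "s + T" "\<Phi> \<circ> x"] lipschitz_solution_continuous_on[OF ocp_cost_eq(2)[OF s adm]] inf s by auto
  then obtain c where c: "c \<ge> 0" "\<And>t. t \<in> {s..s + T} \<Longrightarrow> norm (barrier t (\<Phi> (x t))) \<le> c"
    by (rule continuous_on_Icc_norm_bound) blast
  have ub: "\<bar>u t\<bar> \<le> M" if "t \<in> {s..s + T}" for t using adm that by (auto simp: ocp_admissible_def)
  have "I \<le> (\<integral>\<^sup>+t. ennreal (c + lu * M\<^sup>2) \<partial>lebesgue_on {s..s + T})"
    unfolding I_def
  proof (intro nn_integral_mono ennreal_leI add_mono)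
    fix t assume "t \<in> space (lebesgue_on {s..s + T})"
    then have t: "t \<in> {s..s + T}" by simp
    show "barrier t (\<Phi> (x t)) \<le> c" using c(2)[OF t] by simp
    have "\<bar>u t\<bar>\<^sup>2 \<le> M\<^sup>2" using ub[OF t] by (intro power_mono) auto
    then show "lu * (u t)\<^sup>2 \<le> lu * M\<^sup>2" using lu by (intro mult_left_mono) auto
  qed
  also have "\<dots> = ennreal (c + lu * M\<^sup>2) * emeasure lebesgue {s..s + T}"
    by (simp add: emeasure_restrict_space)
  also have "\<dots> < \<infinity>" using s by (simp add: ennreal_mult_less_top)
  finally show fin: "I < \<infinity>" .
  show "ocp_cost h (\<psi>0, \<psi>1) yref lu T s x u = enn2ereal I"
    unfolding ocp_cost_eq(1)[OF s adm] ereal_integral_def P Nn using fin by (simp add: zero_ennreal.rep_eq)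
qed

end

subsection \<open>Difference quotients of primitives\<close>

lemma bounded_measurable_integrable:
  fixes u :: "real \<Rightarrow> real"
  assumes "u \<in> borel_measurable (lebesgue_on {s..b})" "\<And>t. t \<in> {s..b} \<Longrightarrow> \<bar>u t\<bar> \<le> M"
    and "s \<le> c" "d \<le> b"
  shows "u integrable_on {c..d}" "(\<lambda>t. (u t)\<^sup>2) integrable_on {c..d}"
proof -
  have m2: "(\<lambda>t. (u t)\<^sup>2) \<in> borel_measurable (lebesgue_on {s..b})" using assms(1) by measurable
  have b2: "norm ((u t)\<^sup>2) \<le> M\<^sup>2" if "t \<in> {s..b}" for t
    using power_mono[OF assms(2)[OF that], of 2] by simp
  have b1: "norm (u t) \<le> M" if "t \<in> {s..b}" for t using assms(2)[OF that] by simp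
  have "(\<lambda>t. (u t)\<^sup>2) integrable_on {s..b}"
    by (rule measurable_bounded_by_integrable_imp_integrable[where g="\<lambda>_. M\<^sup>2"]; (rule m2 b2 integrable_const_ivl; assumption)?)
      simp
  moreover have "u integrable_on {s..b}"
    by (rule measurable_bounded_by_integrable_imp_integrable[where g="\<lambda>_. M"]; (rule assms(1) b1 integrable_const_ivl; assumption)?)
      simp
  ultimately show "u integrable_on {c..d}" "(\<lambda>t. (u t)\<^sup>2) integrable_on {c..d}"
    using assms(3,4) by (auto intro: integrable_on_subinterval)
qed

lemma integral_square_le:
  fixes u :: "real \<Rightarrow> real"
  assumes "u integrable_on {c..d}" "(\<lambda>t. (u t)\<^sup>2) integrable_on {c..d}" "c \<le> d"
  shows "(integral {c..d} u)\<^sup>2 \<le> (d - c) * integral {c..d} (\<lambda>t. (u t)\<^sup>2)"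
proof (cases "c = d")
  case False
  define a where "a = integral {c..d} u"
  define k where "k = a / (d - c)"
  have cd: "d - c > 0" using False assms(3) by simp
  have hi: "((\<lambda>t. (u t)\<^sup>2 - 2 * k * u t + k\<^sup>2) has_integral
      (integral {c..d} (\<lambda>t. (u t)\<^sup>2) - 2 * k * a + (d - c) *\<^sub>R k\<^sup>2)) {c..d}"
    unfolding a_def
    by (intro has_integral_add has_integral_diff has_integral_mult_right integrable_integral assms(1,2))
      (use has_integral_const_real[of "k\<^sup>2" c d] cd in simp)
  have "0 \<le> (u t)\<^sup>2 - 2 * k * u t + k\<^sup>2" for t
    using zero_le_power2[of "u t - k"] by (simp add: power2_eq_square algebra_simps)
  then have "0 \<le> integral {c..d} (\<lambda>t. (u t)\<^sup>2) - 2 * k * a + (d - c) * k\<^sup>2"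
    using has_integral_nonneg[OF hi] by simp
  then have "0 \<le> (d - c) * (integral {c..d} (\<lambda>t. (u t)\<^sup>2) - 2 * k * a + (d - c) * k\<^sup>2)"
    using cd by simp
  also have "\<dots> = (d - c) * integral {c..d} (\<lambda>t. (u t)\<^sup>2) - 2 * ((d - c) * k) * a + ((d - c) * k)\<^sup>2"
    by (simp add: power2_eq_square algebra_simps)
  also have "(d - c) * k = a" using cd by (simp add: k_def)
  finally show ?thesis by (simp add: a_def power2_eq_square)
qed simp

lemma nn_integral_lebesgue_on_eq:
  fixes f :: "real \<Rightarrow> real"
  assumes "(f has_integral I) {s..b}" "\<And>t. t \<in> {s..b} \<Longrightarrow> 0 \<le> f t"
  shows "(\<integral>\<^sup>+t. ennreal (f t) \<partial>lebesgue_on {s..b}) = ennreal I"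
proof -
  have "(\<integral>\<^sup>+t. ennreal (f t) \<partial>lebesgue_on {s..b}) = (\<integral>\<^sup>+t. ennreal (f t) * indicator {s..b} t \<partial>lebesgue)"
    by (simp add: nn_integral_restrict_space)
  also have "\<dots> = (\<integral>\<^sup>+t. ennreal (f t) * indicator {s..b} t \<partial>lborel)"
    by (rule nn_integral_completion)
  also have "\<dots> = ennreal I"
    by (rule nn_integral_has_integral_lebesgue'[OF assms(2,1)])
  finally show ?thesis .
qed

text \<open>Jensen's inequality for the averages of \<open>u\<close> over intervals of length \<open>k\<close>; the integral of the
  averages of \<open>u\<^sup>2\<close> telescopes.\<close>

lemma difference_quotient_energy:
  fixes u :: "real \<Rightarrow> real"
  assumes um: "u \<in> borel_measurable (lebesgue_on {s..b})" and ub: "\<And>t. t \<in> {s..b} \<Longrightarrow> \<bar>u t\<bar> \<le> M"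
    and k: "0 < k" and sb: "s \<le> b"
  defines "U \<equiv> \<lambda>t. integral {s..t} u"
  shows "(\<integral>\<^sup>+t. ennreal (((U (min b (t + k)) - U t) / k)\<^sup>2) \<partial>lebesgue_on {s..b})
    \<le> (\<integral>\<^sup>+t. ennreal ((u t)\<^sup>2) \<partial>lebesgue_on {s..b})"
proof -
  note int = bounded_measurable_integrable[OF um ub]
  define V where "V t = integral {s..min b t} (\<lambda>t. (u t)\<^sup>2)" for t
  have Uc: "continuous_on {s..b} U"
    unfolding U_def by (rule indefinite_integral_continuous_1[OF int(1)]) auto
  have Vc0: "continuous_on {s..b} (\<lambda>t. integral {s..t} (\<lambda>t. (u t)\<^sup>2))"
    by (rule indefinite_integral_continuous_1[OF int(2)]) auto
  have Vc: "continuous_on {s..} V"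
    unfolding V_def[abs_def] by (rule continuous_on_compose2[OF Vc0]) (use sb in \<open>auto intro!: continuous_intros\<close>)
  have Vi: "V integrable_on {x..y}" if "s \<le> x" for x y
    using that by (intro integrable_continuous_real continuous_on_subset[OF Vc]) auto
  have V0: "0 \<le> V t" for t
    unfolding V_def by (rule Henstock_Kurzweil_Integration.integral_nonneg[OF int(2)]) auto
  have pt: "((U (min b (t + k)) - U t) / k)\<^sup>2 \<le> (V (t + k) - V t) / k" if t: "t \<in> {s..b}" for t
  proof -
    let ?t' = "min b (t + k)"
    have le: "s \<le> t" "t \<le> ?t'" "?t' \<le> b" using t k by auto
    have "U ?t' - U t = integral {t..?t'} u"
      using Henstock_Kurzweil_Integration.integral_combine[of s t ?t' u] int(1)[of s ?t'] le by (simp add: U_def)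
    moreover have mt: "min b t = t" using t by simp
    have "V (t + k) - V t = integral {t..?t'} (\<lambda>t. (u t)\<^sup>2)"
      using Henstock_Kurzweil_Integration.integral_combine[of s t ?t' "\<lambda>t. (u t)\<^sup>2"] int(2)[of s ?t'] le
      unfolding V_def mt by simp
    ultimately have "(U ?t' - U t)\<^sup>2 \<le> (?t' - t) * (V (t + k) - V t)" and "0 \<le> V (t + k) - V t"
      using integral_square_le[of u t ?t'] int[of t ?t'] le
      by (auto intro!: Henstock_Kurzweil_Integration.integral_nonneg)
    then have "(U ?t' - U t)\<^sup>2 \<le> k * (V (t + k) - V t)"
      using k by (intro order_trans[OF _ mult_right_mono[of "?t' - t" k]]) auto
    then have "(U ?t' - U t)\<^sup>2 / k\<^sup>2 \<le> k * (V (t + k) - V t) / k\<^sup>2" by (intro divide_right_mono) auto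
    then show ?thesis using k by (simp add: power_divide power2_eq_square)
  qed
  have Vk: "((\<lambda>t. V (t + k)) has_integral integral {s + k..b + k} V) {s..b}"
  proof -
    have "(\<lambda>t. V (t + k)) integrable_on {s..b}"
      by (intro integrable_continuous_real continuous_on_compose2[OF Vc]) (use k in \<open>auto intro!: continuous_intros\<close>)
    moreover have "integral {s..b} (\<lambda>t. V (t + k)) = integral {s + k..b + k} V"
      using integral_shift_real_ivl[of "s + k" k "b + k" V] by simp
    ultimately show ?thesis using integrable_integral by fastforce
  qed
  define E where "E = (integral {s + k..b + k} V - integral {s..b} V) / k"
  have vi: "((\<lambda>t. (V (t + k) - V t) / k) has_integral E) {s..b}"
    unfolding E_def by (intro has_integral_divide has_integral_diff Vk integrable_integral Vi) simp
  have "E \<le> V b"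
  proof -
    have 1: "integral {s..s + k} V + integral {s + k..b + k} V = integral {s..b + k} V"
      by (rule Henstock_Kurzweil_Integration.integral_combine) (use k sb Vi in auto)
    have 2: "integral {s..b} V + integral {b..b + k} V = integral {s..b + k} V"
      by (rule Henstock_Kurzweil_Integration.integral_combine) (use k sb Vi in auto)
    have 3: "integral {b..b + k} V = integral {b..b + k} (\<lambda>_. V b)"
      by (rule Henstock_Kurzweil_Integration.integral_cong) (auto simp: V_def min_def)
    have 4: "0 \<le> integral {s..s + k} V"
      by (rule Henstock_Kurzweil_Integration.integral_nonneg[OF Vi]) (use V0 in auto)
    have "integral {s + k..b + k} V - integral {s..b} V \<le> k * V b"
      using 1 2 3 4 k by simp
    then show ?thesis using k by (simp add: E_def pos_divide_le_eq mult.commute)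
  qed
  have "(\<integral>\<^sup>+t. ennreal (((U (min b (t + k)) - U t) / k)\<^sup>2) \<partial>lebesgue_on {s..b})
     \<le> (\<integral>\<^sup>+t. ennreal ((V (t + k) - V t) / k) \<partial>lebesgue_on {s..b})"
    by (intro nn_integral_mono ennreal_leI pt) auto
  also have "\<dots> = ennreal E"
    by (rule nn_integral_lebesgue_on_eq[OF vi]) (use pt order_trans[OF zero_le_power2] in blast)
  also have "\<dots> \<le> ennreal (V b)" using \<open>E \<le> V b\<close> by (rule ennreal_leI)
  also have "\<dots> = (\<integral>\<^sup>+t. ennreal ((u t)\<^sup>2) \<partial>lebesgue_on {s..b})"
    by (rule nn_integral_lebesgue_on_eq[symmetric]) (use integrable_integral[OF int(2)[of s b]] in \<open>auto simp: V_def\<close>)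
  finally show ?thesis .
qed

subsection \<open>Compactness of trajectories\<close>

text \<open>For the control-affine dynamics the limit of trajectories is identified at the points where the
  limit \<open>U\<close> of the primitives of the controls is differentiable: up to a quadratic error the increments
  of a trajectory \<open>x\<close> at \<open>y \<approx> x t\<close> are those of the affine function of time and primitive.\<close>

lemma affine_increment_bound:
  fixes f g :: "'a::euclidean_space \<Rightarrow> 'a"
  assumes sol: "lipschitz_solution (\<lambda>t z. f z + u t *\<^sub>R g z) s b x"
    and um: "u \<in> borel_measurable (lebesgue_on {s..b})" and ub: "\<And>t. t \<in> {s..b} \<Longrightarrow> \<bar>u t\<bar> \<le> M"
    and xl: "\<And>r t. r \<in> {s..b} \<Longrightarrow> t \<in> {s..b} \<Longrightarrow> norm (x r - x t) \<le> L * \<bar>r - t\<bar>"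
    and xR: "\<And>t. t \<in> {s..b} \<Longrightarrow> x t \<in> S" and y: "y \<in> S"
    and lf: "\<And>x y. x \<in> S \<Longrightarrow> y \<in> S \<Longrightarrow> norm (f x - f y) \<le> Lf * norm (x - y)"
    and lg: "\<And>x y. x \<in> S \<Longrightarrow> y \<in> S \<Longrightarrow> norm (g x - g y) \<le> Lg * norm (x - y)"
    and nn: "0 \<le> Lf" "0 \<le> Lg" "0 \<le> L" "0 \<le> M"
    and rt: "r \<in> {s..b}" "t \<in> {s..b}"
  defines "U \<equiv> \<lambda>t. integral {s..t} u"
  shows "norm (x r - x t - (r - t) *\<^sub>R f y - (U r - U t) *\<^sub>R g y)
    \<le> (Lf + M * Lg) * (L * \<bar>r - t\<bar> + norm (x t - y)) * \<bar>r - t\<bar>"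
proof -
  note int = bounded_measurable_integrable[OF um ub]
  define C where "C = (Lf + M * Lg) * (L * \<bar>r - t\<bar> + norm (x t - y))"
  have C0: "0 \<le> C" using nn by (simp add: C_def)
  define lo hi where "lo = min r t" and "hi = max r t"
  have lh: "s \<le> lo" "lo \<le> hi" "hi \<le> b" using rt by (auto simp: lo_def hi_def)
  let ?e = "x hi - x lo - (hi - lo) *\<^sub>R f y - (U hi - U lo) *\<^sub>R g y"
  have "U hi - U lo = integral {lo..hi} u"
    using Henstock_Kurzweil_Integration.integral_combine[of s lo hi u] int(1)[of s hi] lh by (simp add: U_def)
  then have Ui: "(u has_integral (U hi - U lo)) {lo..hi}"
    using integrable_integral[OF int(1)[of lo hi]] lh by simp
  have "((\<lambda>\<sigma>. (f (x \<sigma>) + u \<sigma> *\<^sub>R g (x \<sigma>)) - f y - u \<sigma> *\<^sub>R g y) has_integral ?e) {lo..hi}"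
    using lipschitz_solution_has_integral[OF sol lh] has_integral_const_real[of "f y" lo hi] lh
    by (intro has_integral_diff has_integral_scaleR_left Ui) auto
  then have "norm ?e \<le> C * (hi - lo)"
  proof (rule has_integral_norm_bound_AE[OF _ lh(2), of _ _ "{}"])
    fix \<sigma> assume \<sigma>: "\<sigma> \<in> {lo..hi}"
    then have \<sigma>s: "\<sigma> \<in> {s..b}" using lh by auto
    have "norm (x \<sigma> - y) \<le> norm (x \<sigma> - x t) + norm (x t - y)"
      using norm_triangle_ineq[of "x \<sigma> - x t" "x t - y"] by simp
    also have "\<dots> \<le> L * \<bar>\<sigma> - t\<bar> + norm (x t - y)" using xl[OF \<sigma>s rt(2)] by simp
    also have "L * \<bar>\<sigma> - t\<bar> \<le> L * \<bar>r - t\<bar>" using \<sigma> nn by (intro mult_left_mono) (auto simp: lo_def hi_def)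
    finally have d: "norm (x \<sigma> - y) \<le> L * \<bar>r - t\<bar> + norm (x t - y)" by simp
    have "norm ((f (x \<sigma>) + u \<sigma> *\<^sub>R g (x \<sigma>)) - f y - u \<sigma> *\<^sub>R g y) = norm ((f (x \<sigma>) - f y) + u \<sigma> *\<^sub>R (g (x \<sigma>) - g y))"
      by (simp add: algebra_simps)
    also have "\<dots> \<le> norm (f (x \<sigma>) - f y) + \<bar>u \<sigma>\<bar> * norm (g (x \<sigma>) - g y)"
      by (rule order_trans[OF norm_triangle_ineq]) simp
    also have "\<dots> \<le> Lf * norm (x \<sigma> - y) + M * (Lg * norm (x \<sigma> - y))"
      using lf[OF xR[OF \<sigma>s] y] lg[OF xR[OF \<sigma>s] y] ub[OF \<sigma>s] nn by (intro add_mono mult_mono) auto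
    also have "\<dots> = (Lf + M * Lg) * norm (x \<sigma> - y)" by (simp add: algebra_simps)
    also have "\<dots> \<le> C" unfolding C_def using d nn by (intro mult_left_mono) auto
    finally show "norm ((f (x \<sigma>) + u \<sigma> *\<^sub>R g (x \<sigma>)) - f y - u \<sigma> *\<^sub>R g y) \<le> C" .
  qed (use C0 in auto)
  moreover have "norm (x r - x t - (r - t) *\<^sub>R f y - (U r - U t) *\<^sub>R g y) = norm ?e"
  proof (cases "t \<le> r")
    case False
    then have "x r - x t - (r - t) *\<^sub>R f y - (U r - U t) *\<^sub>R g y = - ?e"
      by (simp add: lo_def hi_def algebra_simps)
    then show ?thesis by (metis norm_minus_cancel)
  qed (simp add: lo_def hi_def)
  moreover have "hi - lo = \<bar>r - t\<bar>" by (auto simp: lo_def hi_def)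
  ultimately show ?thesis by (simp add: C_def)
qed

lemma quadratic_remainder_derivative:
  fixes x :: "real \<Rightarrow> 'a::real_normed_vector"
  assumes t: "t \<in> {a<..<b}"
    and r: "\<And>r. r \<in> {a<..<b} \<Longrightarrow> norm (x r - x t - (r - t) *\<^sub>R v - (U r - U t) *\<^sub>R w) \<le> C * (r - t)\<^sup>2"
    and U: "(U has_vector_derivative d) (at t)"
  shows "(x has_vector_derivative (v + d *\<^sub>R w)) (at t)"
proof -
  define E where "E r = x r - x t - (r - t) *\<^sub>R v - (U r - U t) *\<^sub>R w" for r
  have "(E has_derivative (\<lambda>h. 0)) (at t within {a<..<b})"
  proof (rule has_derivativeI_sandwich[of 1])
    show "norm (E y - E t - 0) / norm (y - t) \<le> \<bar>C\<bar> * \<bar>y - t\<bar>" if "y \<in> {a<..<b}" "y \<noteq> t" "dist y t < 1" for y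
    proof -
      have "norm (E y) \<le> C * (y - t)\<^sup>2" using r[OF that(1)] by (simp add: E_def)
      also have "\<dots> \<le> \<bar>C\<bar> * (y - t)\<^sup>2" by (intro mult_right_mono) auto
      also have "\<dots> = \<bar>C\<bar> * \<bar>y - t\<bar> * \<bar>y - t\<bar>" by (simp add: power2_eq_square)
      finally show ?thesis using that by (simp add: E_def pos_divide_le_eq)
    qed
    have "((\<lambda>y. \<bar>C\<bar> * \<bar>y - t\<bar>) \<longlongrightarrow> \<bar>C\<bar> * \<bar>t - t\<bar>) (at t within {a<..<b})" by (intro tendsto_intros)
    then show "((\<lambda>y. \<bar>C\<bar> * \<bar>y - t\<bar>) \<longlongrightarrow> 0) (at t within {a<..<b})" by simp
  qed auto
  then have E: "(E has_vector_derivative 0) (at t)"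
    using t at_within_open[of t "{a<..<b}"] by (simp add: has_vector_derivative_def)
  have "((\<lambda>r. (x t + E r + (r - t) *\<^sub>R v) + (U r - U t) *\<^sub>R w) has_vector_derivative ((0 + 0 + 1 *\<^sub>R v) + d *\<^sub>R w)) (at t)"
    using U by (intro has_vector_derivative_add E has_vector_derivative_const
      bounded_linear.has_vector_derivative[OF bounded_linear_scaleR_left])
      (auto intro!: derivative_eq_intros)
  then show ?thesis by (simp add: E_def)
qed

context fmpc
begin

definition ext_barrier :: "real \<Rightarrow> real^'n \<Rightarrow> ennreal" where
  "ext_barrier t z = (if \<bar>z $ i0 - yref t\<bar> \<noteq> \<psi>0 t \<and> \<bar>z $ i1 - dyref t\<bar> \<noteq> \<psi>1 t then ennreal (barrier t z) else \<infinity>)"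

lemma barrier_tendsto:
  assumes t: "t \<ge> 0" and inf: "\<And>n. in_funnel t (z n)" and lim: "z \<longlonglongrightarrow> z'"
  shows "(\<lambda>n. ennreal (barrier t (z n))) \<longlonglongrightarrow> ext_barrier t z'"
    "\<bar>z' $ i0 - yref t\<bar> \<le> \<psi>0 t" "\<bar>z' $ i1 - dyref t\<bar> \<le> \<psi>1 t"
proof -
  have l: "(\<lambda>n. \<bar>z n $ i0 - yref t\<bar>) \<longlonglongrightarrow> \<bar>z' $ i0 - yref t\<bar>" "(\<lambda>n. \<bar>z n $ i1 - dyref t\<bar>) \<longlonglongrightarrow> \<bar>z' $ i1 - dyref t\<bar>"
    by (intro tendsto_intros lim)+
  show le: "\<bar>z' $ i0 - yref t\<bar> \<le> \<psi>0 t" "\<bar>z' $ i1 - dyref t\<bar> \<le> \<psi>1 t"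
  proof -
    have "\<bar>z n $ i0 - yref t\<bar> \<le> \<psi>0 t" "\<bar>z n $ i1 - dyref t\<bar> \<le> \<psi>1 t" for n
      using inf[of n] by (auto simp: in_funnel_def)
    then show "\<bar>z' $ i0 - yref t\<bar> \<le> \<psi>0 t" "\<bar>z' $ i1 - dyref t\<bar> \<le> \<psi>1 t"
      using LIMSEQ_le_const2[OF l(1)] LIMSEQ_le_const2[OF l(2)] by blast+
  qed
  have top: "(\<lambda>n. ennreal (barrier t (z n))) \<longlonglongrightarrow> \<infinity>"
    if d: "d \<longlonglongrightarrow> 0" "\<And>n. 0 < d n" "\<And>n. m / (2 * d n) \<le> barrier t (z n)" for d
  proof -
    have "filterlim (\<lambda>n. m / (2 * d n)) at_top sequentially"
    proof (rule LIM_at_top_divide[OF tendsto_const m])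
      have "(\<lambda>n. 2 * d n) \<longlonglongrightarrow> 2 * 0" by (intro tendsto_intros d)
      then show "(\<lambda>n. 2 * d n) \<longlonglongrightarrow> 0" by simp
    qed (use d in auto)
    then have "filterlim (\<lambda>n. barrier t (z n)) at_top sequentially"
      by (rule filterlim_at_top_mono) (use d in auto)
    then show ?thesis by (simp add: ennreal_tendsto_top_eq_at_top)
  qed
  have b3: "m / (2 * (\<psi>0 t - \<bar>z n $ i0 - yref t\<bar>)) \<le> barrier t (z n)"
    "m / (2 * (\<psi>1 t - \<bar>z n $ i1 - dyref t\<bar>)) \<le> barrier t (z n)" for n
    using in_funnel_cost(3,4)[OF inf t, of n 0] by auto
  consider "\<bar>z' $ i0 - yref t\<bar> = \<psi>0 t" | "\<bar>z' $ i1 - dyref t\<bar> = \<psi>1 t" | "in_funnel t z'"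
    using le unfolding in_funnel_def le_less by blast
  then show "(\<lambda>n. ennreal (barrier t (z n))) \<longlonglongrightarrow> ext_barrier t z'"
  proof cases
    case 1
    have "(\<lambda>n. \<psi>0 t - \<bar>z n $ i0 - yref t\<bar>) \<longlonglongrightarrow> \<psi>0 t - \<bar>z' $ i0 - yref t\<bar>" by (intro tendsto_intros l)
    then show ?thesis using top[OF _ _ b3(1)] 1 inf by (simp add: ext_barrier_def in_funnel_def)
  next
    case 2
    have "(\<lambda>n. \<psi>1 t - \<bar>z n $ i1 - dyref t\<bar>) \<longlonglongrightarrow> \<psi>1 t - \<bar>z' $ i1 - dyref t\<bar>" by (intro tendsto_intros l)
    then show ?thesis using top[OF _ _ b3(2)] 2 inf by (simp add: ext_barrier_def in_funnel_def)
  next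
    case 3
    have "1 - (z' $ i0 - yref t)\<^sup>2 / (\<psi>0 t)\<^sup>2 \<noteq> 0" "1 - (z' $ i1 - dyref t)\<^sup>2 / (\<psi>1 t)\<^sup>2 \<noteq> 0"
      using reciprocal_barrier(3)[of "z' $ i0 - yref t" "\<psi>0 t" m] reciprocal_barrier(3)[of "z' $ i1 - dyref t" "\<psi>1 t" m]
        3 bounds(1,3)[OF t] m by (auto simp: in_funnel_def)
    moreover have "\<psi>0 t \<noteq> 0" "\<psi>1 t \<noteq> 0" using bounds(1,3)[OF t] m by auto
    ultimately have "(\<lambda>n. barrier t (z n)) \<longlonglongrightarrow> barrier t z'"
      unfolding barrier_def by (intro tendsto_intros lim) auto
    then show ?thesis using 3 by (auto simp: ext_barrier_def in_funnel_def)
  qed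
qed

lemma state_cost_ext:
  assumes "t \<ge> 0" "\<bar>z $ i0 - yref t\<bar> \<le> \<psi>0 t" "\<bar>z $ i1 - dyref t\<bar> \<le> \<psi>1 t"
  shows "e2ennreal (state_cost t z v) = ext_barrier t z + ennreal (lu * v\<^sup>2)"
proof (cases "in_funnel t z")
  case True
  have "0 \<le> lu * v\<^sup>2" using lu by simp
  then show ?thesis
    using True in_funnel_cost(1,5)[OF True assms(1)]
    by (auto simp: ext_barrier_def in_funnel_def ennreal_plus)
next
  case False
  then show ?thesis using assms by (auto simp: state_cost_def ext_barrier_def in_funnel_def)
qed

subsection \<open>Existence of optimal controls\<close>

lemma reach_in_funnel: "t0 \<le> t \<Longrightarrow> reach t z \<Longrightarrow> in_funnel t z"
  unfolding reach_def path_def by (auto dest!: bspec[of _ _ t])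

lemma ocp_solution_exists:
  assumes s: "t0 \<le> s" and T: "0 < T" and M: "0 < M" and reach: "reach s (\<Phi> xh)"
    and feas: "ocp_admissible f g T M s xh xf uf" "\<And>t. t \<in> {s..s + T} \<Longrightarrow> in_funnel t (\<Phi> (xf t))"
  shows "\<exists>u. ocp_solution f g h (\<psi>0, \<psi>1) yref lu T M s xh u"
proof -
  define b where "b = s + T"
  have s0: "0 \<le> s" and sb: "s < b" using s t0 T by (auto simp: b_def)
  define adm where "adm x u \<longleftrightarrow> ocp_admissible f g T M s xh x u \<and> (\<forall>t\<in>{s..b}. in_funnel t (\<Phi> (x t)))" for x u
  define cost where "cost x u = (\<integral>\<^sup>+t. ennreal (barrier t (\<Phi> (x t)) + lu * (u t)\<^sup>2) \<partial>lebesgue_on {s..b})" for x u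
  have admD: "u \<in> borel_measurable (lebesgue_on {s..b})" "\<And>t. t \<in> {s..b} \<Longrightarrow> \<bar>u t\<bar> \<le> M"
    "lipschitz_solution (rhs u) s b x" "x s = xh" "\<And>t. t \<in> {s..b} \<Longrightarrow> in_funnel t (\<Phi> (x t))"
    "lipschitz_solution (bi_rhs u) s b (\<Phi> \<circ> x)" if "adm x u" for x u
    using that ocp_cost_eq(2)[OF s0 T, of M xh x u] unfolding adm_def admissible_iff[OF s0 T] b_def by auto
  have adm_cost: "ocp_cost h (\<psi>0, \<psi>1) yref lu T s x u = enn2ereal (cost x u)" "cost x u < \<infinity>" if "adm x u" for x u
    using in_funnel_ocp_cost[OF s0 T, of M xh x u] that unfolding adm_def cost_def b_def by auto
  define cs where "cs = (INF xu\<in>{xu. adm (fst xu) (snd xu)}. cost (fst xu) (snd xu))"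
  have cs_le: "cs \<le> cost x u" if "adm x u" for x u
    unfolding cs_def by (rule INF_lower2[of "(x, u)"]) (use that in auto)
  have "adm xf uf" using feas by (auto simp: adm_def b_def)
  then have cs_fin: "cs < \<infinity>" using cs_le adm_cost(2) by (meson order_le_less_trans)
  have "\<exists>xu. adm (fst xu) (snd xu) \<and> cost (fst xu) (snd xu) < cs + ennreal (1 / real (Suc n))" for n
  proof -
    obtain r where r: "cs = ennreal r" "0 \<le> r" using cs_fin by (metis ennreal_cases infinity_ennreal_def less_irrefl)
    have "cs < cs + ennreal (1 / real (Suc n))"
      unfolding r using r(2) by (subst ennreal_plus[symmetric]) (auto intro!: ennreal_lessI)
    then show ?thesis unfolding cs_def INF_less_iff by auto
  qed
  then obtain XU where XU: "\<And>n. adm (fst (XU n)) (snd (XU n))" "\<And>n. cost (fst (XU n)) (snd (XU n)) < cs + ennreal (1 / real (Suc n))"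
    using choice[of "\<lambda>n xu. adm (fst xu) (snd xu) \<and> cost (fst xu) (snd xu) < cs + ennreal (1 / real (Suc n))"] by blast
  define X where "X n = fst (XU n)" for n
  define u where "u n = snd (XU n)" for n
  have ad: "adm (X n) (u n)" and cn: "cost (X n) (u n) < cs + ennreal (1 / real (Suc n))" for n
    using XU by (auto simp: X_def u_def)
  note um = admD(1)[OF ad] and ub = admD(2)[OF ad] and sol = admD(3)[OF ad] and X0 = admD(4)[OF ad]
    and inf = admD(5)[OF ad] and bsol = admD(6)[OF ad]
  obtain R where R: "R > 0" "\<And>b z t. \<lbrakk>path t0 b z; z t0 \<in> B; t \<in> {t0..b}\<rbrakk> \<Longrightarrow> norm (z t) \<le> R"
    by (rule path_bounded) blast
  have \<Phi>R: "norm (\<Phi> (X n t)) \<le> R" if t: "t \<in> {s..b}" for n t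
  proof -
    have p: "path s b (\<Phi> \<circ> X n)" using inf by (intro bi_solution_path[OF bsol]) auto
    obtain w where w: "path t0 b w" "w t0 \<in> B" "\<And>t. t \<in> {s..b} \<Longrightarrow> w t = (\<Phi> \<circ> X n) t"
      by (rule reach_extend[OF reach p _ s less_imp_le[OF sb]]) (use X0 in auto)
    show ?thesis using R(2)[OF w(1,2), of t] w(3)[OF t] t s by auto
  qed
  have "bounded (inv \<Phi> ` cball 0 R)"
    by (intro compact_imp_bounded compact_continuous_image continuous_on_subset[OF \<Phi>(3)]) auto
  then obtain R' where R': "R' > 0" "\<forall>x\<in>inv \<Phi> ` cball 0 R. norm x \<le> R'" unfolding bounded_pos by blast
  have XR: "X n t \<in> cball 0 R'" if "t \<in> {s..b}" for n t
  proof -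
    have "inv \<Phi> (\<Phi> (X n t)) \<in> inv \<Phi> ` cball 0 R" using \<Phi>R[OF that] by (intro imageI) simp
    then show ?thesis using R'(2) by auto
  qed
  have "bounded (f ` cball 0 R')" "bounded (g ` cball 0 R')"
    using f_cont g_cont by (auto intro!: compact_imp_bounded compact_continuous_image elim: continuous_on_subset)
  then obtain cf cg where c: "cf > 0" "\<forall>y\<in>f ` cball 0 R'. norm y \<le> cf" "cg > 0" "\<forall>y\<in>g ` cball 0 R'. norm y \<le> cg"
    unfolding bounded_pos by blast
  define L where "L = cf + M * cg"
  have L0: "0 < L" using c M by (simp add: L_def add_pos_pos)
  have Xl: "norm (X n r - X n t) \<le> L * \<bar>r - t\<bar>" if "r \<in> {s..b}" "t \<in> {s..b}" for n r t
  proof (rule caratheodory_solution_lipschitz[OF lipschitz_solution_caratheodory_Icc[OF sol] _ order_refl _ _ that])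
    fix t assume t: "t \<in> {s..b}"
    have "norm (f (X n t)) \<le> cf" "norm (g (X n t)) \<le> cg" using c XR[OF t] by auto
    moreover from this have "\<bar>u n t\<bar> * norm (g (X n t)) \<le> M * cg" using ub[OF t] M by (intro mult_mono) auto
    ultimately show "norm (f (X n t) + u n t *\<^sub>R g (X n t)) \<le> L"
      using norm_triangle_ineq[of "f (X n t)" "u n t *\<^sub>R g (X n t)"] by (simp add: L_def)
  qed (use L0 in auto)
  obtain Lf where Lf: "Lf \<ge> 0" "\<And>x y. x \<in> cball 0 R' \<Longrightarrow> y \<in> cball 0 R' \<Longrightarrow> norm (f x - f y) \<le> Lf * norm (x - y)"
    by (rule C_k_1_locally_lipschitz[OF f]) blast
  obtain Lg where Lg: "Lg \<ge> 0" "\<And>x y. x \<in> cball 0 R' \<Longrightarrow> y \<in> cball 0 R' \<Longrightarrow> norm (g x - g y) \<le> Lg * norm (x - y)"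
    by (rule C_k_1_locally_lipschitz[OF g]) blast
  define UU where "UU n t = integral {s..t} (u n)" for n t
  note uint = bounded_measurable_integrable(1)[OF um ub]
  have UUl: "\<bar>UU n r - UU n t\<bar> \<le> M * \<bar>r - t\<bar>" if "r \<in> {s..b}" "t \<in> {s..b}" for n r t
  proof -
    have *: "\<bar>UU n t - UU n r\<bar> \<le> M * (t - r)" if rt: "s \<le> r" "r \<le> t" "t \<le> b" for r t
    proof -
      have "UU n t - UU n r = integral {r..t} (u n)"
        using Henstock_Kurzweil_Integration.integral_combine[of s r t "u n"] uint[where c=s and d=t] rt by (simp add: UU_def)
      moreover have "norm (integral {r..t} (u n)) \<le> M * (t - r)"
        by (rule has_integral_norm_bound_AE[OF integrable_integral, of _ _ _ "{}"]) (use uint[where c=r and d=t] rt ub M in auto)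
      ultimately show ?thesis by simp
    qed
    show ?thesis using *[of r t] *[of t r] that by (cases "r \<le> t") (auto simp: abs_minus_commute)
  qed
  define F where "F n t = (X n t, UU n t)" for n t
  have Fl: "norm (F n r - F n t) \<le> (L + M) * \<bar>r - t\<bar>" if "r \<in> {s..b}" "t \<in> {s..b}" for n r t
    using norm_Pair_le[of "X n r - X n t" "UU n r - UU n t"] Xl[OF that, of n] UUl[OF that, of n]
    by (simp add: F_def algebra_simps)
  obtain G k where G: "strict_mono (k :: nat \<Rightarrow> nat)"
     "\<And>e. 0 < e \<Longrightarrow> \<exists>N. \<forall>n x. n \<ge> N \<and> x \<in> {s..b} \<longrightarrow> norm (F (k n) x - G x) < e"
  proof (rule Arzela_Ascoli[of "{s..b}" F "R' + M * T"])
    show "norm (F n t) \<le> R' + M * T" if t: "t \<in> {s..b}" for n t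
    proof -
      have "\<bar>UU n t\<bar> \<le> M * \<bar>t - s\<bar>" using UUl[of t s n] t sb by (simp add: UU_def)
      also have "\<dots> \<le> M * T" using t M by (intro mult_left_mono) (auto simp: b_def)
      finally show ?thesis using norm_Pair_le[of "X n t" "UU n t"] XR[OF t, of n] by (simp add: F_def)
    qed
    show "\<exists>d>0. \<forall>n y. y \<in> {s..b} \<and> norm (x - y) < d \<longrightarrow> norm (F n x - F n y) < e" if "x \<in> {s..b}" "0 < e" for x e
    proof (intro exI[of _ "e / (L + M)"] conjI allI impI)
      show "0 < e / (L + M)" using that L0 M by simp
      fix n y assume y: "y \<in> {s..b} \<and> norm (x - y) < e / (L + M)"
      then have "(L + M) * \<bar>x - y\<bar> < e" using L0 M by (simp add: pos_less_divide_eq mult.commute)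
      then show "norm (F n x - F n y) < e" using Fl[OF that(1), of y n] y by linarith
    qed
  qed auto
  define x where "x t = fst (G t)" for t
  define V where "V t = snd (G t)" for t
  have lim: "(\<lambda>n. F (k n) t) \<longlonglongrightarrow> G t" if t: "t \<in> {s..b}" for t
    by (rule LIMSEQ_I) (use G(2) t in blast)
  have Xlim: "(\<lambda>n. X (k n) t) \<longlonglongrightarrow> x t" and Ulim: "(\<lambda>n. UU (k n) t) \<longlonglongrightarrow> V t" if t: "t \<in> {s..b}" for t
    using tendsto_fst[OF lim[OF t]] tendsto_snd[OF lim[OF t]] by (auto simp: F_def x_def V_def)
  have xl: "norm (x r - x t) \<le> L * \<bar>r - t\<bar>" if rt: "r \<in> {s..b}" "t \<in> {s..b}" for r t
  proof (rule LIMSEQ_le_const2)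
    show "(\<lambda>n. norm (X (k n) r - X (k n) t)) \<longlonglongrightarrow> norm (x r - x t)" by (intro tendsto_intros Xlim rt)
  qed (use Xl[OF rt] in auto)
  have Vl: "\<bar>V r - V t\<bar> \<le> M * \<bar>r - t\<bar>" if rt: "r \<in> {s..b}" "t \<in> {s..b}" for r t
  proof (rule LIMSEQ_le_const2)
    show "(\<lambda>n. \<bar>UU (k n) r - UU (k n) t\<bar>) \<longlonglongrightarrow> \<bar>V r - V t\<bar>" by (intro tendsto_intros Ulim rt)
  qed (use UUl[OF rt] in auto)
  have xR: "x t \<in> cball 0 R'" if t: "t \<in> {s..b}" for t
  proof -
    have "norm (x t) \<le> R'"
      by (rule LIMSEQ_le_const2[OF tendsto_norm[OF Xlim[OF t]]]) (use XR[OF t] in auto)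
    then show ?thesis by simp
  qed
  define W where "W r = V (max s (min b r))" for r
  have Wl: "\<bar>W r - W t\<bar> \<le> M * \<bar>r - t\<bar>" for r t
  proof -
    have "\<bar>W r - W t\<bar> \<le> M * \<bar>max s (min b r) - max s (min b t)\<bar>"
      unfolding W_def using sb by (intro Vl) auto
    also have "\<dots> \<le> M * \<bar>r - t\<bar>" using M by (intro mult_left_mono) auto
    finally show ?thesis .
  qed
  have WV: "W r = V r" if "r \<in> {s..b}" for r using that by (simp add: W_def)
  obtain v N where v: "v \<in> borel_measurable borel" "\<And>t. \<bar>v t\<bar> \<le> M" "negligible N"
    "\<And>t. t \<notin> N \<Longrightarrow> (W has_vector_derivative v t) (at t)"
    by (rule lipschitz_AE_has_vector_derivative[OF Wl]) (rule that; assumption)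
  have vm: "v \<in> borel_measurable (lebesgue_on {s..b})"
  proof -
    have "v \<in> borel_measurable lborel" using v(1) by simp
    then show ?thesis by (intro measurable_restrict_space1 measurable_completion)
  qed
  have xsol: "lipschitz_solution (rhs v) s b x"
  proof (rule lipschitz_solutionI[OF xl v(3)])
    fix t assume t: "t \<in> {s<..<b}" "t \<notin> N"
    then have ts: "t \<in> {s..b}" by auto
    have "norm (x r - x t - (r - t) *\<^sub>R f (x t) - (W r - W t) *\<^sub>R g (x t)) \<le> ((Lf + M * Lg) * L) * (r - t)\<^sup>2"
      if r: "r \<in> {s<..<b}" for r
    proof -
      have rs: "r \<in> {s..b}" using r by auto
      have "norm (x r - x t - (r - t) *\<^sub>R f (x t) - (V r - V t) *\<^sub>R g (x t))
        \<le> (Lf + M * Lg) * (L * \<bar>r - t\<bar> + norm (x t - x t)) * \<bar>r - t\<bar>"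
      proof (rule LIMSEQ_le)
        show "(\<lambda>n. norm (X (k n) r - X (k n) t - (r - t) *\<^sub>R f (x t) - (UU (k n) r - UU (k n) t) *\<^sub>R g (x t)))
          \<longlonglongrightarrow> norm (x r - x t - (r - t) *\<^sub>R f (x t) - (V r - V t) *\<^sub>R g (x t))"
          by (intro tendsto_intros Xlim Ulim ts rs)
        show "(\<lambda>n. (Lf + M * Lg) * (L * \<bar>r - t\<bar> + norm (X (k n) t - x t)) * \<bar>r - t\<bar>)
          \<longlonglongrightarrow> (Lf + M * Lg) * (L * \<bar>r - t\<bar> + norm (x t - x t)) * \<bar>r - t\<bar>"
          by (intro tendsto_intros Xlim ts)
        show "\<exists>N. \<forall>n\<ge>N. norm (X (k n) r - X (k n) t - (r - t) *\<^sub>R f (x t) - (UU (k n) r - UU (k n) t) *\<^sub>R g (x t))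
          \<le> (Lf + M * Lg) * (L * \<bar>r - t\<bar> + norm (X (k n) t - x t)) * \<bar>r - t\<bar>"
          unfolding UU_def
          by (intro exI[of _ 0] allI impI
              affine_increment_bound[OF sol um ub Xl XR xR[OF ts] Lf(2) Lg(2) Lf(1) Lg(1) less_imp_le[OF L0] less_imp_le[OF M] rs ts])
      qed
      then show ?thesis using WV[OF rs] WV[OF ts] by (simp add: power2_eq_square algebra_simps)
    qed
    from quadratic_remainder_derivative[OF t(1) this v(4)[OF t(2)]]
    show "(x has_vector_derivative f (x t) + v t *\<^sub>R g (x t)) (at t)" .
  qed
  have x0: "x s = xh"
    using LIMSEQ_unique[OF Xlim[of s]] X0 sb by simp
  have xadm: "ocp_admissible f g T M s xh x v"
    unfolding admissible_iff[OF s0 T] using vm v(2) xsol x0 by (auto simp: b_def)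
  text \<open>Lower semicontinuity of the cost: Fatou's lemma along the subsequence, with the controls replaced by
    difference quotients of their primitives, and again as the step of the difference quotients vanishes.\<close>
  define hj where "hj j = T / real (Suc j)" for j
  have hj: "hj j > 0" for j using T by (simp add: hj_def)
  define D where "D n j t = (UU n (min b (t + hj j)) - UU n t) / hj j" for n j t
  define a where "a n j t = ennreal (barrier t (\<Phi> (X n t))) + ennreal (lu * (D n j t)\<^sup>2)" for n j t
  have bc: "continuous_on {s..b} (\<lambda>t. barrier t (\<Phi> (X n t)))" for n
    using barrier_continuous_on[of s b "\<Phi> \<circ> X n"] lipschitz_solution_continuous_on[OF bsol] inf s0 by auto
  have UUc: "continuous_on {s..b} (UU n)" for n
    using UUl M by (intro lipschitz_on_continuous_on[of M] lipschitz_onI) (auto simp: dist_real_def)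
  have Dc: "continuous_on {s..b} (D n j)" for n j
    unfolding D_def using hj[of j]
    by (intro continuous_intros UUc continuous_on_compose2[OF UUc]) auto
  have bm: "(\<lambda>t. barrier t (\<Phi> (X n t))) \<in> borel_measurable (lebesgue_on {s..b})" for n
    by (rule continuous_imp_measurable_on_sets_lebesgue[OF bc]) simp
  have Dm: "D n j \<in> borel_measurable (lebesgue_on {s..b})" for n j
    by (rule continuous_imp_measurable_on_sets_lebesgue[OF Dc]) simp
  have am: "a n j \<in> borel_measurable (lebesgue_on {s..b})" for n j
    unfolding a_def using bm Dm by measurable
  have lu_mult: "(\<integral>\<^sup>+t. ennreal (lu * (w t)\<^sup>2) \<partial>lebesgue_on {s..b}) = ennreal lu * (\<integral>\<^sup>+t. ennreal ((w t)\<^sup>2) \<partial>lebesgue_on {s..b})"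
    if "w \<in> borel_measurable (lebesgue_on {s..b})" for w
    using that lu by (subst nn_integral_cmult[symmetric]) (auto simp: ennreal_mult)
  have ai: "(\<integral>\<^sup>+t. a n j t \<partial>lebesgue_on {s..b}) \<le> cost (X n) (u n)" for n j
  proof -
    have "(\<integral>\<^sup>+t. a n j t \<partial>lebesgue_on {s..b}) = (\<integral>\<^sup>+t. ennreal (barrier t (\<Phi> (X n t))) \<partial>lebesgue_on {s..b})
      + (\<integral>\<^sup>+t. ennreal (lu * (D n j t)\<^sup>2) \<partial>lebesgue_on {s..b})"
      unfolding a_def using bm Dm by (intro nn_integral_add) auto
    also have "(\<integral>\<^sup>+t. ennreal (lu * (D n j t)\<^sup>2) \<partial>lebesgue_on {s..b})
        \<le> (\<integral>\<^sup>+t. ennreal (lu * (u n t)\<^sup>2) \<partial>lebesgue_on {s..b})"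
      unfolding lu_mult[OF Dm] lu_mult[OF um]
      using difference_quotient_energy[OF um ub hj less_imp_le[OF sb], of j n]
      by (intro mult_left_mono) (auto simp: D_def UU_def)
    also have "(\<integral>\<^sup>+t. ennreal (barrier t (\<Phi> (X n t))) \<partial>lebesgue_on {s..b}) + (\<integral>\<^sup>+t. ennreal (lu * (u n t)\<^sup>2) \<partial>lebesgue_on {s..b})
      = (\<integral>\<^sup>+t. ennreal (barrier t (\<Phi> (X n t))) + ennreal (lu * (u n t)\<^sup>2) \<partial>lebesgue_on {s..b})"
      using bm um by (intro nn_integral_add[symmetric]) auto
    also have "\<dots> = cost (X n) (u n)"
      unfolding cost_def
      using in_funnel_cost(5)[OF inf] lu s0 by (intro nn_integral_cong) (auto simp: ennreal_plus)
    finally show ?thesis by (simp add: add_left_mono)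
  qed
  have cl: "liminf (\<lambda>n. cost (X (k n)) (u (k n))) \<le> cs"
  proof -
    have "(\<lambda>n. 1 / real (Suc (k n))) \<longlonglongrightarrow> 0"
      using LIMSEQ_subseq_LIMSEQ[OF lim_inverse_n'[THEN LIMSEQ_Suc] G(1)] by (simp add: o_def inverse_eq_divide)
    then have "(\<lambda>n. ennreal (1 / real (Suc (k n)))) \<longlonglongrightarrow> ennreal 0" by (rule tendsto_ennrealI)
    then have "(\<lambda>n. cs + ennreal (1 / real (Suc (k n)))) \<longlonglongrightarrow> cs + ennreal 0" by (rule tendsto_add[OF tendsto_const])
    then have "liminf (\<lambda>n. cs + ennreal (1 / real (Suc (k n)))) = cs" by (simp add: lim_imp_Liminf)
    moreover have "liminf (\<lambda>n. cost (X (k n)) (u (k n))) \<le> liminf (\<lambda>n. cs + ennreal (1 / real (Suc (k n))))"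
      by (intro Liminf_mono always_eventually allI less_imp_le cn)
    ultimately show ?thesis by simp
  qed
  define a' where "a' j t = liminf (\<lambda>n. a (k n) j t)" for j t
  have a'm: "a' j \<in> borel_measurable (lebesgue_on {s..b})" for j unfolding a'_def using am by measurable
  have a'i: "(\<integral>\<^sup>+t. a' j t \<partial>lebesgue_on {s..b}) \<le> cs" for j
  proof -
    have "(\<integral>\<^sup>+t. a' j t \<partial>lebesgue_on {s..b}) \<le> liminf (\<lambda>n. \<integral>\<^sup>+t. a (k n) j t \<partial>lebesgue_on {s..b})"
      unfolding a'_def by (rule nn_integral_liminf[OF am])
    also have "\<dots> \<le> liminf (\<lambda>n. cost (X (k n)) (u (k n)))"
      by (intro Liminf_mono always_eventually allI ai)
    finally show ?thesis using cl by simp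
  qed
  have zlim: "(\<lambda>n. \<Phi> (X (k n) t)) \<longlonglongrightarrow> \<Phi> (x t)" if "t \<in> {s..b}" for t
    using continuous_on_tendsto_compose[OF \<Phi>(2) Xlim[OF that]] by simp
  have bl: "(\<lambda>n. ennreal (barrier t (\<Phi> (X (k n) t)))) \<longlonglongrightarrow> ext_barrier t (\<Phi> (x t))"
      "\<bar>\<Phi> (x t) $ i0 - yref t\<bar> \<le> \<psi>0 t" "\<bar>\<Phi> (x t) $ i1 - dyref t\<bar> \<le> \<psi>1 t" if t: "t \<in> {s..b}" for t
    using barrier_tendsto[of t "\<lambda>n. \<Phi> (X (k n) t)", OF _ _ zlim[OF t]] inf[OF t] t s0 by auto
  have a'eq: "a' j t = ext_barrier t (\<Phi> (x t)) + ennreal (lu * ((V (min b (t + hj j)) - V t) / hj j)\<^sup>2)"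
    if t: "t \<in> {s..b}" for j t
  proof -
    have t2: "min b (t + hj j) \<in> {s..b}" using t hj[of j] by auto
    have "(\<lambda>n. a (k n) j t) \<longlonglongrightarrow> ext_barrier t (\<Phi> (x t)) + ennreal (lu * ((V (min b (t + hj j)) - V t) / hj j)\<^sup>2)"
      unfolding a_def D_def
      by (intro tendsto_add bl t tendsto_ennrealI tendsto_intros Ulim t2) (use hj[of j] in auto)
    then show ?thesis unfolding a'_def by (simp add: lim_imp_Liminf)
  qed
  have hj0: "hj \<longlonglongrightarrow> 0"
    using tendsto_mult[OF tendsto_const lim_inverse_n'[THEN LIMSEQ_Suc], of T]
    by (simp add: hj_def[abs_def] divide_inverse)
  have lim2: "liminf (\<lambda>j. a' j t) = ext_barrier t (\<Phi> (x t)) + ennreal (lu * (v t)\<^sup>2)" if t: "t \<in> {s<..<b}" "t \<notin> N" for t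
  proof -
    have ts: "t \<in> {s..b}" using t by auto
    have "((\<lambda>h. (W (t + h) - W t) / h) \<longlongrightarrow> v t) (at 0)"
      using v(4)[OF t(2)] by (simp add: DERIV_def has_real_derivative_iff_has_vector_derivative[symmetric])
    moreover have "filterlim hj (at 0) sequentially"
      using hj0 hj by (auto simp: filterlim_at intro!: always_eventually less_imp_neq[symmetric])
    ultimately have l: "(\<lambda>j. (W (t + hj j) - W t) / hj j) \<longlonglongrightarrow> v t" by (rule filterlim_compose)
    have "\<forall>\<^sub>F j in sequentially. hj j < b - t" using order_tendstoD(2)[OF hj0] t by simp
    then have "\<forall>\<^sub>F j in sequentially. (W (t + hj j) - W t) / hj j = (V (min b (t + hj j)) - V t) / hj j"
    proof eventually_elim
      case (elim j)
      then show ?case using WV[OF ts] WV[of "t + hj j"] hj[of j] t by simp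
    qed
    then have "(\<lambda>j. (V (min b (t + hj j)) - V t) / hj j) \<longlonglongrightarrow> v t"
      using l by (rule Lim_transform_eventually[rotated])
    then have "(\<lambda>j. a' j t) \<longlonglongrightarrow> ext_barrier t (\<Phi> (x t)) + ennreal (lu * (v t)\<^sup>2)"
      unfolding a'eq[OF ts] by (intro tendsto_add tendsto_const tendsto_ennrealI tendsto_intros)
    then show ?thesis by (simp add: lim_imp_Liminf)
  qed
  have P: "(\<integral>\<^sup>+t. e2ennreal (state_cost t (\<Phi> (x t)) (v t)) \<partial>lebesgue_on {s..b}) \<le> cs"
  proof -
    have "AE t in lebesgue_on {s..b}. e2ennreal (state_cost t (\<Phi> (x t)) (v t)) = liminf (\<lambda>j. a' j t)"
    proof (rule AE_lebesgue_on_negligibleI)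
      show "negligible (N \<union> {s, b})" using v(3) by (intro negligible_Un) auto
      fix t assume t: "t \<in> {s..b}" "t \<notin> N \<union> {s, b}"
      then show "e2ennreal (state_cost t (\<Phi> (x t)) (v t)) = liminf (\<lambda>j. a' j t)"
        using lim2[of t] state_cost_ext[OF _ bl(2,3)[OF t(1)], of "v t"] s0 by auto
    qed simp
    then have "(\<integral>\<^sup>+t. e2ennreal (state_cost t (\<Phi> (x t)) (v t)) \<partial>lebesgue_on {s..b})
      = (\<integral>\<^sup>+t. liminf (\<lambda>j. a' j t) \<partial>lebesgue_on {s..b})" by (rule nn_integral_cong_AE)
    also have "\<dots> \<le> liminf (\<lambda>j. \<integral>\<^sup>+t. a' j t \<partial>lebesgue_on {s..b})" by (rule nn_integral_liminf[OF a'm])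
    also have "\<dots> \<le> liminf (\<lambda>j. cs)" by (intro Liminf_mono always_eventually allI a'i)
    finally show ?thesis by (simp add: Liminf_const)
  qed
  have "ocp_cost h (\<psi>0, \<psi>1) yref lu T s x v \<noteq> \<infinity>"
  proof -
    let ?P = "\<integral>\<^sup>+t. e2ennreal (state_cost t (\<Phi> (x t)) (v t)) \<partial>lebesgue_on {s..b}"
    have "?P < \<infinity>" using P cs_fin by (rule order_le_less_trans)
    then have "enn2ereal ?P \<noteq> \<infinity>" "?P \<noteq> \<infinity>" by (auto simp: enn2ereal_eq_top_iff)
    moreover have "0 \<le> enn2ereal y" for y by (rule enn2ereal_nonneg)
    ultimately show ?thesis
      unfolding ocp_cost_eq(1)[OF s0 T xadm] ereal_integral_def b_def[symmetric]
      by (auto simp: Let_def ereal_minus_eq_PInfty_iff)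
  qed
  then have xin: "in_funnel t (\<Phi> (x t))" if "t \<in> {s..b}" for t
    using finite_cost_in_funnel[OF s0 T xadm reach_in_funnel[OF s reach]] that by (auto simp: b_def)
  then have xa: "adm x v" using xadm by (auto simp: adm_def)
  have "cost x v \<le> cs"
  proof -
    have "cost x v = (\<integral>\<^sup>+t. e2ennreal (state_cost t (\<Phi> (x t)) (v t)) \<partial>lebesgue_on {s..b})"
      unfolding cost_def using in_funnel_cost(1)[OF xin] s0 by (intro nn_integral_cong) auto
    then show ?thesis using P by simp
  qed
  have "ocp_cost h (\<psi>0, \<psi>1) yref lu T s x v \<le> ocp_cost h (\<psi>0, \<psi>1) yref lu T s y w"
    if yw: "ocp_admissible f g T M s xh y w" for y w
  proof (cases "ocp_cost h (\<psi>0, \<psi>1) yref lu T s y w = \<infinity>")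
    case False
    then have "in_funnel t (\<Phi> (y t))" if "t \<in> {s..b}" for t
      using finite_cost_in_funnel[OF s0 T yw reach_in_funnel[OF s reach]] that by (auto simp: b_def)
    then have "adm y w" using yw by (auto simp: adm_def)
    then show ?thesis
      using adm_cost(1)[OF xa] adm_cost(1) cs_le[of y w] \<open>cost x v \<le> cs\<close> by (simp add: less_eq_ennreal.rep_eq[symmetric])
  qed simp
  then show ?thesis unfolding ocp_solution_def using xadm by blast
qed

end

lemma control_solution_cong:
  assumes "control_solution f g w J y" "\<And>t. t \<in> J \<Longrightarrow> w t = u t" "J \<in> sets lebesgue"
  shows "control_solution f g u J y"
proof -
  have "AE t in lebesgue_on J. (y has_vector_derivative f (y t) + w t *\<^sub>R g (y t)) (at t within J)"
    using assms(1) by (simp add: control_solution_def caratheodory_solution_def)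
  then have "AE t in lebesgue_on J. (y has_vector_derivative f (y t) + u t *\<^sub>R g (y t)) (at t within J)"
    by (rule AE_mp) (use assms(2) in \<open>auto intro!: AE_I2\<close>)
  then show ?thesis using assms(1) by (simp add: control_solution_def caratheodory_solution_def)
qed

lemma sampling_time_eq:
  assumes "\<delta> > 0" "t0 + real k * \<delta> \<le> t" "t < t0 + real (Suc k) * \<delta>"
  shows "sampling_time t0 \<delta> t = t0 + real k * \<delta>" "nat \<lfloor>(t - t0) / \<delta>\<rfloor> = k"
proof -
  have "real k \<le> (t - t0) / \<delta>" using assms by (simp add: pos_le_divide_eq)
  moreover have "(t - t0) / \<delta> < real k + 1" using assms by (simp add: pos_divide_less_eq algebra_simps)
  ultimately have "\<lfloor>(t - t0) / \<delta>\<rfloor> = int k" by (intro floor_unique) auto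
  then show "sampling_time t0 \<delta> t = t0 + real k * \<delta>" "nat \<lfloor>(t - t0) / \<delta>\<rfloor> = k"
    by (auto simp: sampling_time_def)
qed

lemma sampling_index_exists:
  assumes "\<delta> > 0" "t0 \<le> (t::real)"
  obtains k where "t0 + real k * \<delta> \<le> t" "t < t0 + real (Suc k) * \<delta>"
proof (rule that[of "nat \<lfloor>(t - t0) / \<delta>\<rfloor>"])
  have 0: "0 \<le> (t - t0) / \<delta>" using assms by simp
  have r: "real (nat \<lfloor>(t - t0) / \<delta>\<rfloor>) = of_int \<lfloor>(t - t0) / \<delta>\<rfloor>" using 0 by simp
  have "of_int \<lfloor>(t - t0) / \<delta>\<rfloor> \<le> (t - t0) / \<delta>" "(t - t0) / \<delta> < of_int \<lfloor>(t - t0) / \<delta>\<rfloor> + 1" by linarith+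
  then have "of_int \<lfloor>(t - t0) / \<delta>\<rfloor> * \<delta> \<le> t - t0" "t - t0 < (of_int \<lfloor>(t - t0) / \<delta>\<rfloor> + 1) * \<delta>"
    unfolding pos_le_divide_eq[OF assms(1)] pos_divide_less_eq[OF assms(1)] .
  then show "t0 + real (nat \<lfloor>(t - t0) / \<delta>\<rfloor>) * \<delta> \<le> t" "t < t0 + real (Suc (nat \<lfloor>(t - t0) / \<delta>\<rfloor>)) * \<delta>"
    unfolding of_nat_Suc r by (simp_all add: algebra_simps)
qed

context fmpc
begin

subsection \<open>Recursive feasibility\<close>

definition feasible :: "real \<Rightarrow> real \<Rightarrow> real \<Rightarrow> real^'n \<Rightarrow> bool" where
  "feasible T M s xh \<longleftrightarrow> reach s (\<Phi> xh) \<and>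
     (\<exists>x u. ocp_admissible f g T M s xh x u \<and> (\<forall>t\<in>{s..s + T}. in_funnel t (\<Phi> (x t))))"

lemma initial_safe:
  obtains Ms where "2 * K \<le> Ms" "\<And>z. z \<in> B \<Longrightarrow> safe_state Ms t0 z"
proof -
  have Bf: "in_funnel t0 z" if "z \<in> B" for z using B(2) that in_funnel_D_set[OF t0] by auto
  have "\<exists>\<kappa>>0. \<forall>z\<in>B. \<kappa> \<le> \<psi>0 t0 - \<bar>z $ i0 - yref t0\<bar>"
  proof (cases "B = {}")
    case False
    have "continuous_on B (\<lambda>z. \<psi>0 t0 - \<bar>z $ i0 - yref t0\<bar>)" by (intro continuous_intros)
    then obtain z where "z \<in> B" "\<forall>y\<in>B. \<psi>0 t0 - \<bar>z $ i0 - yref t0\<bar> \<le> \<psi>0 t0 - \<bar>y $ i0 - yref t0\<bar>"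
      using continuous_attains_inf[OF B(1) False] by blast
    then show ?thesis using Bf[of z] by (intro exI[of _ "\<psi>0 t0 - \<bar>z $ i0 - yref t0\<bar>"]) (auto simp: in_funnel_def)
  qed (auto intro: exI[of _ 1])
  then obtain \<kappa> where \<kappa>: "\<kappa> > 0" "\<And>z. z \<in> B \<Longrightarrow> \<kappa> \<le> \<psi>0 t0 - \<bar>z $ i0 - yref t0\<bar>" by blast
  define Ms where "Ms = 2 * K + 2 * K\<^sup>2 / \<kappa>"
  have Ms0: "Ms \<ge> 0" using K_pos \<kappa> by (simp add: Ms_def)
  show ?thesis
  proof (rule that[of Ms])
    show "2 * K \<le> Ms" using \<kappa> by (simp add: Ms_def)
    fix z assume z: "z \<in> B"
    have main: "(w - d\<psi>0 t0)\<^sup>2 \<le> 2 * Ms * d" if "\<bar>w\<bar> < \<psi>1 t0" "\<kappa> \<le> d" for w d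
    proof -
      have "\<bar>w - d\<psi>0 t0\<bar> \<le> 2 * K" using that d\<psi>0_bound[OF t0] bounds(4)[OF t0] by linarith
      then have "\<bar>w - d\<psi>0 t0\<bar>\<^sup>2 \<le> (2 * K)\<^sup>2" by (intro power_mono) auto
      also have "\<dots> = 2 * (2 * K\<^sup>2 / \<kappa>) * \<kappa>" using \<kappa> by (simp add: power2_eq_square)
      also have "\<dots> \<le> 2 * Ms * d" using that \<kappa> K_pos Ms0 by (intro mult_mono) (auto simp: Ms_def)
      finally show ?thesis by simp
    qed
    show "safe_state Ms t0 z"
      unfolding safe_state_def safe_def
      using main[of "z $ i1 - dyref t0" "\<psi>0 t0 - (z $ i0 - yref t0)"] main[of "- (z $ i1 - dyref t0)" "\<psi>0 t0 + (z $ i0 - yref t0)"]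
        \<kappa>(2)[OF z] Bf[OF z] by (auto simp: in_funnel_def abs_if split: if_splits)
  qed
qed

lemma reach_initial: "\<Phi> x0 \<in> B \<Longrightarrow> reach t0 (\<Phi> x0)"
  unfolding reach_def path_def
  using B(2) in_funnel_D_set[OF t0] by (intro exI[of _ "\<lambda>_. \<Phi> x0"]) (auto simp: has_integral_refl)

lemma ocp_solution_in_funnel:
  assumes s: "0 \<le> s" "0 < T" and fe: "feasible T M s xh" and opt: "ocp_solution f g h (\<psi>0, \<psi>1) yref lu T M s xh u"
  obtains x where "ocp_admissible f g T M s xh x u" "\<And>t. t \<in> {s..s + T} \<Longrightarrow> in_funnel t (\<Phi> (x t))"
proof -
  obtain x where x: "ocp_admissible f g T M s xh x u"
    "\<And>x' u'. ocp_admissible f g T M s xh x' u' \<Longrightarrow>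
       ocp_cost h (\<psi>0, \<psi>1) yref lu T s x u \<le> ocp_cost h (\<psi>0, \<psi>1) yref lu T s x' u'"
    using opt unfolding ocp_solution_def by blast
  obtain y w where yw: "ocp_admissible f g T M s xh y w" "\<And>t. t \<in> {s..s + T} \<Longrightarrow> in_funnel t (\<Phi> (y t))"
    using fe unfolding feasible_def by blast
  have "ocp_cost h (\<psi>0, \<psi>1) yref lu T s y w < \<infinity>"
    using in_funnel_ocp_cost[OF s yw] by (simp add: less_ennreal.rep_eq)
  then have fin: "ocp_cost h (\<psi>0, \<psi>1) yref lu T s x u \<noteq> \<infinity>" using x(2)[OF yw(1)] by auto
  have "in_funnel s (\<Phi> xh)" using yw(2)[of s] yw(1) s by (simp add: ocp_admissible_def)
  then show ?thesis using that[OF x(1)] finite_cost_in_funnel[OF s x(1) _ fin] by blast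
qed

lemma trajectory_unique:
  assumes s: "0 \<le> s" "0 < r" "r \<le> T" and x: "ocp_admissible f g T M s xh x u"
    and y: "control_solution f g w J y" "{s..s + r} \<subseteq> J" "J \<in> sets lebesgue" "y s = xh"
    and w: "\<And>t. t \<in> {s..<s + r} \<Longrightarrow> w t = u t" and t: "t \<in> {s..s + r}"
  shows "y t = x t"
proof -
  have T: "0 < T" using s by simp
  have a: "\<And>t. t \<in> {s..s + T} \<Longrightarrow> \<bar>u t\<bar> \<le> M" "lipschitz_solution (rhs u) s (s + T) x" "x s = xh"
    using x unfolding admissible_iff[OF s(1) T] by auto
  have "control_solution f g w {s..<s + r} y"
    using y(1) unfolding control_solution_def
    by (rule caratheodory_solution_subset[OF _ _ y(3)]) (use y(2) in auto)
  then have c1: "control_solution f g u {s..<s + r} y" by (rule control_solution_cong) (use w in auto)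
  have c2: "continuous_on {s..s + r} y"
    using y(1) unfolding control_solution_def by (rule caratheodory_solution_continuous_on) (rule y(2))
  have ly: "lipschitz_solution (rhs u) s (s + r) y"
    by (rule control_lipschitz_solution_Icc[OF c1 _ c2 f_cont g_cont, where M=M]) (use a s in auto)
  have lx: "lipschitz_solution (rhs u) s (s + r) x"
    by (rule lipschitz_solution_subset[OF a(2)]) (use s in auto)
  show ?thesis
    by (rule lipschitz_solution_unique[OF f g _ ly lx, where M=M]) (use a s t y(4) in auto)
qed

lemma feasible_safe:
  assumes M: "steerable Ms M"
    and s: "t0 \<le> s" "0 < T" and re: "reach s (\<Phi> xh)" and sa: "safe_state Ms s (\<Phi> xh)"
  shows "feasible T M s xh"
proof -
  have s0: "0 \<le> s" using s t0 by simp
  obtain z u where z: "u \<in> borel_measurable borel" "\<forall>r. r \<ge> s \<longrightarrow> \<bar>u r\<bar> \<le> M" "z s = \<Phi> xh"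
      "lipschitz_solution (bi_rhs u) s (s + T) z" "\<forall>r\<in>{s..s + T}. in_funnel r (z r)"
    using M[unfolded steerable_def, rule_format, OF s(1) re sa, of "s + T"] s by auto
  have eq: "\<Phi> \<circ> (inv \<Phi> \<circ> z) = z" by auto
  have um: "u \<in> borel_measurable (lebesgue_on {s..s + T})"
  proof -
    have "u \<in> borel_measurable lborel" using z(1) by simp
    then show ?thesis by (intro measurable_restrict_space1 measurable_completion)
  qed
  have "lipschitz_solution (rhs u) s (s + T) (inv \<Phi> \<circ> z)"
    using lipschitz_solution_bi_iff[of u s "s + T" M "inv \<Phi> \<circ> z"] um z(2,4) s s0 unfolding eq by auto
  then have "ocp_admissible f g T M s xh (inv \<Phi> \<circ> z) u"
    unfolding admissible_iff[OF s0 s(2)] using um z by auto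
  then show ?thesis unfolding feasible_def using re z(5)
    by (intro conjI exI[of _ "inv \<Phi> \<circ> z"] exI[of _ u]) auto
qed

text \<open>The tail of the trajectory is followed until a safe time, which exists in the last unit of time of the
  horizon; from there on the steering control takes over.\<close>

lemma feasible_step:
  assumes M: "steerable Ms M"
    and M0: "0 < M" and Ms: "2 * K \<le> Ms" and s: "t0 \<le> s" and T: "T = \<delta> + 1"
    and re: "reach s (\<Phi> xh)" and adm: "ocp_admissible f g T M s xh x u"
    and inf: "\<And>t. t \<in> {s..s + T} \<Longrightarrow> in_funnel t (\<Phi> (x t))"
  shows "feasible T M (s + \<delta>) (x (s + \<delta>))"
proof -
  have s0: "0 \<le> s" and T0: "0 < T" using s t0 T \<delta> by auto
  define z where "z = \<Phi> \<circ> x"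
  have sol: "lipschitz_solution (bi_rhs u) s (s + T) z" unfolding z_def by (rule ocp_cost_eq(2)[OF s0 T0 adm])
  have zi: "in_funnel t (z t)" if "t \<in> {s..s + T}" for t using inf[OF that] by (simp add: z_def)
  have zs: "z s = \<Phi> xh" using adm by (simp add: z_def ocp_admissible_def)
  have rt: "reach t (z t)" if "t \<in> {s..s + T}" for t
    using reach_path_end[OF re bi_solution_path[OF sol zi] zs s _ that] T0 by auto
  let ?a = "s + \<delta>"
  have "\<exists>r\<in>{?a..?a + 1}. safe Ms r (z r $ i0 - yref r) (z r $ i1 - dyref r)"
  proof (rule safe_time_exists[OF _ Ms])
    show "0 \<le> ?a" using s0 \<delta> by simp
    fix r assume r: "r \<in> {?a..?a + 1}"
    have "((\<lambda>t. z t $ i0) has_vector_derivative z r $ i1) (at r within {?a..?a + 1})"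
      by (rule has_vector_derivative_within_subset[OF bi_solution_output_deriv[OF sol]]) (use r T \<delta> in auto)
    moreover have "(yref has_vector_derivative dyref r) (at r within {?a..?a + 1})"
      by (rule has_vector_derivative_within_subset[OF yref_deriv]) (use r s0 \<delta> in auto)
    ultimately show "((\<lambda>t. z t $ i0 - yref t) has_vector_derivative z r $ i1 - dyref r) (at r within {?a..?a + 1})"
      by (rule has_vector_derivative_diff)
    show "\<bar>z r $ i0 - yref r\<bar> < \<psi>0 r" using zi[of r] r T \<delta> by (auto simp: in_funnel_def)
  qed
  then obtain \<tau> where \<tau>: "\<tau> \<in> {?a..?a + 1}" "safe_state Ms \<tau> (z \<tau>)" by (auto simp: safe_state_def)
  have \<tau>s: "t0 \<le> \<tau>" "\<tau> \<in> {s..s + T}" "\<tau> < ?a + T" using \<tau> T \<delta> s by auto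
  obtain y w where y: "w \<in> borel_measurable borel" "\<forall>r. r \<ge> \<tau> \<longrightarrow> \<bar>w r\<bar> \<le> M" "y \<tau> = z \<tau>"
      "lipschitz_solution (bi_rhs w) \<tau> (?a + T) y" "\<forall>r\<in>{\<tau>..?a + T}. in_funnel r (y r)"
    using M[unfolded steerable_def, rule_format, OF \<tau>s(1) rt[OF \<tau>s(2)] \<tau>(2) \<tau>s(3)] by blast
  define z' where "z' t = (if t \<le> \<tau> then z t else y t)" for t
  define u' where "u' t = (if t < \<tau> then if t \<in> {s..s + T} then u t else 0 else w t)" for t
  have l1: "lipschitz_solution (bi_rhs u') ?a \<tau> z'"
    by (rule lipschitz_solution_cong[OF lipschitz_solution_subset[OF sol], where N'="{}"])
      (use \<tau>s \<tau> \<delta> in \<open>auto simp: z'_def u'_def bi_rhs_def\<close>)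
  have l2: "lipschitz_solution (bi_rhs u') \<tau> (?a + T) z'"
    by (rule lipschitz_solution_cong[OF y(4), where N'="{}"])
      (use y(3) in \<open>auto simp: z'_def u'_def bi_rhs_def\<close>)
  have l: "lipschitz_solution (bi_rhs u') ?a (?a + T) z'"
    by (rule lipschitz_solution_glue[OF l1 l2]) (use \<tau> \<tau>s in auto)
  have u'm: "u' \<in> borel_measurable (lebesgue_on {?a..?a + T})"
  proof (rule measurable_restrict_space1)
    have "(\<lambda>t. if t \<in> {s..s + T} then u t else 0) \<in> borel_measurable lebesgue"
      using adm unfolding admissible_iff[OF s0 T0] by (intro borel_measurable_if_I) auto
    moreover have "w \<in> borel_measurable lebesgue"
    proof -
      have "w \<in> borel_measurable lborel" using y(1) by simp
      then show ?thesis by (rule measurable_completion)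
    qed
    moreover have "{t \<in> space lebesgue. t < \<tau>} \<in> sets lebesgue"
    proof -
      have "{t \<in> space lebesgue. t < \<tau>} = {..<\<tau>}" by auto
      then show ?thesis by simp
    qed
    ultimately show "u' \<in> borel_measurable lebesgue"
      unfolding u'_def[abs_def] by (rule measurable_If)
  qed
  have u'b: "\<bar>u' t\<bar> \<le> M" if "t \<in> {?a..?a + T}" for t
    using adm y(2) M0 unfolding admissible_iff[OF s0 T0] u'_def by auto
  have z'i: "in_funnel t (z' t)" if "t \<in> {?a..?a + T}" for t
    using zi y(5) \<tau>s that \<delta> by (auto simp: z'_def)
  have eq: "\<Phi> \<circ> (inv \<Phi> \<circ> z') = z'" by auto
  have a0: "0 \<le> ?a" using s0 \<delta> by simp
  have "lipschitz_solution (rhs u') ?a (?a + T) (inv \<Phi> \<circ> z')"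
    using lipschitz_solution_bi_iff[OF u'm u'b a0, of "inv \<Phi> \<circ> z'"] l T0 unfolding eq by auto
  moreover have "(inv \<Phi> \<circ> z') ?a = x ?a" using \<tau> by (simp add: z'_def z_def)
  ultimately have "ocp_admissible f g T M ?a (x ?a) (inv \<Phi> \<circ> z') u'"
    unfolding admissible_iff[OF a0 T0] using u'm u'b by auto
  moreover have "reach ?a (\<Phi> (x ?a))" using rt[of ?a] T \<delta> by (simp add: z_def)
  ultimately show ?thesis
    unfolding feasible_def using z'i by (intro conjI exI[of _ "inv \<Phi> \<circ> z'"] exI[of _ u']) auto
qed

lemma fmpc_main:
  assumes M: "steerable Ms M"
    and M0: "0 < M" and Ms: "2 * K \<le> Ms" and init: "\<And>z. z \<in> B \<Longrightarrow> safe_state Ms t0 z"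
    and T: "T = \<delta> + 1" and x0: "\<Phi> x0 \<in> B"
  shows "fmpc_feasible f g h (\<psi>0, \<psi>1) yref lu t0 \<delta> T M x0" (is ?feas)
    and "\<exists>\<mu> x. fmpc_closed_loop f g h (\<psi>0, \<psi>1) yref lu t0 \<delta> T M x0 \<mu> x" (is ?ex)
    and "fmpc_closed_loop f g h (\<psi>0, \<psi>1) yref lu t0 \<delta> T M x0 \<mu> y \<Longrightarrow>
      (\<forall>t\<ge>t0. \<bar>fmpc_input t0 \<delta> \<mu> y t\<bar> \<le> M \<and> in_funnel t (\<Phi> (y t)) \<and>
        ((h \<circ> y) has_vector_derivative \<Phi> (y t) $ i1) (at t within {t0..}))"
proof -
  let ?t = "\<lambda>k. t0 + real k * \<delta>"
  have tS: "?t (Suc k) = ?t k + \<delta>" for k by (simp add: algebra_simps)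
  have tk: "t0 \<le> ?t k" "0 \<le> ?t k" for k using \<delta> t0 by auto
  have T0: "0 < T" and \<delta>T: "\<delta> \<le> T" using T \<delta> by auto
  let ?opt = "\<lambda>k xh u. ocp_solution f g h (\<psi>0, \<psi>1) yref lu T M (?t k) xh u"
  let ?F = "\<lambda>k xh. feasible T M (?t k) xh"
  have F0: "?F 0 x0"
    using feasible_safe[OF M order_refl T0 reach_initial[OF x0] init[OF x0]] by simp
  have opt_ex: "\<exists>u. ?opt k xh u" if "?F k xh" for k xh
    using that unfolding feasible_def by (auto intro: ocp_solution_exists[OF tk(1) T0 M0])
  have advance: "\<exists>x. ocp_admissible f g T M (?t k) xh x u \<and> (\<forall>t\<in>{?t k..?t k + T}. in_funnel t (\<Phi> (x t))) \<and>
      ?F (Suc k) (x (?t (Suc k)))" if F: "?F k xh" and o: "?opt k xh u" for k xh u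
  proof -
    obtain x where x: "ocp_admissible f g T M (?t k) xh x u" "\<And>t. t \<in> {?t k..?t k + T} \<Longrightarrow> in_funnel t (\<Phi> (x t))"
      by (rule ocp_solution_in_funnel[OF tk(2) T0 F o]) blast
    have "reach (?t k) (\<Phi> xh)" using F by (simp add: feasible_def)
    from feasible_step[OF M M0 Ms tk(1) T this x] x show ?thesis unfolding tS by blast
  qed
  have st: "?F k xh" if "fmpc_state f g h (\<psi>0, \<psi>1) yref lu t0 \<delta> T M x0 k xh" for k xh
    using that
  proof (induction rule: fmpc_state.induct)
    case init
    then show ?case using F0 by simp
  next
    case (step k xh u y)
    obtain x where x: "ocp_admissible f g T M (?t k) xh x u" "?F (Suc k) (x (?t (Suc k)))"
      using advance[OF step.IH step.hyps(2)] by blast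
    have "y (?t (Suc k)) = x (?t (Suc k))"
      by (rule trajectory_unique[OF tk(2) \<delta> \<delta>T x(1) step.hyps(3)[unfolded tS] order_refl])
        (use step.hyps(4) \<delta> in \<open>auto simp: algebra_simps\<close>)
    then show ?case using x(2) by simp
  qed
  show ?feas unfolding fmpc_feasible_def using st opt_ex by blast
  show ?ex
  proof -
    let ?P = "\<lambda>k (xh, x, u). (k = 0 \<longrightarrow> xh = x0) \<and> ?F k xh \<and> ?opt k xh u \<and> ocp_admissible f g T M (?t k) xh x u \<and> ?F (Suc k) (x (?t (Suc k)))"
    let ?Q = "\<lambda>k (xh, x, u) (xh', x', u'). xh' = x (?t (Suc k))"
    have "\<exists>s. \<forall>k. ?P k (s k) \<and> ?Q k (s k) (s (Suc k))"
    proof (rule dependent_nat_choice)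
      obtain u where u: "?opt 0 x0 u" using opt_ex[OF F0] by blast
      obtain x where "ocp_admissible f g T M (?t 0) x0 x u" "?F (Suc 0) (x (?t (Suc 0)))" using advance[OF F0 u] by blast
      then show "\<exists>xx. ?P 0 xx" using F0 u by (intro exI[of _ "(x0, x, u)"]) auto
    next
      fix xx k assume "?P k xx"
      then obtain xh x v where xx: "xx = (xh, x, v)" and F1: "?F (Suc k) (x (?t (Suc k)))" by (cases xx) auto
      obtain u where u: "?opt (Suc k) (x (?t (Suc k))) u" using opt_ex[OF F1] by blast
      obtain y where "ocp_admissible f g T M (?t (Suc k)) (x (?t (Suc k))) y u" "?F (Suc (Suc k)) (y (?t (Suc (Suc k))))"
        using advance[OF F1 u] by blast
      then show "\<exists>yy. ?P (Suc k) yy \<and> ?Q k xx yy"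
        using F1 u xx by (intro exI[of _ "(x (?t (Suc k)), y, u)"]) auto
    qed
    then obtain s where "\<forall>k. ?P k (s k) \<and> ?Q k (s k) (s (Suc k))" by (elim exE)
    then have sPQ: "?P k (s k) \<and> ?Q k (s k) (s (Suc k))" for k by (rule spec)
    note s = conjunct1[OF sPQ] conjunct2[OF sPQ]
    define xs us where "xs k = fst (snd (s k))" and "us k = snd (snd (s k))" for k
    define xh where "xh k = fst (s k)" for k
    have sk: "s k = (xh k, xs k, us k)" for k by (simp add: xs_def us_def xh_def)
    have P: "?P k (xh k, xs k, us k)" and Q: "?Q k (xh k, xs k, us k) (xh (Suc k), xs (Suc k), us (Suc k))" for k
      using s(1)[of k] s(2)[of k] unfolding sk .
    have xh0: "xh 0 = x0" using P[of 0] by (simp only: prod.case)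
    have xhS: "xh (Suc k) = xs k (?t (Suc k))" for k using Q[of k] by (simp only: prod.case)
    have ok: "?opt k (xh k) (us k)" and adk: "ocp_admissible f g T M (?t k) (xh k) (xs k) (us k)" for k
      using P[of k] by (simp_all only: prod.case)
    have xsk: "xs k (?t k) = xh k" for k using adk[of k] by (simp add: ocp_admissible_def)
    define idx where "idx t = nat \<lfloor>(t - t0) / \<delta>\<rfloor>" for t
    define y where "y t = xs (idx t) t" for t
    define \<mu> where "\<mu> t (z :: real^'n) = us (idx t) t" for t z
    have idx: "idx t = k" if "?t k \<le> t" "t < ?t (Suc k)" for t k
      unfolding idx_def by (rule sampling_time_eq(2)[OF \<delta> that])
    have yk: "y (?t k) = xh k" for k using idx[of k "?t k"] \<delta> xsk by (simp add: y_def)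
    have yx: "y t = xs k t" if "t \<in> {?t k..?t (Suc k)}" for t k
    proof (cases "t = ?t (Suc k)")
      case True then show ?thesis using yk[of "Suc k"] xhS[of k] by simp
    next
      case False then show ?thesis using idx[of k t] that by (simp add: y_def)
    qed
    let ?in = "fmpc_input t0 \<delta> \<mu> y"
    have inp: "?in t = us k t" if "?t k \<le> t" "t < ?t (Suc k)" for t k
      using idx[OF that] by (simp add: fmpc_input_def \<mu>_def)
    have piece: "lipschitz_solution (rhs ?in) (?t k) (?t (Suc k)) y" for k
    proof (rule lipschitz_solution_cong[where N'="{}"])
      show "lipschitz_solution (rhs (us k)) (?t k) (?t (Suc k)) (xs k)"
        by (rule lipschitz_solution_subset) (use adk[of k, unfolded admissible_iff[OF tk(2) T0]] \<delta>T tS in auto)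
    qed (use yx inp in auto)
    have all: "lipschitz_solution (rhs ?in) t0 (?t k) y" for k
    proof (induction k)
      case 0
      show ?case using lipschitz_solution_subset[OF piece[of 0], of t0 t0] \<delta> by simp
    next
      case (Suc k)
      then show ?case by (rule lipschitz_solution_glue[OF _ piece]) (use tk \<delta> in auto)
    qed
    have "control_solution f g ?in {t0..} y"
      unfolding control_solution_def
    proof (rule lipschitz_solution_caratheodory_Ici)
      fix b assume b: "t0 \<le> b"
      obtain k where "?t k \<le> b" "b < ?t (Suc k)" by (rule sampling_index_exists[OF \<delta> b])
      then show "lipschitz_solution (rhs ?in) t0 b y"
        by (intro lipschitz_solution_subset[OF all[of "Suc k"]]) auto
    qed
    moreover have "\<exists>u. ?opt k (y (?t k)) u \<and> (\<forall>t\<in>{?t k..<?t (Suc k)}. \<mu> t (y (?t k)) = u t)" for k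
      using ok[of k] yk[of k] idx by (intro exI[of _ "us k"]) (auto simp: \<mu>_def)
    moreover have "y t0 = x0" using yk[of 0] xh0 by simp
    ultimately show ?thesis unfolding fmpc_closed_loop_def by blast
  qed
  show "\<forall>t\<ge>t0. \<bar>fmpc_input t0 \<delta> \<mu> y t\<bar> \<le> M \<and> in_funnel t (\<Phi> (y t)) \<and>
        ((h \<circ> y) has_vector_derivative \<Phi> (y t) $ i1) (at t within {t0..})"
    if cl: "fmpc_closed_loop f g h (\<psi>0, \<psi>1) yref lu t0 \<delta> T M x0 \<mu> y"
  proof -
    let ?in = "fmpc_input t0 \<delta> \<mu> y"
    have csol: "control_solution f g ?in {t0..} y" and y0: "y t0 = x0"
      and opt: "\<And>k. \<exists>u. ?opt k (y (?t k)) u \<and> (\<forall>t\<in>{?t k..<?t (Suc k)}. \<mu> t (y (?t k)) = u t)"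
      using cl unfolding fmpc_closed_loop_def by auto
    have piece: "\<exists>x u. ocp_admissible f g T M (?t k) (y (?t k)) x u \<and> (\<forall>t\<in>{?t k..?t k + T}. in_funnel t (\<Phi> (x t))) \<and>
        (\<forall>t\<in>{?t k..<?t (Suc k)}. ?in t = u t) \<and> (\<forall>t\<in>{?t k..?t (Suc k)}. y t = x t) \<and> ?F (Suc k) (y (?t (Suc k)))"
      if F: "?F k (y (?t k))" for k
    proof -
      obtain u where u: "?opt k (y (?t k)) u" "\<And>t. t \<in> {?t k..<?t (Suc k)} \<Longrightarrow> \<mu> t (y (?t k)) = u t"
        using opt[of k] by blast
      obtain x where x: "ocp_admissible f g T M (?t k) (y (?t k)) x u" "\<forall>t\<in>{?t k..?t k + T}. in_funnel t (\<Phi> (x t))"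
        "?F (Suc k) (x (?t (Suc k)))" using advance[OF F u(1)] by blast
      have inp: "?in t = u t" if "t \<in> {?t k..<?t (Suc k)}" for t
        using u(2)[OF that] sampling_time_eq(1)[OF \<delta>, of t0 k t] that by (simp add: fmpc_input_def)
      have yx: "y t = x t" if "t \<in> {?t k..?t (Suc k)}" for t
        by (rule trajectory_unique[OF tk(2) \<delta> \<delta>T x(1) csol])
          (use tk[of k] inp that in \<open>auto simp: algebra_simps\<close>)
      have "y (?t (Suc k)) = x (?t (Suc k))" using yx[of "?t (Suc k)"] \<delta> by simp
      then show ?thesis using x inp yx by (intro exI[of _ x] exI[of _ u]) auto
    qed
    have Fk: "?F k (y (?t k))" for k
    proof (induction k)
      case 0 then show ?case using F0 y0 by simp
    next
      case (Suc k) then show ?case using piece by blast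
    qed
    have props: "\<bar>?in t\<bar> \<le> M \<and> in_funnel t (\<Phi> (y t))" if t: "?t k \<le> t" "t < ?t (Suc k)" for t k
    proof -
      obtain x u where "ocp_admissible f g T M (?t k) (y (?t k)) x u" "\<forall>t\<in>{?t k..?t k + T}. in_funnel t (\<Phi> (x t))"
        "\<forall>t\<in>{?t k..<?t (Suc k)}. ?in t = u t" "\<forall>t\<in>{?t k..?t (Suc k)}. y t = x t"
        using piece[OF Fk[of k]] by blast
      moreover have "t \<in> {?t k..?t k + T}" using t tS[of k] \<delta>T by simp
      ultimately show ?thesis using t by (auto simp: ocp_admissible_def)
    qed
    have bpiece: "lipschitz_solution (bi_rhs ?in) (?t k) (?t (Suc k)) (\<Phi> \<circ> y)" for k
    proof -
      obtain x u where x: "ocp_admissible f g T M (?t k) (y (?t k)) x u"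
        "\<forall>t\<in>{?t k..<?t (Suc k)}. ?in t = u t" "\<forall>t\<in>{?t k..?t (Suc k)}. y t = x t"
        using piece[OF Fk[of k]] by blast
      have "lipschitz_solution (bi_rhs u) (?t k) (?t (Suc k)) (\<Phi> \<circ> x)"
        by (rule lipschitz_solution_subset[OF ocp_cost_eq(2)[OF tk(2) T0 x(1)]]) (use tS[of k] \<delta>T in auto)
      then show ?thesis
        by (rule lipschitz_solution_cong[where N'="{}"]) (use x(2,3) in \<open>auto simp: bi_rhs_def\<close>)
    qed
    have ball: "lipschitz_solution (bi_rhs ?in) t0 (?t k) (\<Phi> \<circ> y)" for k
    proof (induction k)
      case 0
      show ?case using lipschitz_solution_subset[OF bpiece[of 0], of t0 t0] \<delta> by (simp add: o_def)
    next
      case (Suc k)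
      then show ?case by (rule lipschitz_solution_glue[OF _ bpiece]) (use tk \<delta> in auto)
    qed
    have der: "((h \<circ> y) has_vector_derivative \<Phi> (y t) $ i1) (at t within {t0..})" if t: "t0 \<le> t" for t
    proof -
      obtain k where k: "?t k \<le> t + 1" "t + 1 < ?t (Suc k)" by (rule sampling_index_exists[OF \<delta>, of t0 "t + 1"]) (use t in auto)
      have "lipschitz_solution (bi_rhs ?in) t0 (t + 1) (\<Phi> \<circ> y)"
        by (rule lipschitz_solution_subset[OF ball[of "Suc k"]]) (use k in auto)
      from bi_solution_output_deriv[OF this, of t]
      have "((\<lambda>t. \<Phi> (y t) $ i0) has_vector_derivative \<Phi> (y t) $ i1) (at t within {t0..t + 1})" using t by simp
      moreover have "(\<lambda>t. \<Phi> (y t) $ i0) = h \<circ> y" by (auto simp: \<Phi>_output)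
      ultimately show ?thesis by (simp add: at_within_Icc_Ici)
    qed
    show ?thesis
    proof (intro allI impI)
      fix t assume t: "t0 \<le> t"
      obtain k where "?t k \<le> t" "t < ?t (Suc k)" by (rule sampling_index_exists[OF \<delta> t])
      then show "\<bar>?in t\<bar> \<le> M \<and> in_funnel t (\<Phi> (y t)) \<and>
        ((h \<circ> y) has_vector_derivative \<Phi> (y t) $ i1) (at t within {t0..})"
        using props der[OF t] by blast
    qed
  qed
qed

end

theorem theorem2:
  fixes f g :: "real^'n::finite \<Rightarrow> real^'n"
    and h :: "real^'n \<Rightarrow> real"
    and \<Phi> :: "real^'n \<Rightarrow> real^'n"
    and p :: "real^'n \<Rightarrow> real"
    and q :: "real^'n \<Rightarrow> real^'n"
    and i0 i1 :: 'n
    and \<psi>0 \<psi>1 yref :: "real \<Rightarrow> real"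
    and lu t0 \<delta> :: real
    and B :: "(real^'n) set"
  assumes "C_k 2 f" and "C_k 2 g" and "C_k 3 h"
    and "relative_degree_two f g h"
    and "i0 \<noteq> i1"
    and "diffeomorphism \<Phi>"
    and "byrnes_isidori_form i0 i1 f g h \<Phi> p q"
    and "bibs i0 i1 q"
    and "(\<psi>0, \<psi>1) \<in> G1"
    and "yref \<in> W2inf"
    and "lu \<ge> 0" and "t0 \<ge> 0" and "\<delta> > 0"
    and "compact B" and "B \<subseteq> D_set i0 i1 (\<psi>0, \<psi>1) yref t0"
  shows "\<exists>T>\<delta>. \<exists>M>0. \<forall>x0. \<Phi> x0 \<in> B \<longrightarrow>
    fmpc_feasible f g h (\<psi>0, \<psi>1) yref lu t0 \<delta> T M x0 \<and>
    (\<exists>\<mu> x. fmpc_closed_loop f g h (\<psi>0, \<psi>1) yref lu t0 \<delta> T M x0 \<mu> x) \<and>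
    (\<forall>\<mu> x. fmpc_closed_loop f g h (\<psi>0, \<psi>1) yref lu t0 \<delta> T M x0 \<mu> x \<longrightarrow>
       (\<forall>t\<ge>t0. \<bar>fmpc_input t0 \<delta> \<mu> x t\<bar> \<le> M) \<and>
       (let e = (\<lambda>t. (h \<circ> x) t - yref t) in
          \<forall>t\<ge>t0. e differentiable (at t within {t0..}) \<and>
             \<bar>e t\<bar> < \<psi>0 t \<and> \<bar>D1 {t0..} e t\<bar> < \<psi>1 t \<and>
             (t, e t) \<in> funnel \<psi>0 \<and> (t, D1 {t0..} e t) \<in> funnel \<psi>1))"
proof -
  have G0: "\<psi>0 \<in> G0" "\<psi>1 \<in> G0" using assms(9) by (auto simp: G1_def)
  obtain \<epsilon> where \<epsilon>: "\<epsilon> > 0" "\<And>t. t \<ge> 0 \<Longrightarrow> \<epsilon> - D1 {0..} \<psi>0 t \<le> \<psi>1 t" using assms(9) by (auto simp: G1_def)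
  obtain d\<psi>0 K0 where \<psi>0: "K0 \<ge> 0" "\<And>t. t \<ge> 0 \<Longrightarrow> (\<psi>0 has_vector_derivative d\<psi>0 t) (at t within {0..})"
    "\<And>t. t \<ge> 0 \<Longrightarrow> \<bar>\<psi>0 t\<bar> \<le> K0" "\<And>t. t \<ge> 0 \<Longrightarrow> \<bar>d\<psi>0 t\<bar> \<le> K0"
    "\<And>s t. s \<ge> 0 \<Longrightarrow> t \<ge> 0 \<Longrightarrow> \<bar>d\<psi>0 s - d\<psi>0 t\<bar> \<le> K0 * \<bar>s - t\<bar>"
    by (rule W2inf_regular[of \<psi>0]) (use G0 in \<open>auto simp: G0_def\<close>)
  obtain d\<psi>1 K1 where \<psi>1: "K1 \<ge> 0" "\<And>t. t \<ge> 0 \<Longrightarrow> (\<psi>1 has_vector_derivative d\<psi>1 t) (at t within {0..})"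
    "\<And>t. t \<ge> 0 \<Longrightarrow> \<bar>\<psi>1 t\<bar> \<le> K1" "\<And>t. t \<ge> 0 \<Longrightarrow> \<bar>d\<psi>1 t\<bar> \<le> K1"
    "\<And>s t. s \<ge> 0 \<Longrightarrow> t \<ge> 0 \<Longrightarrow> \<bar>d\<psi>1 s - d\<psi>1 t\<bar> \<le> K1 * \<bar>s - t\<bar>"
    by (rule W2inf_regular[of \<psi>1]) (use G0 in \<open>auto simp: G0_def\<close>)
  obtain dyref Ky where y: "Ky \<ge> 0" "\<And>t. t \<ge> 0 \<Longrightarrow> (yref has_vector_derivative dyref t) (at t within {0..})"
    "\<And>t. t \<ge> 0 \<Longrightarrow> \<bar>yref t\<bar> \<le> Ky" "\<And>t. t \<ge> 0 \<Longrightarrow> \<bar>dyref t\<bar> \<le> Ky"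
    "\<And>s t. s \<ge> 0 \<Longrightarrow> t \<ge> 0 \<Longrightarrow> \<bar>dyref s - dyref t\<bar> \<le> Ky * \<bar>s - t\<bar>"
    by (rule W2inf_regular[OF assms(10)]) blast
  define K where "K = max K0 (max K1 Ky)"
  have K: "K0 \<le> K" "K1 \<le> K" "Ky \<le> K" by (auto simp: K_def)
  have Km: "a * \<bar>r\<bar> \<le> K * \<bar>r\<bar>" if "a \<le> K" for a r :: real using that by (intro mult_right_mono) auto
  define m where "m = min (INF t\<in>{0..}. \<psi>0 t) (INF t\<in>{0..}. \<psi>1 t)"
  have m: "m > 0" using G0 by (simp add: m_def G0_def)
  have "bdd_below (\<psi>0 ` {0..})" by (rule bdd_belowI2[of _ "- K0"]) (use \<psi>0(3) in \<open>force simp: abs_le_iff\<close>)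
  then have m0: "m \<le> \<psi>0 t" if "t \<ge> 0" for t using that cINF_lower[of \<psi>0 "{0..}" t] by (simp add: m_def)
  have "bdd_below (\<psi>1 ` {0..})" by (rule bdd_belowI2[of _ "- K1"]) (use \<psi>1(3) in \<open>force simp: abs_le_iff\<close>)
  then have m1: "m \<le> \<psi>1 t" if "t \<ge> 0" for t using that cINF_lower[of \<psi>1 "{0..}" t] by (simp add: m_def)
  define \<gamma> where "\<gamma> = lie g (lie f h) \<circ> inv \<Phi>"
  have \<Phi>: "bij \<Phi>" "continuous_on UNIV \<Phi>" "continuous_on UNIV (inv \<Phi>)"
    using assms(6) C_k_Suc_imp[of 0 \<Phi>] C_k_Suc_imp[of 0 "inv \<Phi>"] by (auto simp: diffeomorphism_def)
  interpret fmpc \<psi>0 d\<psi>0 \<psi>1 K m "min \<epsilon> m" f g h \<Phi> p \<gamma> q i0 i1 yref dyref lu t0 \<delta> B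
  proof
    show "C_k 1 f" "C_k 1 g" using assms(1,2) C_k_mono[of 2 _ 1] by auto
    show "\<gamma> = lie g (lie f h) \<circ> inv \<Phi>" by (rule \<gamma>_def)
    show "continuous_on UNIV \<gamma>"
      unfolding \<gamma>_def o_def
      by (rule continuous_on_compose2[OF continuous_on_lie_lie[OF assms(1-3)] \<Phi>(3)]) auto
    show "\<gamma> z \<noteq> 0" for z using assms(4) by (simp add: \<gamma>_def relative_degree_two_def)
    show "min \<epsilon> m - d\<psi>0 t \<le> \<psi>1 t" if "t \<ge> 0" for t
      using \<epsilon>(2)[OF that] D1_Ici[OF \<psi>0(2)[OF that] that] by simp
    show "\<bar>\<psi>1 s - \<psi>1 t\<bar> \<le> K * \<bar>s - t\<bar>" if "s \<ge> 0" "t \<ge> 0" for s t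
      using order_trans[OF derivative_bound_lipschitz[OF \<psi>1(2,4) that] Km[OF K(2)]] .
    show "\<bar>d\<psi>0 s - d\<psi>0 t\<bar> \<le> K * \<bar>s - t\<bar>" if "s \<ge> 0" "t \<ge> 0" for s t
      using order_trans[OF \<psi>0(5)[OF that] Km[OF K(1)]] .
    show "\<bar>dyref s - dyref t\<bar> \<le> K * \<bar>s - t\<bar>" if "s \<ge> 0" "t \<ge> 0" for s t
      using order_trans[OF y(5)[OF that] Km[OF K(3)]] .
    show "\<psi>0 t \<le> K" "\<psi>1 t \<le> K" "\<bar>d\<psi>0 t\<bar> \<le> K" "\<bar>yref t\<bar> \<le> K" "\<bar>dyref t\<bar> \<le> K" if "t \<ge> 0" for t
      using \<psi>0(3,4)[OF that] \<psi>1(3)[OF that] y(3,4)[OF that] K by auto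
  qed (use assms m \<epsilon> m0 m1 \<psi>0(2) y(2) \<Phi> in auto)
  obtain Ms where Ms: "2 * K \<le> Ms" "\<And>z. z \<in> B \<Longrightarrow> safe_state Ms t0 z" by (rule initial_safe) blast
  have "0 \<le> Ms" using Ms(1) K_pos by simp
  then obtain M where M: "M > 0" "steerable Ms M" by (rule steerable_exists)
  note main = fmpc_main[OF M(2,1) Ms refl]
  have "fmpc_feasible f g h (\<psi>0, \<psi>1) yref lu t0 \<delta> (\<delta> + 1) M x0 \<and>
    (\<exists>\<mu> x. fmpc_closed_loop f g h (\<psi>0, \<psi>1) yref lu t0 \<delta> (\<delta> + 1) M x0 \<mu> x) \<and>
    (\<forall>\<mu> x. fmpc_closed_loop f g h (\<psi>0, \<psi>1) yref lu t0 \<delta> (\<delta> + 1) M x0 \<mu> x \<longrightarrow>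
       (\<forall>t\<ge>t0. \<bar>fmpc_input t0 \<delta> \<mu> x t\<bar> \<le> M) \<and>
       (let e = (\<lambda>t. (h \<circ> x) t - yref t) in
          \<forall>t\<ge>t0. e differentiable (at t within {t0..}) \<and>
             \<bar>e t\<bar> < \<psi>0 t \<and> \<bar>D1 {t0..} e t\<bar> < \<psi>1 t \<and>
             (t, e t) \<in> funnel \<psi>0 \<and> (t, D1 {t0..} e t) \<in> funnel \<psi>1))"
    if x0: "\<Phi> x0 \<in> B" for x0
  proof (intro conjI allI impI)
    show "fmpc_feasible f g h (\<psi>0, \<psi>1) yref lu t0 \<delta> (\<delta> + 1) M x0" by (rule main(1)[OF _ x0])
    show "\<exists>\<mu> x. fmpc_closed_loop f g h (\<psi>0, \<psi>1) yref lu t0 \<delta> (\<delta> + 1) M x0 \<mu> x" by (rule main(2)[OF _ x0])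
    fix \<mu> x assume cl: "fmpc_closed_loop f g h (\<psi>0, \<psi>1) yref lu t0 \<delta> (\<delta> + 1) M x0 \<mu> x"
    note props = main(3)[OF _ x0 cl]
    show "\<bar>fmpc_input t0 \<delta> \<mu> x t\<bar> \<le> M" if "t0 \<le> t" for t using props that by blast
    show "let e = (\<lambda>t. (h \<circ> x) t - yref t) in
          \<forall>t\<ge>t0. e differentiable (at t within {t0..}) \<and>
             \<bar>e t\<bar> < \<psi>0 t \<and> \<bar>D1 {t0..} e t\<bar> < \<psi>1 t \<and>
             (t, e t) \<in> funnel \<psi>0 \<and> (t, D1 {t0..} e t) \<in> funnel \<psi>1"
      unfolding Let_def
    proof (intro allI impI)
      fix t assume t: "t0 \<le> t"
      let ?e = "\<lambda>t. (h \<circ> x) t - yref t"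
      have "(yref has_vector_derivative dyref t) (at t within {t0..})"
        by (rule has_vector_derivative_within_subset[OF y(2)]) (use t assms(12) in auto)
      then have d: "(?e has_vector_derivative \<Phi> (x t) $ i1 - dyref t) (at t within {t0..})"
        using has_vector_derivative_diff[of "h \<circ> x"] props t by blast
      have D: "D1 {t0..} ?e t = \<Phi> (x t) $ i1 - dyref t" by (rule D1_Ici[OF d t])
      have "in_funnel t (\<Phi> (x t))" using props t by blast
      then have "\<bar>?e t\<bar> < \<psi>0 t" "\<bar>D1 {t0..} ?e t\<bar> < \<psi>1 t"
        unfolding D by (auto simp: in_funnel_def \<Phi>_output)
      moreover have "?e differentiable (at t within {t0..})"
        using d by (rule differentiableI_vector)
      ultimately show "?e differentiable (at t within {t0..}) \<and>
             \<bar>?e t\<bar> < \<psi>0 t \<and> \<bar>D1 {t0..} ?e t\<bar> < \<psi>1 t \<and>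
             (t, ?e t) \<in> funnel \<psi>0 \<and> (t, D1 {t0..} ?e t) \<in> funnel \<psi>1"
        using t assms(12) by (auto simp: funnel_def)
    qed
  qed
  then show ?thesis using M(1) by (intro exI[of _ "\<delta> + 1"] exI[of _ M]) auto
qed

end
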